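(* Let $(\mathrm U_q(\mathfrak q),\mathrm U_q(\mathfrak k))\supseteq(\mathrm U_q(\mathfrak p),\mathrm U_q(\mathfrak l))$ be compatible pairs of quantum sub-superalgebras of $\mathrm U_q(\mathfrak{gl}_{m|n})$. Then the induction functor $\mathrm I_{\mathfrak p,\mathfrak l}^{\mathfrak q,\mathfrak k}:\mathcal C(\mathfrak p,\mathfrak l)\to\mathcal C(\mathfrak q,\mathfrak k)$ is left exact.
   Context: **Algebra.** Let $m,n$ be positive integers, $\mathbf I=\{1,\dots,m+n\}$, $\mathbf I'=\{1,\dots,m+n-1\}$, $\mathfrak g=\mathfrak{gl}_{m|n}$ (complex), $\mathfrak h$ the diagonal Cartan subalgebra, $\{\epsilon_a\}$ the basis of $\mathfrak h^*$ dual to the diagonal matrix units, with $(\epsilon_a,\epsilon_b)=\delta_{ab}$ for $a\le m$ and $-\delta_{ab}$ for $a>m$; $\mathfrak h^*_{\mathbb Z}=\bigoplus_a\mathbb Z\epsilon_a$. Let $q$ be an indeterminate, $q_a=q$ for $a\le m$, $q_a=q^{-1}$ for $a>m$. $[x]\in\mathbb Z_2$ denotes parity. $\mathrm U_q(\mathfrak g)$ is the unital associative superalgebra over $\mathbb C(q)$ generated by $E_{a,a+1},E_{a+1,a}$ ($a\in\mathbf I'$), $K_b^{\pm1}$ ($b\in\mathbf I$), with $E_{m,m+1},E_{m+1,m}$ odd and the other generators even, and relations (whenever indices make sense): $K_aK_a^{-1}=1$, the $K_a^{\pm1}$ commute; $K_aE_{b,b\pm1}K_a^{-1}=q^{(\epsilon_a,\epsilon_b-\epsilon_{b\pm1})}E_{b,b\pm1}$;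 $E_{a,a+1}E_{b+1,b}-(-1)^{\delta_{am}\delta_{bm}}E_{b+1,b}E_{a,a+1}=\delta_{ab}\frac{K_aK_{a+1}^{-1}-K_a^{-1}K_{a+1}}{q_a-q_a^{-1}}$; $E_{m,m+1}^2=E_{m+1,m}^2=0$; $E_{a,a+1}E_{b,b+1}=E_{b,b+1}E_{a,a+1}$ and $E_{a+1,a}E_{b+1,b}=E_{b+1,b}E_{a+1,a}$ for $|a-b|\ge2$; for $a\ne m$, $x^2y-(q+q^{-1})xyx+yx^2=0$ for $(x,y)=(E_{a,a+1},E_{a\pm1,a+1\pm1})$ and $(E_{a+1,a},E_{a+1\pm1,a\pm1})$; $E_{m-1,m+2}E_{m,m+1}+E_{m,m+1}E_{m-1,m+2}=0=E_{m+2,m-1}E_{m+1,m}+E_{m+1,m}E_{m+2,m-1}$, where for $a<c<b$ $E_{ab}=E_{ac}E_{cb}-q_c^{-1}E_{cb}E_{ac}$, $E_{ba}=E_{bc}E_{ca}-q_cE_{ca}E_{bc}$ (independent of $c$). It is a Hopf superalgebra with $\Delta(E_{a,a+1})=E_{a,a+1}\otimes K_aK_{a+1}^{-1}+1\otimes E_{a,a+1}$, $\Delta(E_{a+1,a})=E_{a+1,a}\otimes1+K_a^{-1}K_{a+1}\otimes E_{a+1,a}$, $\Delta(K_a^{\pm1})=K_a^{\pm1}\otimes K_a^{\pm1}$ and the corresponding counit and antipode. **Sub-superalgebras.** For $\Theta_\pm\subseteq\mathbf I'$ one has the quantum sub-superalgebra generated by all $K_b^{\pm1}$, the $E_{a,a+1}$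 with $a\in\Theta_+$ and the $E_{a+1,a}$ with $a\in\Theta_-$. It is reductive if $\Theta_+=\Theta_-$, parabolic if $\Theta_+=\mathbf I'$ or $\Theta_-=\mathbf I'$. A pair $(\mathrm U_q(\mathfrak q),\mathrm U_q(\mathfrak k))$ consists of a parabolic or reductive $\mathrm U_q(\mathfrak q)$ and a reductive $\mathrm U_q(\mathfrak k)\subseteq\mathrm U_q(\mathfrak q)$. Pairs are compatible, $(\mathrm U_q(\mathfrak q),\mathrm U_q(\mathfrak k))\supseteq(\mathrm U_q(\mathfrak p),\mathrm U_q(\mathfrak l))$, if $\mathrm U_q(\mathfrak q)\supseteq\mathrm U_q(\mathfrak p)$ and $\mathrm U_q(\mathfrak k)\supseteq\mathrm U_q(\mathfrak l)$. **Modules and functors.** All modules are $\mathbb Z_2$-graded. $\mathrm{Hom}_{\mathrm U}(V,W)$ is the $\mathbb Z_2$-graded space of linear maps with $\phi(xv)=(-1)^{[x][\phi]}x\phi(v)$. An integral weight vector of weight $\mu\in\mathfrak h^*_{\mathbb Z}$ is $v$ with $K_av=q^{(\mu,\epsilon_a)}v$ for all $a$. For a pair, $\mathcal C(\mathfrak q,\mathfrak k)$ is the (abelian) category, with even morphisms, of $\mathrm U_q(\mathfrak q)$-modules spanned by integral weight vectors $v$ with $\dim\mathrm U_q(\mathfrak k)v<\infty$ (called $\mathrm U_q(\mathfrak k)$-finite). For compatible pairs, the induction functor $\mathrm I_{\mathfrak p,\mathfrak l}^{\mathfrak q,\mathfrak k}$ sends $V$ to the sum of all $\mathrm U_q(\mathfrak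 k)$-finite graded $\mathrm U_q(\mathfrak q)$-submodules of $\mathrm{Hom}_{\mathrm U_q(\mathfrak p)}(\mathrm U_q(\mathfrak q),V)$, where $\langle y\zeta,x\rangle=(-1)^{[y]([x]+[\zeta])}\langle\zeta,xy\rangle$, and acts on morphisms by post-composition. *)

theory Defs
  imports
    "HOL-Library.Poly_Mapping"
    "HOL-Library.FuncSet"
    "HOL-Library.Z2"
    "HOL-Computational_Algebra.Polynomial"
    "HOL-Computational_Algebra.Fraction_Field"
    "HOL-Algebra.QuotRing"
    "HOL-Algebra.Generated_Groups"
    "HOL-Algebra.Generated_Rings"
begin

section \<open>The quantum superalgebra\<close>

type_synonym cq = "complex poly fract"

definition qq :: cq where
  "qq = Fract [:0, 1:] 1"

definition qa :: "nat \<Rightarrow> nat \<Rightarrow> cq" where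
  "qa m a = (if a \<le> m then qq else inverse qq)"

definition idx :: "nat \<Rightarrow> nat \<Rightarrow> nat set" where
  "idx m n = {1..m + n}"

definition idx' :: "nat \<Rightarrow> nat \<Rightarrow> nat set" where
  "idx' m n = {1..m + n - 1}"

text \<open>An integral weight \<open>\<Sum>\<^sub>a \<mu>\<^sub>a \<epsilon>\<^sub>a\<close> is given by its coefficients; only the
  values on \<open>idx m n\<close> matter.\<close>

type_synonym weight = "nat \<Rightarrow> int"

definition eps :: "nat \<Rightarrow> weight" where
  "eps a = (\<lambda>b. if b = a then 1 else 0)"

definition bform :: "nat \<Rightarrow> nat \<Rightarrow> weight \<Rightarrow> weight \<Rightarrow> int" where
  "bform m n \<mu> \<nu> = (\<Sum>a\<in>idx m n. (if a \<le> m then 1 else - 1) * \<mu> a * \<nu> a)"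

text \<open>\<open>GenE a b\<close> is only used for \<open>|a - b| = 1\<close>.\<close>

datatype qgen = GenE nat nat | GenK nat | GenKinv nat

text \<open>The free monoid on the generators, written additively, so that
  \<open>Poly_Mapping\<close> supplies the multiplication of the free associative algebra
  \<open>\<complex>(q)\<langle>qgen\<rangle>\<close>.\<close>

datatype qword = Word (letters: "qgen list")

instantiation qword :: monoid_add
begin

definition zero_qword :: qword where
  "0 = Word []"

definition plus_qword :: "qword \<Rightarrow> qword \<Rightarrow> qword" where
  "v + w = Word (letters v @ letters w)"

instance
  by standard (auto simp: zero_qword_def plus_qword_def)

end

type_synonym qfree = "qword \<Rightarrow>\<^sub>0 cq"

definition gen :: "qgen \<Rightarrow> qfree" where
  "gen g = Poly_Mapping.single (Word [g]) 1"

definition const :: "cq \<Rightarrow> qfree" where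
  "const c = Poly_Mapping.single 0 c"

abbreviation fE :: "nat \<Rightarrow> nat \<Rightarrow> qfree" where
  "fE a b \<equiv> gen (GenE a b)"

abbreviation fK :: "nat \<Rightarrow> qfree" where
  "fK a \<equiv> gen (GenK a)"

abbreviation fKinv :: "nat \<Rightarrow> qfree" where
  "fKinv a \<equiv> gen (GenKinv a)"

definition gens :: "nat \<Rightarrow> nat \<Rightarrow> qgen set" where
  "gens m n = {GenE a (Suc a) | a. a \<in> idx' m n} \<union> {GenE (Suc a) a | a. a \<in> idx' m n}
     \<union> GenK ` idx m n \<union> GenKinv ` idx m n"

definition free_alg :: "nat \<Rightarrow> nat \<Rightarrow> qfree ring" where
  "free_alg m n = \<lparr>carrier = {x. \<forall>w\<in>Poly_Mapping.keys x. set (letters w) \<subseteq> gens m n},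
     mult = (*), one = 1, zero = 0, add = (+)\<rparr>"

text \<open>\<open>root_up m a k\<close> is \<open>E\<^bsub>a,a+k+1\<^esub>\<close> and \<open>root_down m a k\<close> is \<open>E\<^bsub>a+k+1,a\<^esub>\<close>, both
  obtained from the recursion for \<open>E\<^bsub>ab\<^esub>\<close> by splitting at \<open>c = a + 1\<close>.\<close>

primrec root_up :: "nat \<Rightarrow> nat \<Rightarrow> nat \<Rightarrow> qfree" where
  "root_up m a 0 = fE a (Suc a)"
| "root_up m a (Suc k) = fE a (Suc a) * root_up m (Suc a) k
     - const (inverse (qa m (Suc a))) * root_up m (Suc a) k * fE a (Suc a)"

primrec root_down :: "nat \<Rightarrow> nat \<Rightarrow> nat \<Rightarrow> qfree" where
  "root_down m a 0 = fE (Suc a) a"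
| "root_down m a (Suc k) = root_down m (Suc a) k * fE (Suc a) a
     - const (qa m (Suc a)) * fE (Suc a) a * root_down m (Suc a) k"

definition serre :: "qfree \<Rightarrow> qfree \<Rightarrow> qfree" where
  "serre x y = x * x * y - const (qq + inverse qq) * x * y * x + y * x * x"

text \<open>Each element listed below is a relator, i.e. is set to zero. In the quantum
  Serre relators, \<open>b = Suc a \<or> a = Suc b\<close> stands for \<open>b = a \<plusminus> 1\<close>.\<close>

definition relators :: "nat \<Rightarrow> nat \<Rightarrow> qfree set" where
  "relators m n =
     {fK a * fKinv a - 1 | a. a \<in> idx m n}
   \<union> {x * y - y * x | x y. x \<in> fK ` idx m n \<union> fKinv ` idx m n
        \<and> y \<in> fK ` idx m n \<union> fKinv ` idx m n}
   \<union> {fK a * fE b c * fKinv a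
        - const (qq powi bform m n (eps a) (\<lambda>i. eps b i - eps c i)) * fE b c | a b c.
        a \<in> idx m n \<and> b \<in> idx m n \<and> c \<in> idx m n \<and> (c = Suc b \<or> b = Suc c)}
   \<union> {fE a (Suc a) * fE (Suc b) b
        - (if a = m \<and> b = m then - 1 else 1) * (fE (Suc b) b * fE a (Suc a))
        - (if a = b then const (inverse (qa m a - inverse (qa m a)))
             * (fK a * fKinv (Suc a) - fKinv a * fK (Suc a)) else 0) | a b.
        a \<in> idx' m n \<and> b \<in> idx' m n}
   \<union> {fE m (Suc m) * fE m (Suc m), fE (Suc m) m * fE (Suc m) m}
   \<union> {fE a (Suc a) * fE b (Suc b) - fE b (Suc b) * fE a (Suc a) | a b.
        a \<in> idx' m n \<and> b \<in> idx' m n \<and> \<bar>int a - int b\<bar> \<ge> 2}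
   \<union> {fE (Suc a) a * fE (Suc b) b - fE (Suc b) b * fE (Suc a) a | a b.
        a \<in> idx' m n \<and> b \<in> idx' m n \<and> \<bar>int a - int b\<bar> \<ge> 2}
   \<union> {serre (fE a (Suc a)) (fE b (Suc b)) | a b.
        a \<in> idx' m n \<and> b \<in> idx' m n \<and> a \<noteq> m \<and> (b = Suc a \<or> a = Suc b)}
   \<union> {serre (fE (Suc a) a) (fE (Suc b) b) | a b.
        a \<in> idx' m n \<and> b \<in> idx' m n \<and> a \<noteq> m \<and> (b = Suc a \<or> a = Suc b)}
   \<union> (if m \<ge> 2 \<and> n \<ge> 2 then
        {root_up m (m - 1) 2 * fE m (Suc m) + fE m (Suc m) * root_up m (m - 1) 2,
         root_down m (m - 1) 2 * fE (Suc m) m + fE (Suc m) m * root_down m (m - 1) 2}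
      else {})"

definition rel_ideal :: "nat \<Rightarrow> nat \<Rightarrow> qfree set" where
  "rel_ideal m n = Idl\<^bsub>free_alg m n\<^esub> (relators m n)"

type_synonym uq = "qfree set"

definition uq_class :: "nat \<Rightarrow> nat \<Rightarrow> qfree \<Rightarrow> uq" where
  "uq_class m n x = rel_ideal m n +>\<^bsub>free_alg m n\<^esub> x"

definition gen_parity :: "nat \<Rightarrow> qgen \<Rightarrow> bit" where
  "gen_parity m g = (if g = GenE m (Suc m) \<or> g = GenE (Suc m) m then 1 else 0)"

definition word_parity :: "nat \<Rightarrow> qword \<Rightarrow> bit" where
  "word_parity m w = sum_list (map (gen_parity m) (letters w))"

text \<open>\<open>hpart M p\<close> is the set of homogeneous elements of parity \<open>p\<close> (including zero).\<close>

record 'a superring = "'a ring" +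
  hpart :: "bit \<Rightarrow> 'a set"

text \<open>The scalars \<open>\<complex>(q)\<close> are the classes of \<open>const c\<close>, so that a unital module over
  (a subalgebra of) \<open>Uq m n\<close> is automatically a \<open>\<complex>(q)\<close>-vector space.\<close>

definition Uq :: "nat \<Rightarrow> nat \<Rightarrow> uq superring" where
  "Uq m n = ring.extend (free_alg m n Quot rel_ideal m n)
     (superring.fields (\<lambda>p. {uq_class m n x | x. x \<in> carrier (free_alg m n)
        \<and> (\<forall>w\<in>Poly_Mapping.keys x. word_parity m w = p)}))"

definition uq_scalar :: "nat \<Rightarrow> nat \<Rightarrow> cq \<Rightarrow> uq" where
  "uq_scalar m n c = uq_class m n (const c)"

definition uq_gen :: "nat \<Rightarrow> nat \<Rightarrow> qgen \<Rightarrow> uq" where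
  "uq_gen m n g = uq_class m n (gen g)"


section \<open>Sub-superalgebras\<close>

definition Uq_sub :: "nat \<Rightarrow> nat \<Rightarrow> nat set \<Rightarrow> nat set \<Rightarrow> uq superring" where
  "Uq_sub m n \<Theta>p \<Theta>m =
     (let A = generate_ring (Uq m n) (range (uq_scalar m n)
        \<union> uq_gen m n ` (GenK ` idx m n \<union> GenKinv ` idx m n
            \<union> {GenE a (Suc a) | a. a \<in> \<Theta>p} \<union> {GenE (Suc a) a | a. a \<in> \<Theta>m}))
      in (Uq m n)\<lparr>carrier := A, hpart := \<lambda>p. hpart (Uq m n) p \<inter> A\<rparr>)"

definition reductive_sub :: "nat \<Rightarrow> nat \<Rightarrow> uq superring \<Rightarrow> bool" where
  "reductive_sub m n A \<longleftrightarrow> (\<exists>\<Theta>\<subseteq>idx' m n. A = Uq_sub m n \<Theta> \<Theta>)"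

definition parabolic_sub :: "nat \<Rightarrow> nat \<Rightarrow> uq superring \<Rightarrow> bool" where
  "parabolic_sub m n A \<longleftrightarrow> (\<exists>\<Theta>p\<subseteq>idx' m n. \<exists>\<Theta>m\<subseteq>idx' m n.
     (\<Theta>p = idx' m n \<or> \<Theta>m = idx' m n) \<and> A = Uq_sub m n \<Theta>p \<Theta>m)"

definition uq_pair :: "nat \<Rightarrow> nat \<Rightarrow> uq superring \<Rightarrow> uq superring \<Rightarrow> bool" where
  "uq_pair m n Q K \<longleftrightarrow> (parabolic_sub m n Q \<or> reductive_sub m n Q) \<and> reductive_sub m n K
     \<and> carrier K \<subseteq> carrier Q"

definition compatible_pairs ::
  "nat \<Rightarrow> nat \<Rightarrow> uq superring \<Rightarrow> uq superring \<Rightarrow> uq superring \<Rightarrow> uq superring \<Rightarrow> bool" where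
  "compatible_pairs m n Q K P L \<longleftrightarrow> uq_pair m n Q K \<and> uq_pair m n P L
     \<and> carrier P \<subseteq> carrier Q \<and> carrier L \<subseteq> carrier K"


section \<open>Supermodules and graded homomorphisms\<close>

text \<open>As in \<open>HOL-Algebra.Module\<close>, the module record extends the ring record; the
  fields \<open>mult\<close> and \<open>one\<close> of a module are not used.\<close>

record ('a, 'b) smodule = "'b superring" +
  act :: "'a \<Rightarrow> 'b \<Rightarrow> 'b" (infixl "\<rhd>\<index>" 70)

locale supermodule = abelian_group M
  for R :: "('a, 'r) superring_scheme" and M :: "('a, 'b, 'c) smodule_scheme" (structure) +
  assumes act_closed: "\<lbrakk>x \<in> carrier R; v \<in> carrier M\<rbrakk> \<Longrightarrow> x \<rhd> v \<in> carrier M"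
    and act_add_left: "\<lbrakk>x \<in> carrier R; y \<in> carrier R; v \<in> carrier M\<rbrakk>
      \<Longrightarrow> (x \<oplus>\<^bsub>R\<^esub> y) \<rhd> v = (x \<rhd> v) \<oplus> (y \<rhd> v)"
    and act_add_right: "\<lbrakk>x \<in> carrier R; v \<in> carrier M; w \<in> carrier M\<rbrakk>
      \<Longrightarrow> x \<rhd> (v \<oplus> w) = (x \<rhd> v) \<oplus> (x \<rhd> w)"
    and act_mult: "\<lbrakk>x \<in> carrier R; y \<in> carrier R; v \<in> carrier M\<rbrakk>
      \<Longrightarrow> (x \<otimes>\<^bsub>R\<^esub> y) \<rhd> v = x \<rhd> (y \<rhd> v)"
    and act_one: "v \<in> carrier M \<Longrightarrow> \<one>\<^bsub>R\<^esub> \<rhd> v = v"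
    and hpart_subgroup: "additive_subgroup (hpart M p) M"
    and hpart_decomp: "v \<in> carrier M
      \<Longrightarrow> \<exists>!w. w \<in> hpart M 0 \<times> hpart M 1 \<and> v = fst w \<oplus> snd w"
    and act_parity: "\<lbrakk>x \<in> hpart R p; v \<in> hpart M r\<rbrakk> \<Longrightarrow> x \<rhd> v \<in> hpart M (p + r)"

definition hcomp :: "('b, 'r) superring_scheme \<Rightarrow> bit \<Rightarrow> 'b \<Rightarrow> 'b" where
  "hcomp M p v = (THE a. a \<in> hpart M p \<and> (\<exists>b\<in>hpart M (p + 1). v = a \<oplus>\<^bsub>M\<^esub> b))"

text \<open>\<open>ssign M s v\<close> is \<open>(-1)\<^sup>s v\<close>.\<close>

definition ssign :: "('b, 'r) superring_scheme \<Rightarrow> bit \<Rightarrow> 'b \<Rightarrow> 'b" where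
  "ssign M s v = (if s = 1 then \<ominus>\<^bsub>M\<^esub> v else v)"

text \<open>Homogeneous homomorphisms of parity \<open>d\<close>. They are \<open>\<complex>(q)\<close>-linear because the
  scalars are even elements of the superalgebra acting. Maps are extensional, so
  that equality of maps is equality on the carrier.\<close>

definition super_hom_deg :: "('a, 'r) superring_scheme \<Rightarrow> ('a, 'b) smodule \<Rightarrow> ('a, 'c) smodule
    \<Rightarrow> bit \<Rightarrow> ('b \<Rightarrow> 'c) set" where
  "super_hom_deg R V W d = {\<phi> \<in> carrier V \<rightarrow>\<^sub>E carrier W.
     (\<forall>v\<in>carrier V. \<forall>w\<in>carrier V. \<phi> (v \<oplus>\<^bsub>V\<^esub> w) = \<phi> v \<oplus>\<^bsub>W\<^esub> \<phi> w)
     \<and> (\<forall>p. \<phi> ` hpart V p \<subseteq> hpart W (p + d))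
     \<and> (\<forall>p. \<forall>x\<in>hpart R p. \<forall>v\<in>carrier V.
          \<phi> (x \<rhd>\<^bsub>V\<^esub> v) = ssign W (p * d) (x \<rhd>\<^bsub>W\<^esub> \<phi> v))}"

definition super_hom :: "('a, 'r) superring_scheme \<Rightarrow> ('a, 'b) smodule \<Rightarrow> ('a, 'c) smodule
    \<Rightarrow> ('b \<Rightarrow> 'c) superring" where
  "super_hom R V W =
     \<lparr>carrier = {\<lambda>v\<in>carrier V. \<phi> v \<oplus>\<^bsub>W\<^esub> \<psi> v | \<phi> \<psi>.
        \<phi> \<in> super_hom_deg R V W 0 \<and> \<psi> \<in> super_hom_deg R V W 1},
      mult = undefined, one = undefined,
      zero = (\<lambda>v\<in>carrier V. \<zero>\<^bsub>W\<^esub>),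
      add = (\<lambda>\<phi> \<psi>. \<lambda>v\<in>carrier V. \<phi> v \<oplus>\<^bsub>W\<^esub> \<psi> v),
      hpart = super_hom_deg R V W\<rparr>"

definition restrict_module :: "('a, 'b) smodule \<Rightarrow> 'b set \<Rightarrow> ('a, 'b) smodule" where
  "restrict_module M N = M\<lparr>carrier := N, hpart := \<lambda>p. hpart M p \<inter> N\<rparr>"

definition graded_submodule :: "('a, 'r) superring_scheme \<Rightarrow> 'b set \<Rightarrow> ('a, 'b) smodule \<Rightarrow> bool"
  where
  "graded_submodule R N M \<longleftrightarrow> N \<subseteq> carrier M \<and> supermodule R (restrict_module M N)"


section \<open>The categories and the induction functor\<close>

definition weight_vector :: "nat \<Rightarrow> nat \<Rightarrow> (uq, 'v) smodule \<Rightarrow> weight \<Rightarrow> 'v \<Rightarrow> bool" where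
  "weight_vector m n M \<mu> v \<longleftrightarrow> v \<in> carrier M \<and> (\<forall>a\<in>idx m n.
     uq_gen m n (GenK a) \<rhd>\<^bsub>M\<^esub> v = uq_scalar m n (qq powi bform m n \<mu> (eps a)) \<rhd>\<^bsub>M\<^esub> v)"

definition cq_span :: "nat \<Rightarrow> nat \<Rightarrow> (uq, 'v) smodule \<Rightarrow> 'v set \<Rightarrow> 'v set" where
  "cq_span m n M S =
     {(\<Oplus>\<^bsub>M\<^esub>b\<in>B. uq_scalar m n (c b) \<rhd>\<^bsub>M\<^esub> b) | B c. finite B \<and> B \<subseteq> S}"

definition fin_dim :: "nat \<Rightarrow> nat \<Rightarrow> (uq, 'v) smodule \<Rightarrow> 'v set \<Rightarrow> bool" where
  "fin_dim m n M W \<longleftrightarrow> (\<exists>B. finite B \<and> B \<subseteq> carrier M \<and> W = cq_span m n M B)"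

text \<open>The objects of \<open>\<C>(\<qq>, \<kk>)\<close> with carrier in a given type.\<close>

definition cat_C ::
  "nat \<Rightarrow> nat \<Rightarrow> uq superring \<Rightarrow> uq superring \<Rightarrow> (uq, 'v) smodule set" where
  "cat_C m n Q K = {M. supermodule Q M \<and>
     carrier M = cq_span m n M {v. (\<exists>\<mu>. weight_vector m n M \<mu> v)
       \<and> fin_dim m n M ((\<lambda>x. x \<rhd>\<^bsub>M\<^esub> v) ` carrier K)}}"

abbreviation even_hom :: "('a, 'r) superring_scheme \<Rightarrow> ('a, 'b) smodule \<Rightarrow> ('a, 'c) smodule
    \<Rightarrow> ('b \<Rightarrow> 'c) set" where
  "even_hom R V W \<equiv> super_hom_deg R V W 0"

text \<open>\<open>Q\<close> as a left \<open>P\<close>-module.\<close>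

definition regular_module :: "'a superring \<Rightarrow> ('a, 'a) smodule" where
  "regular_module Q = superring.extend Q (smodule.fields (mult Q))"

text \<open>\<open>coind P Q V\<close> is \<open>Hom\<^sub>P(Q, V)\<close> with the action
  \<open>\<langle>y\<zeta>, x\<rangle> = (-1)\<^bsup>[y]([x]+[\<zeta>])\<^esup> \<langle>\<zeta>, xy\<rangle>\<close>, extended from homogeneous to arbitrary
  \<open>y\<close>, \<open>\<zeta>\<close>, \<open>x\<close> by additivity.\<close>

definition coind :: "'a superring \<Rightarrow> 'a superring \<Rightarrow> ('a, 'v) smodule \<Rightarrow> ('a, 'a \<Rightarrow> 'v) smodule" where
  "coind P Q V = (let H = super_hom P (regular_module Q) V in
     superring.extend H (smodule.fields
       (\<lambda>y \<zeta>. \<lambda>x\<in>carrier Q.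
          \<Oplus>\<^bsub>V\<^esub>i\<in>{0, 1}. \<Oplus>\<^bsub>V\<^esub>j\<in>{0, 1}. \<Oplus>\<^bsub>V\<^esub>k\<in>{0, 1}.
            ssign V (i * (j + k)) (hcomp H k \<zeta> (hcomp Q j x \<otimes>\<^bsub>Q\<^esub> hcomp Q i y)))))"

text \<open>A sum of submodules is the additive subgroup generated by their union.\<close>

definition Ind :: "nat \<Rightarrow> nat \<Rightarrow> uq superring \<Rightarrow> uq superring \<Rightarrow> uq superring
    \<Rightarrow> (uq, 'v) smodule \<Rightarrow> (uq, uq \<Rightarrow> 'v) smodule" where
  "Ind m n P Q K V = restrict_module (coind P Q V)
     (generate (add_monoid (coind P Q V))
       (\<Union>{N. graded_submodule Q N (coind P Q V)
             \<and> restrict_module (coind P Q V) N \<in> cat_C m n Q K}))"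

definition Ind_map :: "nat \<Rightarrow> nat \<Rightarrow> uq superring \<Rightarrow> uq superring \<Rightarrow> uq superring
    \<Rightarrow> (uq, 'v) smodule \<Rightarrow> (uq, 'v) smodule \<Rightarrow> ('v \<Rightarrow> 'v) \<Rightarrow> (uq \<Rightarrow> 'v) \<Rightarrow> (uq \<Rightarrow> 'v)" where
  "Ind_map m n P Q K V W f = (\<lambda>\<zeta>\<in>carrier (Ind m n P Q K V). compose (carrier Q) f \<zeta>)"


section \<open>Left exact functors\<close>

text \<open>Categories of supermodules are given by a superalgebra and a set of objects, with
  the even homomorphisms as morphisms. \<open>F\<close> is the object part and
  \<open>\<Phi> V W\<close> the action on morphisms \<open>V \<rightarrow> W\<close>.\<close>

locale additive_functor =
  fixes R :: "'a superring" and \<C> :: "('a, 'v) smodule set"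
    and S :: "'b superring" and \<D> :: "('b, 'w) smodule set"
    and F :: "('a, 'v) smodule \<Rightarrow> ('b, 'w) smodule"
    and \<Phi> :: "('a, 'v) smodule \<Rightarrow> ('a, 'v) smodule \<Rightarrow> ('v \<Rightarrow> 'v) \<Rightarrow> ('w \<Rightarrow> 'w)"
  assumes obj: "V \<in> \<C> \<Longrightarrow> F V \<in> \<D>"
    and mor: "\<lbrakk>V \<in> \<C>; W \<in> \<C>; f \<in> even_hom R V W\<rbrakk> \<Longrightarrow> \<Phi> V W f \<in> even_hom S (F V) (F W)"
    and ident: "V \<in> \<C> \<Longrightarrow> \<Phi> V V (\<lambda>v\<in>carrier V. v) = (\<lambda>z\<in>carrier (F V). z)"
    and comp: "\<lbrakk>V \<in> \<C>; W \<in> \<C>; X \<in> \<C>; f \<in> even_hom R V W; g \<in> even_hom R W X\<rbrakk>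
      \<Longrightarrow> \<Phi> V X (compose (carrier V) g f) = compose (carrier (F V)) (\<Phi> W X g) (\<Phi> V W f)"
    and additive: "\<lbrakk>V \<in> \<C>; W \<in> \<C>; f \<in> even_hom R V W; g \<in> even_hom R V W\<rbrakk>
      \<Longrightarrow> \<Phi> V W (\<lambda>v\<in>carrier V. f v \<oplus>\<^bsub>W\<^esub> g v)
          = (\<lambda>z\<in>carrier (F V). \<Phi> V W f z \<oplus>\<^bsub>F W\<^esub> \<Phi> V W g z)"

text \<open>Exactness of \<open>0 \<rightarrow> A \<rightarrow> B \<rightarrow> C\<close>.\<close>

definition left_exact_seq :: "('a, 'b) smodule \<Rightarrow> ('b \<Rightarrow> 'c) \<Rightarrow> ('a, 'c) smodule
    \<Rightarrow> ('c \<Rightarrow> 'd) \<Rightarrow> ('a, 'd) smodule \<Rightarrow> bool" where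
  "left_exact_seq A f B g C \<longleftrightarrow>
     inj_on f (carrier A) \<and> f ` carrier A = {b \<in> carrier B. g b = \<zero>\<^bsub>C\<^esub>}"

locale left_exact_functor = additive_functor +
  assumes left_exact: "\<lbrakk>A \<in> \<C>; B \<in> \<C>; C \<in> \<C>; f \<in> even_hom R A B; g \<in> even_hom R B C;
      left_exact_seq A f B g C\<rbrakk>
    \<Longrightarrow> left_exact_seq (F A) (\<Phi> A B f) (F B) (\<Phi> B C g) (F C)"

end

(*
  The functor is the composite of coinduction V \<mapsto> Hom_P(Q, V) and the passage to the largest
  submodule lying in the target category. Coinduction is left exact: an element of Hom_P(Q, B)
  killed by g takes values in the image of the injective map f, so f can be inverted pointwise.
  What remains is that the lift of an element of Ind B again lies in Ind A. The preimage of Ind B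
  is isomorphic to a submodule of Ind B, and a submodule of a module spanned by K-finite weight
  vectors is again of this kind: distinct weights have distinct eigenvalues, because q is not a root
  of unity, and subspaces of finite-dimensional spaces are finite-dimensional. That the coinduced
  module is a supermodule at all depends on the parity decomposition of the quantum superalgebra,
  which holds because the relators are homogeneous.
*)
theory Submission
  imports Defs
begin

section \<open>Graded abelian groups\<close>

text \<open>Signs make sense for homogeneous arguments only, while the modules contain arbitrary
  sums: the action on \<open>coind\<close> is an eight-term sum over parities, and an element of its
  carrier is an even map plus an odd map. So each identity is reduced by additivity to homogeneous
  arguments, where one term survives and the sign rule becomes an identity in Z/2. Lifts along
  \<open>f\<close> are likewise built for the two parity components separately. The largest
  submodule is handled through its universal property alone: it is the smallest additive subgroup
  containing every submodule in the category, so claims are checked on those submodules and sums of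
  elements from different ones are never written out. Three closure properties of the category
  enter: under images (the functor acts on morphisms), under sums (it lands in the category), and
  under submodules (lifting). Only the last needs weights to be separated. There, no single
  \<open>K_a\<close> need distinguish all weights at once, and a weight is a function on all
  naturals of which only the values on \<open>idx m n\<close> are visible, so weights are normalised
  first.\<close>

lemma add_bit_self [simp]: "p + p = (0 :: bit)" "p + (p + r) = (r :: bit)"
  by (cases p; cases r; simp)+

text \<open>These rules unfold the operations of \<open>bit\<close> into case distinctions.\<close>

declare add_bit_eq_xor [simp del] mult_bit_eq_and [simp del]

lemma additive_subgroup_iff:
  assumes "abelian_group G"
  shows "additive_subgroup H G \<longleftrightarrow> H \<subseteq> carrier G \<and> \<zero>\<^bsub>G\<^esub> \<in> H
    \<and> (\<forall>x\<in>H. \<forall>y\<in>H. x \<oplus>\<^bsub>G\<^esub> y \<in> H) \<and> (\<forall>x\<in>H. \<ominus>\<^bsub>G\<^esub> x \<in> H)"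
  unfolding additive_subgroup_def subgroup_def by (auto simp: a_inv_def)

lemma additive_subgroupD:
  assumes "abelian_group G" "additive_subgroup H G"
  shows "x \<in> H \<Longrightarrow> x \<in> carrier G" "\<zero>\<^bsub>G\<^esub> \<in> H"
    "\<lbrakk>x \<in> H; y \<in> H\<rbrakk> \<Longrightarrow> x \<oplus>\<^bsub>G\<^esub> y \<in> H" "x \<in> H \<Longrightarrow> \<ominus>\<^bsub>G\<^esub> x \<in> H"
  using assms(2) unfolding additive_subgroup_iff[OF assms(1)] by auto

text \<open>The part of \<open>supermodule\<close> that does not mention an action. Splitting it off
  lets the same facts about \<open>hcomp\<close> serve the superalgebras, the modules, and the
  coinduced group before its module axioms are known.\<close>

locale graded_group = abelian_group M for M :: "('b, 'r) superring_scheme" (structure) +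
  assumes hpart_add_subgroup: "additive_subgroup (hpart M p) M"
    and hpart_ex1: "v \<in> carrier M
      \<Longrightarrow> \<exists>!w. w \<in> hpart M 0 \<times> hpart M 1 \<and> v = fst w \<oplus> snd w"
begin

lemma hpart_carrier: "v \<in> hpart M p \<Longrightarrow> v \<in> carrier M"
  using hpart_add_subgroup[of p] by (auto dest: additive_subgroup.a_subset)

lemma hpart_zero [simp]: "\<zero> \<in> hpart M p"
  using hpart_add_subgroup[of p] by (rule additive_subgroup.zero_closed)

lemma hpart_add: "\<lbrakk>v \<in> hpart M p; w \<in> hpart M p\<rbrakk> \<Longrightarrow> v \<oplus> w \<in> hpart M p"
  using hpart_add_subgroup[of p] by (rule additive_subgroup.a_closed)

lemma hpart_minus: "v \<in> hpart M p \<Longrightarrow> \<ominus> v \<in> hpart M p"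
  using hpart_add_subgroup[of p] unfolding additive_subgroup_iff[OF abelian_group_axioms] by blast

text \<open>The grading axiom fixes the order even, odd. For \<open>p = 1\<close> the two summands
  are swapped before it is applied.\<close>

lemma hpart_unique:
  assumes "a \<in> hpart M p" "b \<in> hpart M (p + 1)" "a' \<in> hpart M p" "b' \<in> hpart M (p + 1)"
    and "a \<oplus> b = a' \<oplus> b'"
  shows "a = a'"
proof (cases "p = 0")
  case True
  have "a \<oplus> b \<in> carrier M" using assms hpart_carrier by simp
  from hpart_ex1[OF this] assms True have "(a, b) = (a', b')"
    by (metis (no_types, lifting) SigmaI add_0 fst_conv snd_conv)
  then show ?thesis by simp
next
  case False
  then have 1: "p = 1" by simp
  have "b \<oplus> a \<in> carrier M" using assms hpart_carrier by simp
  moreover have "b \<oplus> a = b' \<oplus> a'" using assms hpart_carrier a_comm by metis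
  ultimately have "(b, a) = (b', a')" using hpart_ex1[of "b \<oplus> a"] assms 1
    by (metis (no_types, lifting) SigmaI add_bit_self(1) fst_conv snd_conv)
  then show ?thesis by simp
qed

lemma hpart_disjoint:
  assumes "v \<in> hpart M p" "v \<in> hpart M r" "p \<noteq> r"
  shows "v = \<zero>"
proof -
  have r: "r = p + 1" using assms(3) by (cases p; cases r; simp)
  show ?thesis using assms hpart_carrier r
    by (intro hpart_unique[of v p \<zero> \<zero> v]) auto
qed

lemma hcomp_eqI:
  assumes "a \<in> hpart M p" "b \<in> hpart M (p + 1)" "v = a \<oplus> b"
  shows "hcomp M p v = a"
  unfolding hcomp_def using assms hpart_unique by (intro the_equality) auto

lemma hcomp_ex:
  assumes "v \<in> carrier M"
  shows "\<exists>a\<in>hpart M p. \<exists>b\<in>hpart M (p + 1). v = a \<oplus> b"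
proof -
  obtain a b where ab: "a \<in> hpart M 0" "b \<in> hpart M 1" "v = a \<oplus> b"
    using ex1_implies_ex[OF hpart_ex1[OF assms]] by auto
  moreover from ab have "v = b \<oplus> a" using hpart_carrier a_comm by metis
  moreover have "p \<noteq> 0 \<Longrightarrow> p = 1" by simp
  ultimately show ?thesis
    by (cases "p = 0") (force intro: bexI[of _ a] bexI[of _ b], metis add_bit_self(1))
qed

lemma hcomp_hpart: "v \<in> carrier M \<Longrightarrow> hcomp M p v \<in> hpart M p"
  using hcomp_ex hcomp_eqI by metis

lemma hcomp_closed [simp]: "v \<in> carrier M \<Longrightarrow> hcomp M p v \<in> carrier M"
  using hcomp_hpart hpart_carrier by blast

lemma hcomp_decomp': "v \<in> carrier M \<Longrightarrow> hcomp M p v \<oplus> hcomp M (p + 1) v = v"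
proof -
  assume v: "v \<in> carrier M"
  then obtain a b where ab: "a \<in> hpart M p" "b \<in> hpart M (p + 1)" "v = a \<oplus> b"
    using hcomp_ex by metis
  have "v = b \<oplus> a" using ab hpart_carrier a_comm by metis
  then have "hcomp M (p + 1) v = b" using ab by (intro hcomp_eqI[where b = a]) auto
  with ab show ?thesis using hcomp_eqI by metis
qed

lemma hcomp_decomp: "v \<in> carrier M \<Longrightarrow> hcomp M 0 v \<oplus> hcomp M 1 v = v"
  using hcomp_decomp'[of v 0] by simp

lemma hcomp_homogeneous:
  assumes "v \<in> hpart M p"
  shows "hcomp M r v = (if r = p then v else \<zero>)"
proof (cases "r = p")
  case True
  then show ?thesis using assms hpart_carrier by (auto intro!: hcomp_eqI[of _ _ \<zero>])
next
  case False
  then have "p = r + 1" by (cases p; cases r; simp)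
  then show ?thesis using assms hpart_carrier False by (auto intro!: hcomp_eqI[of _ _ v])
qed

lemma add_interchange:
  "\<lbrakk>a \<in> carrier M; b \<in> carrier M; c \<in> carrier M; d \<in> carrier M\<rbrakk>
    \<Longrightarrow> (a \<oplus> b) \<oplus> (c \<oplus> d) = (a \<oplus> c) \<oplus> (b \<oplus> d)"
  by (simp add: a_ac)

lemma hcomp_add:
  assumes "v \<in> carrier M" "w \<in> carrier M"
  shows "hcomp M p (v \<oplus> w) = hcomp M p v \<oplus> hcomp M p w"
proof (rule hcomp_eqI)
  show "v \<oplus> w = hcomp M p v \<oplus> hcomp M p w \<oplus> (hcomp M (p+1) v \<oplus> hcomp M (p+1) w)"
  proof -
    have "v \<oplus> w = (hcomp M p v \<oplus> hcomp M (p+1) v) \<oplus> (hcomp M p w \<oplus> hcomp M (p+1) w)"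
      using assms by (simp only: hcomp_decomp')
    then show ?thesis using assms by (simp only: add_interchange hcomp_closed)
  qed
qed (use assms hcomp_hpart hpart_add in auto)

text \<open>Every element is the sum of its two homogeneous components, so an additive property has
  to be checked on homogeneous elements only. This is how sign rules are extended to the whole
  carrier.\<close>

lemma graded_induct [consumes 1, case_names homogeneous add]:
  assumes "v \<in> carrier M"
    and "\<And>p w. w \<in> hpart M p \<Longrightarrow> X w"
    and "\<And>a b. \<lbrakk>a \<in> carrier M; b \<in> carrier M; X a; X b\<rbrakk> \<Longrightarrow> X (a \<oplus> b)"
  shows "X v"
  using assms(3)[of "hcomp M 0 v" "hcomp M 1 v"] assms(1,2) hcomp_hpart
  by (metis hcomp_closed hcomp_decomp)

lemma ssign_closed [simp]: "v \<in> carrier M \<Longrightarrow> ssign M s v \<in> carrier M"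
  by (simp add: ssign_def)

lemma ssign_hpart: "v \<in> hpart M p \<Longrightarrow> ssign M s v \<in> hpart M p"
  by (simp add: ssign_def hpart_minus)

lemma ssign_add: "\<lbrakk>v \<in> carrier M; w \<in> carrier M\<rbrakk>
    \<Longrightarrow> ssign M s (v \<oplus> w) = ssign M s v \<oplus> ssign M s w"
  by (simp add: ssign_def minus_add a_comm)

lemma ssign_ssign [simp]: "v \<in> carrier M \<Longrightarrow> ssign M s (ssign M t v) = ssign M (s + t) v"
  by (cases s; cases t; simp add: ssign_def)

lemma ssign_0 [simp]: "ssign M 0 v = v"
  by (simp add: ssign_def)

lemma ssign_zero [simp]: "ssign M s \<zero> = \<zero>"
  by (simp add: ssign_def)

lemma finsum_bit:
  fixes f :: "bit \<Rightarrow> 'b"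
  assumes "f 0 \<in> carrier M" "f 1 \<in> carrier M"
  shows "finsum M f {0, 1} = f 0 \<oplus> f 1"
  using assms by (subst finsum_insert) auto

lemma finsum_bit_single:
  fixes f :: "bit \<Rightarrow> 'b"
  assumes "f p \<in> carrier M" "f (p + 1) = \<zero>"
  shows "finsum M f {0, 1} = f p"
  using assms by (cases p) (auto simp: finsum_bit)

end

text \<open>Uniqueness of the decomposition comes from trivial intersection:
  \<open>a + b = a' + b'\<close> gives \<open>a - a' = b' - b\<close>, an element of both
  parts.\<close>

lemma graded_groupI:
  fixes M (structure)
  assumes "abelian_group M" "\<And>p. additive_subgroup (hpart M p) M"
    and ex: "\<And>v. v \<in> carrier M \<Longrightarrow> \<exists>a\<in>hpart M 0. \<exists>b\<in>hpart M 1. v = a \<oplus> b"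
    and disj: "\<And>v. \<lbrakk>v \<in> hpart M 0; v \<in> hpart M 1\<rbrakk> \<Longrightarrow> v = \<zero>"
  shows "graded_group M"
proof (rule graded_group.intro[OF assms(1)], rule graded_group_axioms.intro)
  interpret abelian_group M by fact
  show "\<exists>!w. w \<in> hpart M 0 \<times> hpart M 1 \<and> v = fst w \<oplus> snd w" if v: "v \<in> carrier M" for v
  proof (rule ex_ex1I)
    show "\<exists>w. w \<in> hpart M 0 \<times> hpart M 1 \<and> v = fst w \<oplus> snd w"
      using ex[OF v] by force
  next
    fix w w'
    assume w: "w \<in> hpart M 0 \<times> hpart M 1 \<and> v = fst w \<oplus> snd w"
      and w': "w' \<in> hpart M 0 \<times> hpart M 1 \<and> v = fst w' \<oplus> snd w'"
    obtain a b where ab: "w = (a, b)" by force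
    obtain a' b' where ab': "w' = (a', b')" by force
    note S = additive_subgroupD[OF assms(1,2)]
    have c: "a \<in> carrier M" "b \<in> carrier M" "a' \<in> carrier M" "b' \<in> carrier M"
      using w w' ab ab' S by auto
    have e: "a \<oplus> b = a' \<oplus> b'" using w w' ab ab' by simp
    have "a \<oplus> \<ominus> a' = b' \<oplus> \<ominus> b"
    proof -
      have "a \<oplus> \<ominus> a' = (a \<oplus> b) \<oplus> (\<ominus> b \<oplus> \<ominus> a')" using c by (simp add: a_assoc r_neg2)
      also have "\<dots> = (b' \<oplus> a') \<oplus> (\<ominus> a' \<oplus> \<ominus> b)" unfolding e using c by (simp add: a_comm)
      also have "\<dots> = b' \<oplus> \<ominus> b" using c by (simp add: a_assoc r_neg2)
      finally show ?thesis .
    qed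
    moreover have "a \<oplus> \<ominus> a' \<in> hpart M 0" using w w' ab ab' S by auto
    moreover have "b' \<oplus> \<ominus> b \<in> hpart M 1" using w w' ab ab' S by auto
    ultimately have z: "a \<oplus> \<ominus> a' = \<zero>" "b' \<oplus> \<ominus> b = \<zero>" using disj by metis+
    have "a = a'" "b' = b" using z c by (metis minus_equality minus_minus a_inv_closed)+
    then show "w = w'" using ab ab' by simp
  qed
qed (rule assms(2))

context supermodule
begin

sublocale graded_group M
  by (rule graded_group.intro[OF abelian_group_axioms], rule graded_group_axioms.intro)
    (fact hpart_subgroup, fact hpart_decomp)

lemma act_zero_right [simp]: "x \<in> carrier R \<Longrightarrow> x \<rhd> \<zero> = \<zero>"
  using act_add_right[of x \<zero> \<zero>] act_closed[of x \<zero>]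
  by (metis add.r_cancel_one zero_closed r_zero)

text \<open>\<open>R\<close> carries no axioms in this locale, so the facts about its zero that the
  cancellation uses have to be supplied.\<close>

lemma act_zero_left:
  assumes "\<zero>\<^bsub>R\<^esub> \<in> carrier R" "\<zero>\<^bsub>R\<^esub> \<oplus>\<^bsub>R\<^esub> \<zero>\<^bsub>R\<^esub> = \<zero>\<^bsub>R\<^esub>" "v \<in> carrier M"
  shows "\<zero>\<^bsub>R\<^esub> \<rhd> v = \<zero>"
  using act_add_left[of "\<zero>\<^bsub>R\<^esub>" "\<zero>\<^bsub>R\<^esub>" v] act_closed[of "\<zero>\<^bsub>R\<^esub>" v] assms
  by (metis add.r_cancel_one)

lemma act_minus_right: "\<lbrakk>x \<in> carrier R; v \<in> carrier M\<rbrakk> \<Longrightarrow> x \<rhd> (\<ominus> v) = \<ominus> (x \<rhd> v)"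
  using act_add_right[of x v "\<ominus> v"] act_closed
  by (metis a_inv_closed act_zero_right minus_equality r_neg a_comm)

lemma act_ssign: "\<lbrakk>x \<in> carrier R; v \<in> carrier M\<rbrakk> \<Longrightarrow> x \<rhd> ssign M s v = ssign M s (x \<rhd> v)"
  by (simp add: ssign_def act_minus_right)

end

lemma supermodule_altI:
  fixes M (structure)
  assumes "graded_group M"
    and "\<And>x v. \<lbrakk>x \<in> carrier R; v \<in> carrier M\<rbrakk> \<Longrightarrow> x \<rhd> v \<in> carrier M"
    and "\<And>x y v. \<lbrakk>x \<in> carrier R; y \<in> carrier R; v \<in> carrier M\<rbrakk>
      \<Longrightarrow> (x \<oplus>\<^bsub>R\<^esub> y) \<rhd> v = (x \<rhd> v) \<oplus> (y \<rhd> v)"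
    and "\<And>x v w. \<lbrakk>x \<in> carrier R; v \<in> carrier M; w \<in> carrier M\<rbrakk>
      \<Longrightarrow> x \<rhd> (v \<oplus> w) = (x \<rhd> v) \<oplus> (x \<rhd> w)"
    and "\<And>x y v. \<lbrakk>x \<in> carrier R; y \<in> carrier R; v \<in> carrier M\<rbrakk>
      \<Longrightarrow> (x \<otimes>\<^bsub>R\<^esub> y) \<rhd> v = x \<rhd> (y \<rhd> v)"
    and "\<And>v. v \<in> carrier M \<Longrightarrow> \<one>\<^bsub>R\<^esub> \<rhd> v = v"
    and "\<And>x v p r. \<lbrakk>x \<in> hpart R p; v \<in> hpart M r\<rbrakk> \<Longrightarrow> x \<rhd> v \<in> hpart M (p + r)"
  shows "supermodule R M"
proof -
  interpret graded_group M by fact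
  show ?thesis
    by (rule supermodule.intro[OF abelian_group_axioms], rule supermodule_axioms.intro)
      (use assms(2-) hpart_add_subgroup hpart_ex1 in auto)
qed

section \<open>Submodules and homomorphisms\<close>

lemma restrict_module_simps [simp]:
  "carrier (restrict_module M N) = N"
  "hpart (restrict_module M N) p = hpart M p \<inter> N"
  "zero (restrict_module M N) = zero M"
  "add (restrict_module M N) = add M"
  "act (restrict_module M N) = act M"
  by (simp_all add: restrict_module_def)

lemma abelian_group_restrict:
  assumes "abelian_group M" "additive_subgroup N M"
  shows "abelian_group (restrict_module M N)"
proof -
  interpret abelian_group M by fact
  note S = additive_subgroupD[OF assms]
  show ?thesis
  proof (rule abelian_groupI)
    show "\<exists>y\<in>carrier (restrict_module M N). y \<oplus>\<^bsub>restrict_module M N\<^esub> x = \<zero>\<^bsub>restrict_module M N\<^esub>"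
      if "x \<in> carrier (restrict_module M N)" for x
      using that S by (auto intro!: bexI[of _ "\<ominus>\<^bsub>M\<^esub> x"] simp: l_neg subsetD)
  qed (use S in \<open>auto simp: subsetD a_ac\<close>)
qed

text \<open>\<open>a_inv\<close> picks the inverse inside the carrier, so shrinking the carrier
  could a priori change it; uniqueness of inverses in \<open>M\<close> rules this out.\<close>

lemma a_inv_restrict:
  assumes "abelian_group M" "additive_subgroup N M" "v \<in> N"
  shows "\<ominus>\<^bsub>restrict_module M N\<^esub> v = \<ominus>\<^bsub>M\<^esub> v"
proof -
  interpret abelian_group M by fact
  interpret N: abelian_group "restrict_module M N" by (rule abelian_group_restrict; fact)
  have "N \<subseteq> carrier M" using additive_subgroupD(1)[OF assms(1,2)] by auto
  moreover have "\<ominus>\<^bsub>restrict_module M N\<^esub> v \<in> N" using N.a_inv_closed[of v] assms(3) by simp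
  moreover have "\<ominus>\<^bsub>restrict_module M N\<^esub> v \<oplus>\<^bsub>M\<^esub> v = \<zero>\<^bsub>M\<^esub>" using N.l_neg[of v] assms(3) by simp
  ultimately show ?thesis
    using assms(3) minus_equality[of "\<ominus>\<^bsub>restrict_module M N\<^esub> v" v] by (simp add: subsetD)
qed

lemma restrict_supermodule:
  fixes M (structure)
  assumes M: "supermodule R M"
    and N: "additive_subgroup N M"
    and act: "\<And>x v. \<lbrakk>x \<in> carrier R; v \<in> N\<rbrakk> \<Longrightarrow> x \<rhd> v \<in> N"
    and hom: "\<And>v. v \<in> N \<Longrightarrow> hcomp M 0 v \<in> N" "\<And>v. v \<in> N \<Longrightarrow> hcomp M 1 v \<in> N"
    and R: "\<And>p. hpart R p \<subseteq> carrier R"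
  shows "supermodule R (restrict_module M N)"
proof -
  interpret supermodule R M by fact
  note S = additive_subgroupD[OF abelian_group_axioms N]
  interpret N: abelian_group "restrict_module M N"
    by (rule abelian_group_restrict[OF abelian_group_axioms N])
  have g: "graded_group (restrict_module M N)"
  proof (rule graded_groupI[OF N.abelian_group_axioms])
    show "additive_subgroup (hpart (restrict_module M N) p) (restrict_module M N)" for p
      unfolding additive_subgroup_iff[OF N.abelian_group_axioms]
      using S by (auto simp: hpart_add hpart_minus a_inv_restrict[OF abelian_group_axioms N])
  next
    show "v = \<zero>\<^bsub>restrict_module M N\<^esub>"
      if "v \<in> hpart (restrict_module M N) 0" "v \<in> hpart (restrict_module M N) 1" for v
      using that hpart_disjoint[of v 0 1] by auto
  next
    show "\<exists>a\<in>hpart (restrict_module M N) 0. \<exists>b\<in>hpart (restrict_module M N) 1. v = a \<oplus>\<^bsub>restrict_module M N\<^esub> b"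
      if "v \<in> carrier (restrict_module M N)" for v
      using that S hom hcomp_hpart hcomp_decomp
      by (intro bexI[of _ "hcomp M 0 v"] bexI[of _ "hcomp M 1 v"]) auto
  qed
  show ?thesis
    by (rule supermodule_altI[OF g])
      (use act R S in \<open>auto simp: act_add_left act_add_right act_mult act_one act_parity subsetD\<close>)
qed

text \<open>The definition only asks the restricted record to be a supermodule, with negatives and
  homogeneous components taken inside \<open>N\<close>. Uniqueness in \<open>M\<close> identifies
  them with the negatives and components of \<open>M\<close>, which leaves closure conditions that
  can be checked directly.\<close>

lemma graded_submodule_iff:
  assumes "supermodule R M" and R: "\<And>p. hpart R p \<subseteq> carrier R"
  shows "graded_submodule R N M \<longleftrightarrow> additive_subgroup N M
    \<and> (\<forall>x\<in>carrier R. \<forall>v\<in>N. x \<rhd>\<^bsub>M\<^esub> v \<in> N) \<and> (\<forall>v\<in>N. hcomp M 0 v \<in> N \<and> hcomp M 1 v \<in> N)"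
    (is "?L \<longleftrightarrow> ?R")
proof
  interpret supermodule R M by fact
  assume L: ?L
  then interpret N: supermodule R "restrict_module M N" by (simp add: graded_submodule_def)
  have sub: "N \<subseteq> carrier M" using L by (simp add: graded_submodule_def)
  have neg: "\<ominus>\<^bsub>M\<^esub> x \<in> N" if "x \<in> N" for x
  proof -
    have "\<ominus>\<^bsub>restrict_module M N\<^esub> x \<in> N" using N.a_inv_closed[of x] that by simp
    moreover have "\<ominus>\<^bsub>restrict_module M N\<^esub> x \<oplus>\<^bsub>M\<^esub> x = \<zero>\<^bsub>M\<^esub>" using N.l_neg[of x] that by simp
    ultimately show ?thesis
      using that sub minus_equality[of "\<ominus>\<^bsub>restrict_module M N\<^esub> x" x] by (simp add: subsetD)
  qed
  have grp: "additive_subgroup N M" unfolding additive_subgroup_iff[OF abelian_group_axioms]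
    using sub neg N.a_closed N.zero_closed by simp
  have "hcomp M p v \<in> N" if v: "v \<in> N" for p v
  proof -
    obtain a b where "a \<in> hpart M p \<inter> N" "b \<in> hpart M (p+1) \<inter> N" "v = a \<oplus>\<^bsub>M\<^esub> b"
      using N.hcomp_ex[of v p] v by auto
    then show ?thesis using hcomp_eqI[of a p b v] by auto
  qed
  then show ?R using grp N.act_closed by auto
next
  assume ?R
  then show ?L unfolding graded_submodule_def
    using restrict_supermodule[OF assms(1), of N] R
    by (metis additive_subgroup.a_subset)
qed

locale superalgebra = ring R + graded_group R for R :: "'a superring" (structure) +
  assumes mult_hpart: "\<lbrakk>x \<in> hpart R p; y \<in> hpart R r\<rbrakk> \<Longrightarrow> x \<otimes> y \<in> hpart R (p + r)"
    and one_hpart: "\<one> \<in> hpart R 0"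

locale even_map = R: superalgebra R + V: supermodule R V + W: supermodule R W
  for R :: "'a superring" and V :: "('a, 'b) smodule" and W :: "('a, 'c) smodule" +
  fixes \<phi> :: "'b \<Rightarrow> 'c"
  assumes even_hom: "\<phi> \<in> even_hom R V W"
begin

lemma closed [simp]: "v \<in> carrier V \<Longrightarrow> \<phi> v \<in> carrier W"
  using even_hom by (auto simp: super_hom_deg_def)

lemma extensional: "\<phi> \<in> extensional (carrier V)"
  using even_hom by (auto simp: super_hom_deg_def PiE_def)

lemma add: "\<lbrakk>v \<in> carrier V; w \<in> carrier V\<rbrakk> \<Longrightarrow> \<phi> (v \<oplus>\<^bsub>V\<^esub> w) = \<phi> v \<oplus>\<^bsub>W\<^esub> \<phi> w"
  using even_hom by (auto simp: super_hom_deg_def)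

lemma hpart: "v \<in> hpart V p \<Longrightarrow> \<phi> v \<in> hpart W p"
proof -
  have "\<phi> ` hpart V p \<subseteq> hpart W (p + 0)" using even_hom unfolding super_hom_deg_def by blast
  then show "v \<in> hpart V p \<Longrightarrow> \<phi> v \<in> hpart W p" by auto
qed

lemma zero [simp]: "\<phi> \<zero>\<^bsub>V\<^esub> = \<zero>\<^bsub>W\<^esub>"
  using add[of "\<zero>\<^bsub>V\<^esub>" "\<zero>\<^bsub>V\<^esub>"] by (simp add: W.add.r_cancel_one)

lemma minus: "v \<in> carrier V \<Longrightarrow> \<phi> (\<ominus>\<^bsub>V\<^esub> v) = \<ominus>\<^bsub>W\<^esub> \<phi> v"
  using add[of "\<ominus>\<^bsub>V\<^esub> v" v] W.minus_equality[of "\<phi> (\<ominus>\<^bsub>V\<^esub> v)" "\<phi> v"] by (simp add: V.l_neg)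

lemma act_homogeneous:
  assumes "x \<in> hpart R p" "v \<in> carrier V"
  shows "\<phi> (x \<rhd>\<^bsub>V\<^esub> v) = x \<rhd>\<^bsub>W\<^esub> \<phi> v"
proof -
  have "\<phi> (x \<rhd>\<^bsub>V\<^esub> v) = ssign W (p * 0) (x \<rhd>\<^bsub>W\<^esub> \<phi> v)"
    using even_hom assms unfolding super_hom_deg_def by blast
  then show ?thesis by (simp add: ssign_def)
qed

text \<open>\<open>even_hom\<close> gives linearity for homogeneous \<open>x\<close>. An even map
  produces no sign, so the formula is the same for both parities and extends by additivity.\<close>

lemma act: "\<lbrakk>x \<in> carrier R; v \<in> carrier V\<rbrakk> \<Longrightarrow> \<phi> (x \<rhd>\<^bsub>V\<^esub> v) = x \<rhd>\<^bsub>W\<^esub> \<phi> v"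
proof (induction x rule: R.graded_induct)
  case (homogeneous p w)
  then show ?case by (simp add: act_homogeneous)
next
  case (add a b)
  then show ?case
    by (simp add: V.act_add_left W.act_add_left V.act_closed W.act_closed even_map.add[OF even_map_axioms])
qed

lemma hcomp: "v \<in> carrier V \<Longrightarrow> hcomp W p (\<phi> v) = \<phi> (hcomp V p v)"
  by (intro W.hcomp_eqI[where b = "\<phi> (hcomp V (p + 1) v)"])
    (auto intro!: hpart V.hcomp_hpart simp flip: add simp add: V.hcomp_decomp')

lemma image_subgroup:
  assumes "additive_subgroup N V"
  shows "additive_subgroup (\<phi> ` N) W"
proof -
  note N = additive_subgroupD[OF V.abelian_group_axioms assms]
  show ?thesis unfolding additive_subgroup_iff[OF W.abelian_group_axioms]
  proof (intro conjI ballI subsetI)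
    show "\<zero>\<^bsub>W\<^esub> \<in> \<phi> ` N" using N(2) zero by (metis imageI)
  qed (use N in \<open>auto simp flip: add minus intro!: imageI\<close>)
qed

lemma image_submodule:
  assumes "graded_submodule R N V"
  shows "graded_submodule R (\<phi> ` N) W"
proof -
  have hR: "\<And>p. hpart R p \<subseteq> carrier R" using R.hpart_carrier by blast
  note g = assms[unfolded graded_submodule_iff[OF V.supermodule_axioms hR]]
  have sub: "v \<in> N \<Longrightarrow> v \<in> carrier V" for v
    using g additive_subgroupD(1)[OF V.abelian_group_axioms] by blast
  show ?thesis
    unfolding graded_submodule_iff[OF W.supermodule_axioms hR]
    using g sub by (auto simp: image_subgroup hcomp simp flip: act)
qed

text \<open>Since \<open>\<phi>\<close> commutes with \<open>hcomp\<close>, the components of an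
  element of the preimage are again mapped into \<open>N\<close>.\<close>

lemma preimage_submodule:
  assumes "graded_submodule R N W"
  shows "graded_submodule R {v \<in> carrier V. \<phi> v \<in> N} V"
proof -
  have hR: "\<And>p. hpart R p \<subseteq> carrier R" using R.hpart_carrier by blast
  note g = assms[unfolded graded_submodule_iff[OF W.supermodule_axioms hR]]
  note N = additive_subgroupD[OF W.abelian_group_axioms conjunct1[OF g]]
  have "additive_subgroup {v \<in> carrier V. \<phi> v \<in> N} V"
    unfolding additive_subgroup_iff[OF V.abelian_group_axioms] using N by (auto simp: add minus)
  then show ?thesis
    unfolding graded_submodule_iff[OF V.supermodule_axioms hR]
    using g by (auto simp: act V.act_closed simp flip: hcomp)
qed

lemma restrict_even_map:
  assumes "graded_submodule R N V" "graded_submodule R N' W" "\<phi> ` N \<subseteq> N'"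
  shows "even_map R (restrict_module V N) (restrict_module W N') (restrict \<phi> N)"
proof -
  interpret N: supermodule R "restrict_module V N"
    using assms(1) by (simp add: graded_submodule_def)
  interpret N': supermodule R "restrict_module W N'"
    using assms(2) by (simp add: graded_submodule_def)
  have sub: "v \<in> N \<Longrightarrow> v \<in> carrier V" for v
    using assms(1) by (auto simp: graded_submodule_def)
  show ?thesis
  proof unfold_locales
    show "restrict \<phi> N \<in> even_hom R (restrict_module V N) (restrict_module W N')"
      unfolding super_hom_deg_def
      using assms(3) sub N.a_closed N.act_closed R.hpart_carrier
      by (auto simp: add act_homogeneous hpart ssign_def)
  qed
qed

end

text \<open>Inclusions are treated as even maps so that the results on images of weight vectors
  apply to them; \<open>cat_part_cat_C\<close> needs this for each summand of the largest
  submodule.\<close>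

lemma submodule_inclusion:
  assumes "superalgebra R" "supermodule R M" "graded_submodule R N M" "graded_submodule R N' M" "N \<subseteq> N'"
  shows "even_map R (restrict_module M N) (restrict_module M N') (\<lambda>v\<in>N. v)"
proof -
  interpret R: superalgebra R by fact
  interpret N: supermodule R "restrict_module M N"
    using assms(3) by (simp add: graded_submodule_def)
  interpret N': supermodule R "restrict_module M N'"
    using assms(4) by (simp add: graded_submodule_def)
  show ?thesis
  proof unfold_locales
    show "(\<lambda>v\<in>N. v) \<in> even_hom R (restrict_module M N) (restrict_module M N')"
      unfolding super_hom_deg_def
      using assms(5) N.a_closed N.act_closed R.hpart_carrier by (auto simp: ssign_def)
  qed
qed

section \<open>Weights and finiteness\<close>

text \<open>What the finiteness arguments use of a pair: central scalars and all \<open>K_a\<close>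
  in \<open>Q\<close>, and a set \<open>K\<close> closed under addition and scalars, which makes
  every orbit \<open>K v\<close> a linear subspace. \<open>pair_uq_algebra\<close> establishes it
  for actual pairs.\<close>

locale uq_algebra = superalgebra Q for m n :: nat and Q K :: "uq superring" +
  assumes scalar_closed: "uq_scalar m n c \<in> carrier Q"
    and scalar_add: "uq_scalar m n (c + d) = uq_scalar m n c \<oplus>\<^bsub>Q\<^esub> uq_scalar m n d"
    and scalar_mult: "uq_scalar m n (c * d) = uq_scalar m n c \<otimes>\<^bsub>Q\<^esub> uq_scalar m n d"
    and scalar_one: "uq_scalar m n 1 = \<one>\<^bsub>Q\<^esub>"
    and scalar_central: "x \<in> carrier Q \<Longrightarrow> uq_scalar m n c \<otimes>\<^bsub>Q\<^esub> x = x \<otimes>\<^bsub>Q\<^esub> uq_scalar m n c"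
    and GenK_closed: "a \<in> idx m n \<Longrightarrow> uq_gen m n (GenK a) \<in> carrier Q"
    and K_subset: "carrier K \<subseteq> carrier Q"
    and K_zero: "\<zero>\<^bsub>Q\<^esub> \<in> carrier K"
    and K_one: "\<one>\<^bsub>Q\<^esub> \<in> carrier K"
    and K_add: "\<lbrakk>x \<in> carrier K; y \<in> carrier K\<rbrakk> \<Longrightarrow> x \<oplus>\<^bsub>Q\<^esub> y \<in> carrier K"
    and K_scalar: "x \<in> carrier K \<Longrightarrow> uq_scalar m n c \<otimes>\<^bsub>Q\<^esub> x \<in> carrier K"

locale uq_module = Q: uq_algebra m n Q K + supermodule Q M
  for m n :: nat and Q K :: "uq superring" and M :: "(uq, 'v) smodule" (structure)
begin

abbreviation scal (infixr "\<bullet>" 75) where "c \<bullet> v \<equiv> uq_scalar m n c \<rhd> v"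

lemma scal_closed [simp]: "v \<in> carrier M \<Longrightarrow> c \<bullet> v \<in> carrier M"
  by (simp add: act_closed Q.scalar_closed)

lemma scal_add_left: "v \<in> carrier M \<Longrightarrow> (c + d) \<bullet> v = c \<bullet> v \<oplus> d \<bullet> v"
  by (simp add: Q.scalar_add act_add_left Q.scalar_closed)

lemma scal_add_right: "\<lbrakk>v \<in> carrier M; w \<in> carrier M\<rbrakk> \<Longrightarrow> c \<bullet> (v \<oplus> w) = c \<bullet> v \<oplus> c \<bullet> w"
  by (simp add: act_add_right Q.scalar_closed)

lemma scal_scal: "v \<in> carrier M \<Longrightarrow> c \<bullet> d \<bullet> v = (c * d) \<bullet> v"
  by (simp add: Q.scalar_mult act_mult Q.scalar_closed)

lemma scal_one [simp]: "v \<in> carrier M \<Longrightarrow> 1 \<bullet> v = v"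
  by (simp add: Q.scalar_one act_one)

lemma scal_zero_right [simp]: "c \<bullet> \<zero> = \<zero>"
  by (simp add: Q.scalar_closed)

lemma scal_zero_left [simp]: "v \<in> carrier M \<Longrightarrow> 0 \<bullet> v = \<zero>"
  using scal_add_left[of v 0 0] by (simp add: add.r_cancel_one)

lemma scal_act: "\<lbrakk>x \<in> carrier Q; v \<in> carrier M\<rbrakk> \<Longrightarrow> x \<rhd> c \<bullet> v = c \<bullet> (x \<rhd> v)"
  by (metis Q.scalar_central Q.scalar_closed act_mult)

lemma scal_minus: "v \<in> carrier M \<Longrightarrow> (- 1) \<bullet> v = \<ominus> v"
  using scal_add_left[of v "- 1" 1] minus_equality[of "(- 1) \<bullet> v" v] by simp

definition subspace :: "'v set \<Rightarrow> bool" where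
  "subspace W \<longleftrightarrow> W \<subseteq> carrier M \<and> \<zero> \<in> W \<and> (\<forall>v\<in>W. \<forall>w\<in>W. v \<oplus> w \<in> W) \<and> (\<forall>c. \<forall>v\<in>W. c \<bullet> v \<in> W)"

lemma subspaceD:
  assumes "subspace W"
  shows "v \<in> W \<Longrightarrow> v \<in> carrier M" "\<zero> \<in> W" "\<lbrakk>v \<in> W; w \<in> W\<rbrakk> \<Longrightarrow> v \<oplus> w \<in> W"
    "v \<in> W \<Longrightarrow> c \<bullet> v \<in> W"
  using assms by (auto simp: subspace_def)

lemma finsum_mem:
  assumes "X \<subseteq> carrier M" "\<zero> \<in> X" "\<And>v w. \<lbrakk>v \<in> X; w \<in> X\<rbrakk> \<Longrightarrow> v \<oplus> w \<in> X" "\<And>i. i \<in> I \<Longrightarrow> f i \<in> X"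
  shows "finsum M f I \<in> X"
  using assms(4)
proof (induction I rule: infinite_finite_induct)
  case (insert i I)
  then have "finsum M f (insert i I) = f i \<oplus> finsum M f I"
    using assms(1) by (intro finsum_insert) auto
  with insert show ?case using assms(3) by auto
qed (use assms(2) in auto)

lemma finsum_additive:
  assumes "\<And>v. v \<in> carrier M \<Longrightarrow> h v \<in> carrier M" "h \<zero> = \<zero>"
    "\<And>v w. \<lbrakk>v \<in> carrier M; w \<in> carrier M\<rbrakk> \<Longrightarrow> h (v \<oplus> w) = h v \<oplus> h w"
    "\<And>i. i \<in> I \<Longrightarrow> f i \<in> carrier M"
  shows "h (finsum M f I) = (\<Oplus>i\<in>I. h (f i))"
  using assms(4)
proof (induction I rule: infinite_finite_induct)
  case (insert i I)
  then have "finsum M f (insert i I) = f i \<oplus> finsum M f I"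
    by (intro finsum_insert) auto
  moreover from insert have "(\<Oplus>i\<in>insert i I. h (f i)) = h (f i) \<oplus> (\<Oplus>i\<in>I. h (f i))"
    using assms(1) by (intro finsum_insert) auto
  ultimately show ?case using insert assms(3) by (auto intro!: finsum_closed)
qed (use assms(2) in auto)

abbreviation span where "span S \<equiv> cq_span m n M S"

text \<open>\<open>X\<close> has to contain the scalar multiples of \<open>S\<close> but is not
  assumed closed under scalars. This admits sets described by a normal form of their elements, as in
  \<open>span_insert\<close> and \<open>weight_decomposition\<close>.\<close>

lemma span_least:
  assumes "S \<subseteq> carrier M" "X \<subseteq> carrier M" "\<zero> \<in> X" "\<And>v w. \<lbrakk>v \<in> X; w \<in> X\<rbrakk> \<Longrightarrow> v \<oplus> w \<in> X"
    "\<And>c s. s \<in> S \<Longrightarrow> c \<bullet> s \<in> X"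
  shows "span S \<subseteq> X"
  unfolding cq_span_def using assms by (auto intro!: finsum_mem)

lemma span_zero: "\<zero> \<in> span S"
  unfolding cq_span_def by (auto intro!: exI[of _ "{}"])

lemma span_scal: "\<lbrakk>s \<in> S; S \<subseteq> carrier M\<rbrakk> \<Longrightarrow> c \<bullet> s \<in> span S"
  unfolding cq_span_def
  by (auto intro!: exI[of _ "{s}"] exI[of _ "\<lambda>_. c"] simp: subset_iff finsum_insert)

lemma span_add:
  assumes S: "S \<subseteq> carrier M" and "v \<in> span S" "w \<in> span S"
  shows "v \<oplus> w \<in> span S"
proof -
  obtain B c where B: "finite B" "B \<subseteq> S" "v = (\<Oplus>b\<in>B. c b \<bullet> b)"
    using assms unfolding cq_span_def by auto
  obtain B' c' where B': "finite B'" "B' \<subseteq> S" "w = (\<Oplus>b\<in>B'. c' b \<bullet> b)"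
    using assms unfolding cq_span_def by auto
  \<comment> \<open>Both coefficient functions are padded with 0 so that the two sums run over the
    common index set \<open>B \<union> B'\<close>.\<close>
  define d where "d b = (if b \<in> B then c b else 0)" for b
  define d' where "d' b = (if b \<in> B' then c' b else 0)" for b
  have v: "v = (\<Oplus>b\<in>B \<union> B'. d b \<bullet> b)"
    unfolding B(3) using S B B'
    by (intro add.finprod_mono_neutral_cong_left) (auto simp: d_def subset_iff)
  have w: "w = (\<Oplus>b\<in>B \<union> B'. d' b \<bullet> b)"
    unfolding B'(3) using S B B'
    by (intro add.finprod_mono_neutral_cong_left) (auto simp: d'_def subset_iff)
  have "v \<oplus> w = (\<Oplus>b\<in>B \<union> B'. d b \<bullet> b \<oplus> d' b \<bullet> b)"
    unfolding v w using S B B' by (subst finsum_addf) (auto simp: subset_iff)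
  also have "\<dots> = (\<Oplus>b\<in>B \<union> B'. (d b + d' b) \<bullet> b)"
    using S B B' by (intro add.finprod_cong') (auto simp: scal_add_left subset_iff)
  finally show ?thesis unfolding cq_span_def using B B'
    by (intro CollectI exI[of _ "B \<union> B'"] exI[of _ "\<lambda>b. d b + d' b"] conjI) auto
qed

lemma span_subspace: "S \<subseteq> carrier M \<Longrightarrow> subspace (span S)"
proof -
  assume S: "S \<subseteq> carrier M"
  have c: "span S \<subseteq> carrier M" using S by (intro span_least) auto
  have "span S \<subseteq> {v \<in> carrier M. c \<bullet> v \<in> span S}" for c
    using S by (intro span_least)
      (auto simp: span_zero span_add scal_add_right scal_scal span_scal subset_iff)
  then show ?thesis using c S by (auto simp: subspace_def span_zero span_add)
qed

lemma span_superset: "S \<subseteq> carrier M \<Longrightarrow> S \<subseteq> span S"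
  using span_scal[of _ S 1] by (auto simp: subset_iff)

lemma span_min: "\<lbrakk>subspace W; S \<subseteq> W\<rbrakk> \<Longrightarrow> span S \<subseteq> W"
  using subspaceD[of W] by (intro span_least) auto

lemma span_mono: "\<lbrakk>S \<subseteq> S'; S' \<subseteq> carrier M\<rbrakk> \<Longrightarrow> span S \<subseteq> span S'"
  using span_subspace[of S'] span_superset[of S'] by (intro span_min) auto

lemma span_insert:
  assumes "b \<in> carrier M" "B \<subseteq> carrier M" "v \<in> span (insert b B)"
  obtains c u where "u \<in> span B" "v = c \<bullet> b \<oplus> u"
proof -
  let ?X = "{c \<bullet> b \<oplus> u | c u. u \<in> span B}"
  note sB = subspaceD[OF span_subspace[OF assms(2)]]
  have "span (insert b B) \<subseteq> ?X"
  proof (rule span_least)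
    show "\<zero> \<in> ?X" using assms(1) sB(2) by (auto intro!: exI[of _ 0] exI[of _ "\<zero>"])
    show "?X \<subseteq> carrier M" using assms sB(1) by auto
    show "v \<oplus> w \<in> ?X" if vw: "v \<in> ?X" "w \<in> ?X" for v w
    proof -
      obtain c u d u' where *: "v = c \<bullet> b \<oplus> u" "w = d \<bullet> b \<oplus> u'" "u \<in> span B" "u' \<in> span B"
        using vw by blast
      have "v \<oplus> w = (c + d) \<bullet> b \<oplus> (u \<oplus> u')"
        using * assms(1) sB(1) by (simp add: scal_add_left add_interchange)
      then show ?thesis using *(3,4) sB(3) by blast
    qed
    show "c \<bullet> s \<in> ?X" if "s \<in> insert b B" for c s
    proof (cases "s = b")
      case True
      then have "c \<bullet> s = c \<bullet> b \<oplus> \<zero>" using assms(1) by simp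
      then show ?thesis using sB(2) by blast
    next
      case False
      then have "s \<in> B" using that by simp
      then have "c \<bullet> s = 0 \<bullet> b \<oplus> c \<bullet> s" using assms(1,2) by auto
      moreover have "c \<bullet> s \<in> span B" using \<open>s \<in> B\<close> assms(2) span_scal by blast
      ultimately show ?thesis by blast
    qed
  qed (use assms in auto)
  then show ?thesis using that assms(3) by blast
qed

text \<open>Induction on the spanning set. \<open>W \<inter> span B\<close> is finite-dimensional by
  hypothesis, and \<open>W\<close> exceeds it by at most one dimension: any \<open>w\<close> in
  \<open>W\<close> outside \<open>span B\<close> has a nonzero coefficient at \<open>b\<close>, and
  multiples of it clear that coefficient from all other elements of \<open>W\<close>.\<close>

lemma fin_dim_subspace_span:
  assumes "finite B" "B \<subseteq> carrier M" "subspace W" "W \<subseteq> span B"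
  shows "fin_dim m n M W"
  using assms
proof (induction B arbitrary: W rule: finite_induct)
  case empty
  have "span {} \<subseteq> {\<zero>}" by (rule span_least) auto
  then have "W = span {}" using empty subspaceD(2)[OF empty(2)] span_zero by blast
  then show ?case unfolding fin_dim_def by blast
next
  case (insert b B)
  note W = subspaceD[OF insert.prems(2)]
  have B: "b \<in> carrier M" "B \<subseteq> carrier M" using insert.prems by auto
  note sB = subspaceD[OF span_subspace[OF B(2)]]
  have "subspace (W \<inter> span B)" unfolding subspace_def using W sB by blast
  then have "fin_dim m n M (W \<inter> span B)" using insert.IH B by blast
  then obtain C where C: "finite C" "C \<subseteq> carrier M" "W \<inter> span B = span C"
    unfolding fin_dim_def by blast
  show ?case
  proof (cases "W \<subseteq> span B")
    case True
    then show ?thesis unfolding fin_dim_def using C by (metis inf.absorb1)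
  next
    case False
    then obtain w where w: "w \<in> W" "w \<notin> span B" by blast
    then obtain c u where cu: "u \<in> span B" "w = c \<bullet> b \<oplus> u"
      using span_insert[OF B] insert.prems(3) by blast
    have c0: "c \<noteq> 0" using cu w sB(1) B by auto
    have wC: "insert w C \<subseteq> carrier M" using w W C by blast
    note sC = subspaceD[OF span_subspace[OF wC]]
    have "W \<subseteq> span (insert w C)"
    proof
      fix w' assume w': "w' \<in> W"
      then obtain c' u' where cu': "u' \<in> span B" "w' = c' \<bullet> b \<oplus> u'"
        using span_insert[OF B] insert.prems(3) by blast
      \<comment> \<open>Chosen so that the coefficient of \<open>b\<close> in
        \<open>w' - e w\<close> vanishes; the difference then lies in both \<open>W\<close> and
        \<open>span B\<close>.\<close>
      define e where "e = c' / c"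
      have ec: "e * c = c'" using c0 by (simp add: e_def)
      define z where "z = w' \<oplus> (- e) \<bullet> w"
      have uu: "u \<in> carrier M" "u' \<in> carrier M" using cu cu' sB by auto
      have ww: "w \<in> carrier M" "w' \<in> carrier M" using w w' W by auto
      have "z = (c' \<bullet> b \<oplus> u') \<oplus> ((- c') \<bullet> b \<oplus> (- e) \<bullet> u)"
        unfolding z_def cu(2) cu'(2) using B uu by (simp add: scal_add_right scal_scal ec)
      also have "\<dots> = (c' \<bullet> b \<oplus> (- c') \<bullet> b) \<oplus> (u' \<oplus> (- e) \<bullet> u)"
        using B uu by (simp add: add_interchange)
      also have "\<dots> = u' \<oplus> (- e) \<bullet> u" using B uu scal_add_left[of b c' "- c'"] by simp
      finally have "z \<in> span B" using cu cu' sB by simp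
      moreover have "z \<in> W" unfolding z_def using w w' W by simp
      ultimately have "z \<in> span (insert w C)"
        using C span_mono[of C "insert w C"] wC by blast
      moreover have "e \<bullet> w \<in> span (insert w C)" using wC by (intro span_scal) auto
      moreover have "w' = z \<oplus> e \<bullet> w"
        unfolding z_def using ww scal_add_left[of w "- e" e] by (simp add: a_assoc)
      ultimately show "w' \<in> span (insert w C)" using sC(3) by simp
    qed
    moreover have "C \<subseteq> W" using C span_superset by blast
    ultimately have "W = span (insert w C)"
      using span_min[OF insert.prems(2), of "insert w C"] w by blast
    then show ?thesis unfolding fin_dim_def using C wC by blast
  qed
qed

lemma fin_dim_subset: "\<lbrakk>fin_dim m n M W'; subspace W; W \<subseteq> W'\<rbrakk> \<Longrightarrow> fin_dim m n M W"
  unfolding fin_dim_def[of _ _ _ W'] using fin_dim_subspace_span by blast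

abbreviation orbit where "orbit v \<equiv> (\<lambda>x. x \<rhd> v) ` carrier K"

lemma orbit_subspace:
  assumes v: "v \<in> carrier M"
  shows "subspace (orbit v)"
  unfolding subspace_def
proof (intro conjI ballI allI subsetI)
  show "\<zero> \<in> orbit v"
    using Q.K_zero act_zero_left[of v] v by (force simp: image_iff)
next
  fix a b assume "a \<in> orbit v" "b \<in> orbit v"
  then obtain x y where "x \<in> carrier K" "y \<in> carrier K" "a = x \<rhd> v" "b = y \<rhd> v" by blast
  then show "a \<oplus> b \<in> orbit v"
    using Q.K_add[of x y] Q.K_subset v by (auto simp: image_iff subset_iff act_add_left intro!: bexI[of _ "x \<oplus>\<^bsub>Q\<^esub> y"])
next
  fix c a assume "a \<in> orbit v"
  then obtain x where "x \<in> carrier K" "a = x \<rhd> v" by blast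
  then show "c \<bullet> a \<in> orbit v"
    using Q.K_scalar[of x c] Q.K_subset v
    by (auto simp: image_iff subset_iff act_mult Q.scalar_closed intro!: bexI[of _ "uq_scalar m n c \<otimes>\<^bsub>Q\<^esub> x"])
qed (use Q.K_subset v act_closed in auto)

text \<open>The spanning set in \<open>cat_C\<close> is the union of these sets over all weights.
  Unlike the union, each of them is a subspace.\<close>

definition wsp :: "weight \<Rightarrow> 'v set" where
  "wsp \<mu> = {v. weight_vector m n M \<mu> v \<and> fin_dim m n M (orbit v)}"

lemma wsp_carrier: "v \<in> wsp \<mu> \<Longrightarrow> v \<in> carrier M"
  by (simp add: wsp_def weight_vector_def)

text \<open>The orbit of a sum is merely contained in the sum of two finite-dimensional orbits, so
  closure under addition rests on subspaces of finite-dimensional spaces being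
  finite-dimensional.\<close>

lemma wsp_subspace: "subspace (wsp \<mu>)"
  unfolding subspace_def
proof (intro conjI ballI allI)
  show "wsp \<mu> \<subseteq> carrier M" using wsp_carrier by blast
next
  have "orbit \<zero> = {\<zero>}" using Q.K_subset Q.K_one act_zero_right by (auto simp: subset_iff image_iff)
  also have "\<dots> = span {}" using span_least[of "{}" "{\<zero>}"] span_zero by auto
  finally have "fin_dim m n M (orbit \<zero>)" unfolding fin_dim_def by blast
  then show "\<zero> \<in> wsp \<mu>" by (simp add: wsp_def weight_vector_def Q.GenK_closed)
next
  fix v w assume vw: "v \<in> wsp \<mu>" "w \<in> wsp \<mu>"
  note c = vw[THEN wsp_carrier]
  obtain B C where B: "finite B" "B \<subseteq> carrier M" "orbit v = span B"
    and C: "finite C" "C \<subseteq> carrier M" "orbit w = span C"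
    using vw by (auto simp: wsp_def fin_dim_def)
  have BC: "B \<union> C \<subseteq> carrier M" using B C by blast
  have "orbit (v \<oplus> w) \<subseteq> span (B \<union> C)"
  proof
    fix a assume "a \<in> orbit (v \<oplus> w)"
    then obtain x where x: "x \<in> carrier K" "a = x \<rhd> v \<oplus> x \<rhd> w"
      using act_add_right c Q.K_subset by blast
    have "x \<rhd> v \<in> span (B \<union> C)" "x \<rhd> w \<in> span (B \<union> C)"
      using x(1) B(3) C(3) span_mono[OF _ BC] by blast+
    then show "a \<in> span (B \<union> C)" using x span_add[OF BC] by simp
  qed
  then have "fin_dim m n M (orbit (v \<oplus> w))"
    using B C BC c by (intro fin_dim_subspace_span[of "B \<union> C"] orbit_subspace) auto
  moreover have "weight_vector m n M \<mu> (v \<oplus> w)"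
    using vw c by (auto simp: wsp_def weight_vector_def act_add_right Q.GenK_closed Q.scalar_closed)
  ultimately show "v \<oplus> w \<in> wsp \<mu>" by (simp add: wsp_def)
next
  fix c v assume v: "v \<in> wsp \<mu>"
  note cv = wsp_carrier[OF v]
  note O = subspaceD[OF orbit_subspace[OF cv]]
  have "orbit (c \<bullet> v) \<subseteq> orbit v"
  proof
    fix a assume "a \<in> orbit (c \<bullet> v)"
    then obtain x where x: "x \<in> carrier K" "a = x \<rhd> c \<bullet> v" by blast
    then have "a = c \<bullet> (x \<rhd> v)" using scal_act cv Q.K_subset by blast
    then show "a \<in> orbit v" using O(4) x(1) by blast
  qed
  moreover have "fin_dim m n M (orbit v)" using v by (simp add: wsp_def)
  moreover have "subspace (orbit (c \<bullet> v))" using cv by (intro orbit_subspace) simp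
  ultimately have "fin_dim m n M (orbit (c \<bullet> v))" by (rule fin_dim_subset[rotated 2])
  moreover have "weight_vector m n M \<mu> (c \<bullet> v)"
    using v cv by (auto simp: wsp_def weight_vector_def scal_act Q.GenK_closed scal_scal mult.commute)
  ultimately show "c \<bullet> v \<in> wsp \<mu>" by (simp add: wsp_def)
qed

lemma cat_C_iff: "M \<in> cat_C m n Q K \<longleftrightarrow> carrier M \<subseteq> span (\<Union>\<mu>. wsp \<mu>)"
proof -
  have eq: "{v. (\<exists>\<mu>. weight_vector m n M \<mu> v) \<and> fin_dim m n M (orbit v)} = (\<Union>\<mu>. wsp \<mu>)"
    by (auto simp: wsp_def)
  have "(\<Union>\<mu>. wsp \<mu>) \<subseteq> carrier M" using wsp_carrier by blast
  then have "span (\<Union>\<mu>. wsp \<mu>) \<subseteq> carrier M"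
    using span_subspace subspaceD(1) by blast
  then show ?thesis unfolding cat_C_def mem_Collect_eq eq
    using supermodule_axioms by blast
qed

end

section \<open>Powers of the indeterminate q are distinct\<close>

lemma qq_nonzero: "qq \<noteq> 0"
  by (simp add: qq_def Zero_fract_def eq_fract)

lemma qq_power: "qq ^ k = Fract ([:0, 1:] ^ k) 1"
  by (induction k) (simp_all add: qq_def One_fract_def)

text \<open>\<open>qq ^ k\<close> is the class of the polynomial X^k, so the equation holds already
  between polynomials and the degree decides.\<close>

lemma qq_power_eq_one:
  assumes "qq ^ k = 1"
  shows "k = 0"
proof -
  have "[:0, 1:] ^ k = (1 :: complex poly)"
    using assms by (simp add: qq_power One_fract_def eq_fract)
  then have "Polynomial.degree ([:0, 1:] ^ k :: complex poly) = 0" by simp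
  then show ?thesis by (simp add: degree_power_eq)
qed

lemma qq_powi_inject: "qq powi k = qq powi l \<longleftrightarrow> k = l"
proof
  have *: "i = j" if "qq powi i = qq powi j" "i \<le> j" for i j
  proof -
    have "qq powi (j - i) = 1" using that(1) qq_nonzero by (simp add: power_int_diff)
    then have "qq ^ nat (j - i) = 1" using that(2) by (simp add: power_int_def)
    then show ?thesis using qq_power_eq_one that(2) by fastforce
  qed
  assume "qq powi k = qq powi l"
  then show "k = l" using *[of k l] *[of l k] by (cases "k \<le> l") auto
qed simp

lemma bform_eps: "a \<in> idx m n \<Longrightarrow> bform m n \<mu> (eps a) = (if a \<le> m then \<mu> a else - \<mu> a)"
  by (simp add: bform_def eps_def idx_def if_distrib[of "\<lambda>x. _ * x"] cong: if_cong)

text \<open>Pairing with \<open>eps a\<close> for \<open>a\<close> in \<open>idx m n\<close> sees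
  only the values of \<open>\<mu>\<close> there. Restriction thus selects one representative among
  the functions that describe the same weight.\<close>

lemma weight_vector_restrict:
  "weight_vector m n M (restrict \<mu> (idx m n)) v \<longleftrightarrow> weight_vector m n M \<mu> v"
  by (auto simp: weight_vector_def bform_eps)

section \<open>Decomposition into weight components\<close>

context uq_module
begin

lemma wsp_restrict: "wsp (restrict \<mu> (idx m n)) = wsp \<mu>"
  by (simp add: wsp_def weight_vector_restrict)

text \<open>Distinct members of \<open>T\<close> have to differ at an index in
  \<open>idx m n\<close>, since only there can a \<open>K_a\<close> tell them apart. Requiring them
  to be extensional on \<open>idx m n\<close> guarantees this.\<close>

lemma weight_decomposition:
  assumes "v \<in> span (\<Union>\<mu>. wsp \<mu>)"
  obtains T f where "finite T" "T \<subseteq> extensional (idx m n)" "\<And>\<mu>. f \<mu> \<in> wsp \<mu>" "v = finsum M f T"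
proof -
  \<comment> \<open>The clause that \<open>f\<close> vanishes off \<open>T\<close> lets two
    decompositions be added over the union of their supports.\<close>
  let ?X = "{finsum M f T | f T. finite T \<and> T \<subseteq> extensional (idx m n)
    \<and> (\<forall>\<mu>. f \<mu> \<in> wsp \<mu>) \<and> (\<forall>\<mu>. \<mu> \<notin> T \<longrightarrow> f \<mu> = \<zero>)}"
  note W = subspaceD[OF wsp_subspace]
  have fc: "f \<in> T \<rightarrow> carrier M" if "\<forall>\<mu>. f \<mu> \<in> wsp \<mu>" for f T using that wsp_carrier by blast
  have "span (\<Union>\<mu>. wsp \<mu>) \<subseteq> ?X"
  proof (rule span_least)
    show "?X \<subseteq> carrier M" using fc by (auto intro!: finsum_closed)
    show "\<zero> \<in> ?X" using W(2) by (auto intro!: exI[of _ "\<lambda>_. \<zero>"] exI[of _ "{}"])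
    show "v \<oplus> w \<in> ?X" if vw: "v \<in> ?X" "w \<in> ?X" for v w
    proof -
      obtain f T where f: "v = finsum M f T" "finite T" "T \<subseteq> extensional (idx m n)"
        "\<forall>\<mu>. f \<mu> \<in> wsp \<mu>" "\<forall>\<mu>. \<mu> \<notin> T \<longrightarrow> f \<mu> = \<zero>" using vw by blast
      obtain g S where g: "w = finsum M g S" "finite S" "S \<subseteq> extensional (idx m n)"
        "\<forall>\<mu>. g \<mu> \<in> wsp \<mu>" "\<forall>\<mu>. \<mu> \<notin> S \<longrightarrow> g \<mu> = \<zero>" using vw by blast
      have v: "v = finsum M f (T \<union> S)" unfolding f(1)
        using f g fc[OF f(4)] by (intro add.finprod_mono_neutral_cong_left) auto
      have w: "w = finsum M g (T \<union> S)" unfolding g(1)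
        using f g fc[OF g(4)] by (intro add.finprod_mono_neutral_cong_left) auto
      have "v \<oplus> w = finsum M (\<lambda>\<mu>. f \<mu> \<oplus> g \<mu>) (T \<union> S)"
        unfolding v w using fc f(4) g(4) by (intro finsum_addf[symmetric]) blast+
      moreover have "\<forall>\<mu>. f \<mu> \<oplus> g \<mu> \<in> wsp \<mu>" using W(3) f g by blast
      moreover have "\<forall>\<mu>. \<mu> \<notin> T \<union> S \<longrightarrow> f \<mu> \<oplus> g \<mu> = \<zero>" using f g by auto
      ultimately show ?thesis using f(2,3) g(2,3)
        by (intro CollectI exI[of _ "\<lambda>\<mu>. f \<mu> \<oplus> g \<mu>"] exI[of _ "T \<union> S"]) auto
    qed
    show "c \<bullet> s \<in> ?X" if s: "s \<in> (\<Union>\<mu>. wsp \<mu>)" for c s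
    proof -
      obtain \<mu> where \<mu>: "s \<in> wsp \<mu>" using s by blast
      define \<nu> where "\<nu> = restrict \<mu> (idx m n)"
      define f where "f = (\<lambda>\<kappa>. if \<kappa> = \<nu> then c \<bullet> s else \<zero>)"
      have cs: "c \<bullet> s \<in> wsp \<nu>" using \<mu> W(4) by (simp add: \<nu>_def wsp_restrict)
      then have "c \<bullet> s = finsum M f {\<nu>}" using wsp_carrier by (simp add: f_def finsum_insert)
      moreover have "\<forall>\<kappa>. f \<kappa> \<in> wsp \<kappa>" using cs W(2) by (simp add: f_def)
      ultimately show ?thesis
        by (intro CollectI exI[of _ f] exI[of _ "{\<nu>}"]) (auto simp: f_def \<nu>_def)
    qed
  qed (use wsp_carrier in blast)
  then have "v \<in> ?X" using assms by blast
  then show ?thesis using that by blast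
qed

text \<open>Applying \<open>K\<^sub>a - q\<^bsup>(\<mu>,\<epsilon>\<^sub>a)\<^esup>\<close> removes the component of weight \<open>\<mu>\<close>.\<close>

lemma weight_components_mem:
  assumes U: "subspace U" and GenK: "\<And>a v. \<lbrakk>a \<in> idx m n; v \<in> U\<rbrakk> \<Longrightarrow> uq_gen m n (GenK a) \<rhd> v \<in> U"
    and "finite T" "T \<subseteq> extensional (idx m n)" "\<And>\<mu>. f \<mu> \<in> wsp \<mu>" "finsum M f T \<in> U" "\<mu> \<in> T"
  shows "f \<mu> \<in> U"
  using assms(3-)
proof (induction T arbitrary: f \<mu> rule: finite_induct)
  case (insert \<nu> T)
  note S = subspaceD[OF U]
  note W = subspaceD[OF wsp_subspace]
  have fc: "f \<kappa> \<in> carrier M" for \<kappa> using insert.prems(2) wsp_carrier by blast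
  have sum: "finsum M f (insert \<nu> T) = f \<nu> \<oplus> finsum M f T"
    using insert.hyps fc by (intro finsum_insert) auto
  have T: "finsum M f T \<in> carrier M" using fc by (intro finsum_closed) auto
  have mem: "f \<kappa> \<in> U" if \<kappa>: "\<kappa> \<in> T" for \<kappa>
  proof -
    have "\<kappa> \<noteq> \<nu>" using insert.hyps \<kappa> by blast
    moreover have "\<kappa> \<in> extensional (idx m n)" "\<nu> \<in> extensional (idx m n)"
      using insert.prems \<kappa> by auto
    \<comment> \<open>The index \<open>a\<close> depends on \<open>\<kappa>\<close>: one
      \<open>K_a\<close> need not separate \<open>\<nu>\<close> from all the other weights.\<close>
    ultimately obtain a where a: "a \<in> idx m n" "\<kappa> a \<noteq> \<nu> a"
      by (metis extensionalityI)
    define g where "g = uq_gen m n (GenK a)"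
    have g: "g \<in> carrier Q" using a by (simp add: g_def Q.GenK_closed)
    define e where "e \<xi> = qq powi bform m n \<xi> (eps a)" for \<xi>
    have ne: "e \<kappa> - e \<nu> \<noteq> 0" using a by (auto simp: e_def qq_powi_inject bform_eps)
    define h where "h v = g \<rhd> v \<oplus> (- e \<nu>) \<bullet> v" for v
    have hc: "h v \<in> carrier M" if "v \<in> carrier M" for v using that g by (simp add: h_def act_closed)
    have ha: "h (v \<oplus> w) = h v \<oplus> h w" if "v \<in> carrier M" "w \<in> carrier M" for v w
      using that g by (simp add: h_def act_add_right scal_add_right add_interchange act_closed)
    have hz: "h \<zero> = \<zero>" using g by (simp add: h_def)
    have hf: "h (f \<xi>) = (e \<xi> - e \<nu>) \<bullet> f \<xi>" for \<xi>
    proof -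
      have "g \<rhd> f \<xi> = e \<xi> \<bullet> f \<xi>"
        using insert.prems(2) a by (simp add: wsp_def weight_vector_def g_def e_def)
      then show ?thesis using scal_add_left[OF fc, of "e \<xi>" "- e \<nu>"] by (simp add: h_def)
    qed
    have "h (f \<nu> \<oplus> finsum M f T) = h (finsum M f T)"
      using ha[OF fc T] hf[of \<nu>] fc hc[OF T] by simp
    also have "\<dots> = (\<Oplus>\<xi>\<in>T. h (f \<xi>))" by (rule finsum_additive) (auto simp: hc hz ha fc)
    finally have "(\<Oplus>\<xi>\<in>T. (e \<xi> - e \<nu>) \<bullet> f \<xi>) = h (f \<nu> \<oplus> finsum M f T)" by (simp add: hf)
    also have "\<dots> \<in> U" unfolding h_def
      using insert.prems(3) GenK[OF a(1)] S by (simp add: sum g_def)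
    finally have sumU: "(\<Oplus>\<xi>\<in>T. (e \<xi> - e \<nu>) \<bullet> f \<xi>) \<in> U" .
    \<comment> \<open>The induction hypothesis is used for the rescaled family
      \<open>(e \<xi> - e \<nu>) f \<xi>\<close>. Some members of it may vanish; only the scalar at
      \<open>\<kappa>\<close> has to be invertible.\<close>
    have "(e \<kappa> - e \<nu>) \<bullet> f \<kappa> \<in> U"
      by (rule insert.IH[OF _ _ sumU \<kappa>]) (use insert.prems(1,2) W(4) in auto)
    then have "inverse (e \<kappa> - e \<nu>) \<bullet> (e \<kappa> - e \<nu>) \<bullet> f \<kappa> \<in> U" using S(4) by blast
    then show ?thesis using fc ne by (simp add: scal_scal)
  qed
  have TU: "finsum M f T \<in> U" using mem S by (intro finsum_mem) auto
  have "f \<nu> = (f \<nu> \<oplus> finsum M f T) \<oplus> (- 1) \<bullet> finsum M f T"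
    using fc T by (simp add: scal_minus a_assoc r_neg)
  also have "\<dots> \<in> U" using insert.prems(3) TU S unfolding sum by blast
  finally show ?case using mem insert.prems(4) by blast
qed simp

end

section \<open>Weight vectors and the category under even maps\<close>

locale uq_map = V: uq_module m n Q K V + W: uq_module m n Q K W + even_map Q V W \<phi>
  for m n Q K and V :: "(uq, 'v) smodule" and W :: "(uq, 'w) smodule" and \<phi>
begin

lemma image_subspace:
  assumes "V.subspace S"
  shows "W.subspace (\<phi> ` S)"
proof -
  note S = V.subspaceD[OF assms]
  show ?thesis unfolding W.subspace_def
  proof (intro conjI ballI allI subsetI)
    show "\<zero>\<^bsub>W\<^esub> \<in> \<phi> ` S" using S(2) zero by (metis imageI)
    show "a \<oplus>\<^bsub>W\<^esub> b \<in> \<phi> ` S" if "a \<in> \<phi> ` S" "b \<in> \<phi> ` S" for a b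
      using that S by (auto simp flip: add)
    show "W.scal c a \<in> \<phi> ` S" if "a \<in> \<phi> ` S" for c a
      using that S by (auto simp: V.Q.scalar_closed simp flip: act)
  qed (use S in auto)
qed

lemma span_image:
  assumes "S \<subseteq> carrier V"
  shows "\<phi> ` V.span S = W.span (\<phi> ` S)"
proof
  have S': "\<phi> ` S \<subseteq> carrier W" using assms by auto
  note W = W.subspaceD[OF W.span_subspace[OF S']]
  have "V.span S \<subseteq> {v \<in> carrier V. \<phi> v \<in> W.span (\<phi> ` S)}"
  proof (rule V.span_least[OF assms])
    show "V.scal c s \<in> {v \<in> carrier V. \<phi> v \<in> W.span (\<phi> ` S)}" if "s \<in> S" for c s
      using that assms S' by (auto simp: act V.Q.scalar_closed subset_iff intro!: W.span_scal)
  qed (use W in \<open>auto simp: add\<close>)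
  then show "\<phi> ` V.span S \<subseteq> W.span (\<phi> ` S)" by auto
  show "W.span (\<phi> ` S) \<subseteq> \<phi> ` V.span S"
    using assms by (intro W.span_min image_subspace V.span_subspace image_mono V.span_superset)
qed

lemma orbit_image: "v \<in> carrier V \<Longrightarrow> \<phi> ` V.orbit v = W.orbit (\<phi> v)"
  using V.Q.K_subset by (force simp: act subset_iff image_iff)

lemma wsp_image:
  assumes "v \<in> V.wsp \<mu>"
  shows "\<phi> v \<in> W.wsp \<mu>"
proof -
  note v = V.wsp_carrier[OF assms]
  obtain B where B: "finite B" "B \<subseteq> carrier V" "V.orbit v = V.span B"
    using assms by (auto simp: V.wsp_def fin_dim_def)
  have "W.orbit (\<phi> v) = W.span (\<phi> ` B)"
    using orbit_image[OF v] B(3) span_image[OF B(2)] by simp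
  then have "fin_dim m n W (W.orbit (\<phi> v))"
    unfolding fin_dim_def using B by (intro exI[of _ "\<phi> ` B"]) auto
  moreover have "weight_vector m n W \<mu> (\<phi> v)"
    using assms v by (auto simp: V.wsp_def weight_vector_def V.Q.GenK_closed V.Q.scalar_closed simp flip: act)
  ultimately show ?thesis by (simp add: W.wsp_def)
qed

lemma wsp_union_carrier: "(\<Union>\<mu>. V.wsp \<mu>) \<subseteq> carrier V" "(\<Union>\<mu>. W.wsp \<mu>) \<subseteq> carrier W"
  using V.wsp_carrier W.wsp_carrier by blast+

lemma image_weights:
  assumes "V \<in> cat_C m n Q K"
  shows "\<phi> ` carrier V \<subseteq> W.span (\<Union>\<mu>. W.wsp \<mu>)"
proof -
  have "\<phi> ` carrier V \<subseteq> \<phi> ` V.span (\<Union>\<mu>. V.wsp \<mu>)"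
    using assms by (auto simp: V.cat_C_iff)
  also have "\<dots> = W.span (\<phi> ` (\<Union>\<mu>. V.wsp \<mu>))" by (rule span_image[OF wsp_union_carrier(1)])
  also have "\<dots> \<subseteq> W.span (\<Union>\<mu>. W.wsp \<mu>)"
    using wsp_image by (intro W.span_mono[OF _ wsp_union_carrier(2)]) blast
  finally show ?thesis .
qed

lemma surj_cat_C:
  assumes "V \<in> cat_C m n Q K" "\<phi> ` carrier V = carrier W"
  shows "W \<in> cat_C m n Q K"
  using image_weights[OF assms(1)] assms(2) by (simp add: W.cat_C_iff)

text \<open>The weight equations can be tested after applying \<open>\<phi>\<close>. A finite
  spanning set of the orbit of \<open>\<phi> v\<close> lies in that orbit, hence is the image of a
  finite subset of the orbit of \<open>v\<close>; by injectivity that subset spans.\<close>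

lemma inj_wsp:
  assumes inj: "inj_on \<phi> (carrier V)" and v: "v \<in> carrier V" "\<phi> v \<in> W.wsp \<mu>"
  shows "v \<in> V.wsp \<mu>"
proof -
  have "weight_vector m n V \<mu> v"
    unfolding weight_vector_def
  proof (intro conjI ballI)
    fix a assume a: "a \<in> idx m n"
    show "uq_gen m n (GenK a) \<rhd>\<^bsub>V\<^esub> v = V.scal (qq powi bform m n \<mu> (eps a)) v"
      using v a by (intro inj_onD[OF inj])
        (auto simp: act V.act_closed V.Q.GenK_closed V.Q.scalar_closed W.wsp_def weight_vector_def)
  qed (rule v)
  moreover have "fin_dim m n V (V.orbit v)"
  proof -
    obtain B where B: "finite B" "B \<subseteq> carrier W" "\<phi> ` V.orbit v = W.span B"
      using v orbit_image[OF v(1)] by (auto simp: W.wsp_def fin_dim_def)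
    then have "B \<subseteq> \<phi> ` V.orbit v" using W.span_superset by blast
    then obtain C where C: "finite C" "C \<subseteq> V.orbit v" "B = \<phi> ` C"
      using finite_subset_image[OF B(1)] by metis
    have sub: "V.orbit v \<subseteq> carrier V" using V.orbit_subspace[OF v(1)] V.subspaceD(1) by blast
    then have Cc: "C \<subseteq> carrier V" using C by blast
    have "\<phi> ` V.orbit v = \<phi> ` V.span C" using B C span_image[OF Cc] by simp
    moreover have "V.span C \<subseteq> carrier V" using V.span_subspace[OF Cc] V.subspaceD(1) by blast
    ultimately have "V.orbit v = V.span C"
      using sub inj by (simp add: inj_on_image_eq_iff)
    then show ?thesis unfolding fin_dim_def using C(1) Cc by blast
  qed
  ultimately show ?thesis by (simp add: V.wsp_def)
qed

text \<open>An injective map stands in for the inclusion of a submodule. The image of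
  \<open>V\<close> is a subspace stable under all \<open>K_a\<close>, so it contains the weight
  components of each \<open>\<phi> v\<close>, and \<open>inj_wsp\<close> pulls these back to finite
  weight vectors of \<open>V\<close>.\<close>

lemma inj_cat_C:
  assumes inj: "inj_on \<phi> (carrier V)" and "W \<in> cat_C m n Q K"
  shows "V \<in> cat_C m n Q K"
  unfolding V.cat_C_iff
proof
  fix v assume v: "v \<in> carrier V"
  let ?S = "\<Union>\<mu>. V.wsp \<mu>"
  have Vc: "V.subspace (carrier V)" by (simp add: V.subspace_def)
  have "\<phi> v \<in> W.span (\<Union>\<mu>. W.wsp \<mu>)"
    using assms(2) v closed by (auto simp: W.cat_C_iff)
  then obtain T f where f: "finite T" "T \<subseteq> extensional (idx m n)" "\<And>\<mu>. f \<mu> \<in> W.wsp \<mu>"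
    "\<phi> v = finsum W f T" using W.weight_decomposition by blast
  have fs: "f \<mu> \<in> \<phi> ` V.span ?S" if "\<mu> \<in> T" for \<mu>
  proof -
    have "f \<mu> \<in> \<phi> ` carrier V"
    proof (rule W.weight_components_mem[OF image_subspace[OF Vc] _ f(1,2,3) _ that])
      show "finsum W f T \<in> \<phi> ` carrier V" unfolding f(4)[symmetric] using v by (rule imageI)
      show "uq_gen m n (GenK a) \<rhd>\<^bsub>W\<^esub> w \<in> \<phi> ` carrier V"
        if "a \<in> idx m n" "w \<in> \<phi> ` carrier V" for a w
        using that V.Q.GenK_closed by (auto simp: V.act_closed simp flip: act)
    qed
    then obtain u where u: "u \<in> carrier V" "f \<mu> = \<phi> u" by blast
    then have "u \<in> V.wsp \<mu>" using inj_wsp[OF inj] f(3)[of \<mu>] by auto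
    then show ?thesis using u V.span_superset[OF wsp_union_carrier(1)] by blast
  qed
  note S = W.subspaceD[OF image_subspace[OF V.span_subspace[OF wsp_union_carrier(1)]]]
  have "finsum W f T \<in> \<phi> ` V.span ?S"
    using fs S by (intro W.finsum_mem) auto
  then obtain u where u: "u \<in> V.span ?S" "\<phi> v = \<phi> u" using f(4) by auto
  moreover have "u \<in> carrier V"
    using u V.subspaceD(1)[OF V.span_subspace[OF wsp_union_carrier(1)]] by blast
  ultimately show "v \<in> V.span ?S" using inj v by (metis inj_onD)
qed

end

section \<open>The largest submodule in the category\<close>

definition cat_submodules :: "nat \<Rightarrow> nat \<Rightarrow> uq superring \<Rightarrow> uq superring \<Rightarrow> (uq, 'v) smodule \<Rightarrow> 'v set set"
  where "cat_submodules m n Q K M =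
    {N. graded_submodule Q N M \<and> restrict_module M N \<in> cat_C m n Q K}"

text \<open>The carrier that \<open>Ind\<close> cuts out of \<open>coind\<close>, defined for an
  arbitrary module so that its behaviour under maps can be studied apart from coinduction.\<close>

definition cat_part :: "nat \<Rightarrow> nat \<Rightarrow> uq superring \<Rightarrow> uq superring \<Rightarrow> (uq, 'v) smodule \<Rightarrow> 'v set"
  where "cat_part m n Q K M = generate (add_monoid M) (\<Union>(cat_submodules m n Q K M))"

lemma (in uq_algebra) uq_moduleI: "supermodule Q M \<Longrightarrow> uq_module m n Q K M"
  by (intro uq_module.intro uq_algebra_axioms)

lemma (in uq_algebra) uq_mapI: "even_map Q V W \<phi> \<Longrightarrow> uq_map m n Q K V W \<phi>"
  by (intro uq_map.intro uq_moduleI) (auto simp: even_map_def)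

context uq_module
begin

lemma cat_submodules_subset: "\<Union>(cat_submodules m n Q K M) \<subseteq> carrier M"
  by (auto simp: cat_submodules_def graded_submodule_def)

lemma cat_part_subgroup: "additive_subgroup (cat_part m n Q K M) M"
  unfolding cat_part_def additive_subgroup_def
  using cat_submodules_subset by (intro add.generate_is_subgroup) auto

text \<open>The working form of the sum of submodules: a property holds throughout
  \<open>cat_part\<close> once it holds on each member and defines an additive subgroup.\<close>

lemma cat_part_min:
  assumes "additive_subgroup X M" "\<And>N. N \<in> cat_submodules m n Q K M \<Longrightarrow> N \<subseteq> X"
  shows "cat_part m n Q K M \<subseteq> X"
  unfolding cat_part_def using assms
  by (intro add.generate_subgroup_incl) (auto simp: additive_subgroup_def)

lemma cat_part_upper: "N \<in> cat_submodules m n Q K M \<Longrightarrow> N \<subseteq> cat_part m n Q K M"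
  unfolding cat_part_def by (auto intro: generate.incl)

lemma Q_hpart_subset: "hpart Q p \<subseteq> carrier Q"
  using Q.hpart_carrier by blast

lemma cat_part_submodule: "graded_submodule Q (cat_part m n Q K M) M"
proof -
  let ?G = "cat_part m n Q K M"
  note G = additive_subgroupD[OF abelian_group_axioms cat_part_subgroup]
  have N: "additive_subgroup N M" "\<forall>x\<in>carrier Q. \<forall>v\<in>N. x \<rhd> v \<in> N"
    "\<forall>v\<in>N. hcomp M 0 v \<in> N \<and> hcomp M 1 v \<in> N" "N \<subseteq> carrier M"
    if "N \<in> cat_submodules m n Q K M" for N
    using that graded_submodule_iff[OF supermodule_axioms Q_hpart_subset]
    by (auto simp: cat_submodules_def graded_submodule_def)
  \<comment> \<open>Any additive \<open>h\<close> that preserves every member preserves their sum.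
    It is applied to the action of a fixed \<open>x\<close> and to \<open>hcomp M p\<close>.\<close>
  have add: "?G \<subseteq> {v \<in> carrier M. h v \<in> ?G}"
    if h: "\<And>N v. \<lbrakk>N \<in> cat_submodules m n Q K M; v \<in> N\<rbrakk> \<Longrightarrow> h v \<in> N" "h \<zero> = \<zero>"
      "\<And>v w. \<lbrakk>v \<in> carrier M; w \<in> carrier M\<rbrakk> \<Longrightarrow> h (v \<oplus> w) = h v \<oplus> h w"
      "\<And>v. v \<in> carrier M \<Longrightarrow> h v \<in> carrier M" for h
  proof (rule cat_part_min)
    have "h (\<ominus> v) = \<ominus> (h v)" if "v \<in> carrier M" for v
      using h(2) h(3)[of "\<ominus> v" v] h(4) that minus_equality[of "h (\<ominus> v)" "h v"] by (simp add: l_neg)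
    then show "additive_subgroup {v \<in> carrier M. h v \<in> ?G} M"
      unfolding additive_subgroup_iff[OF abelian_group_axioms] using G h by auto
    show "N \<subseteq> {v \<in> carrier M. h v \<in> ?G}" if "N \<in> cat_submodules m n Q K M" for N
      using that h(1) N(4) cat_part_upper by blast
  qed
  have "?G \<subseteq> {v \<in> carrier M. x \<rhd> v \<in> ?G}" if "x \<in> carrier Q" for x
    using that N(2) by (intro add) (auto simp: act_add_right act_closed)
  moreover have "?G \<subseteq> {v \<in> carrier M. hcomp M p v \<in> ?G}" for p
  proof (rule add)
    show "hcomp M p v \<in> N" if "N \<in> cat_submodules m n Q K M" "v \<in> N" for N v
      using N(3)[OF that(1)] that(2) by (cases "p = 0") auto
  qed (auto simp: hcomp_add hcomp_homogeneous[of \<zero> p])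
  ultimately show ?thesis
    unfolding graded_submodule_iff[OF supermodule_axioms Q_hpart_subset]
    using cat_part_subgroup by blast
qed

text \<open>Each member is spanned by its own finite weight vectors, and inclusion carries these to
  finite weight vectors of the sum. The span of the latter is an additive subgroup containing all
  members, hence everything.\<close>

lemma cat_part_cat_C: "restrict_module M (cat_part m n Q K M) \<in> cat_C m n Q K"
proof -
  let ?G = "cat_part m n Q K M"
  interpret G: uq_module m n Q K "restrict_module M ?G"
    using cat_part_submodule by (intro Q.uq_moduleI) (simp add: graded_submodule_def)
  let ?S = "\<Union>\<mu>. G.wsp \<mu>"
  have S: "?S \<subseteq> carrier (restrict_module M ?G)" using G.wsp_carrier by blast
  note GS = G.subspaceD[OF G.span_subspace[OF S]]
  note Gc = additive_subgroupD[OF abelian_group_axioms cat_part_subgroup]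
  have "?G \<subseteq> G.span ?S"
  proof (rule cat_part_min)
    have "\<ominus> v \<in> G.span ?S" if "v \<in> G.span ?S" for v
      using GS(4)[OF that, of "- 1"] GS(1)[OF that] Gc(1) scal_minus by auto
    then show "additive_subgroup (G.span ?S) M"
      unfolding additive_subgroup_iff[OF abelian_group_axioms] using GS Gc(1) by auto
  next
    fix N assume N: "N \<in> cat_submodules m n Q K M"
    then interpret i: uq_map m n Q K "restrict_module M N" "restrict_module M ?G" "\<lambda>v\<in>N. v"
      using cat_part_submodule cat_part_upper[OF N]
      by (intro Q.uq_mapI submodule_inclusion Q.superalgebra_axioms supermodule_axioms)
        (auto simp: cat_submodules_def)
    show "N \<subseteq> G.span ?S" using i.image_weights N by (auto simp: cat_submodules_def)
  qed
  then show ?thesis by (simp add: G.cat_C_iff)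
qed

end

context uq_map
begin

text \<open>The image of a member is again a member, because the category is closed under surjective
  even maps. So the preimage of \<open>cat_part\<close> of \<open>W\<close>, an additive subgroup,
  contains all members in \<open>V\<close>.\<close>

lemma cat_part_image:
  assumes "v \<in> cat_part m n Q K V"
  shows "\<phi> v \<in> cat_part m n Q K W"
proof -
  have "cat_part m n Q K V \<subseteq> {v \<in> carrier V. \<phi> v \<in> cat_part m n Q K W}"
  proof (rule V.cat_part_min)
    note G = additive_subgroupD[OF W.abelian_group_axioms W.cat_part_subgroup]
    show "additive_subgroup {v \<in> carrier V. \<phi> v \<in> cat_part m n Q K W} V"
      unfolding additive_subgroup_iff[OF V.abelian_group_axioms] using G by (auto simp: add minus)
  next
    fix N assume N: "N \<in> cat_submodules m n Q K V"
    then have g: "graded_submodule Q N V" by (simp add: cat_submodules_def)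
    interpret r: uq_map m n Q K "restrict_module V N" "restrict_module W (\<phi> ` N)" "restrict \<phi> N"
      by (intro V.Q.uq_mapI restrict_even_map g image_submodule order_refl)
    have "restrict_module W (\<phi> ` N) \<in> cat_C m n Q K"
      using N by (intro r.surj_cat_C) (auto simp: cat_submodules_def)
    then have "\<phi> ` N \<in> cat_submodules m n Q K W"
      using image_submodule[OF g] by (simp add: cat_submodules_def)
    then show "N \<subseteq> {v \<in> carrier V. \<phi> v \<in> cat_part m n Q K W}"
      using W.cat_part_upper g by (auto simp: graded_submodule_def)
  qed
  then show ?thesis using assms by blast
qed

text \<open>Injectivity is essential: the kernel of \<open>\<phi>\<close> is always mapped into
  \<open>cat_part\<close> of \<open>W\<close>. With it, the preimage embeds into an object of the
  category and is therefore one of the submodules that are summed up in \<open>V\<close>.\<close>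

lemma cat_part_preimage:
  assumes inj: "inj_on \<phi> (carrier V)" and v: "v \<in> carrier V" "\<phi> v \<in> cat_part m n Q K W"
  shows "v \<in> cat_part m n Q K V"
proof -
  let ?N = "{v \<in> carrier V. \<phi> v \<in> cat_part m n Q K W}"
  have g: "graded_submodule Q ?N V" by (rule preimage_submodule[OF W.cat_part_submodule])
  interpret r: uq_map m n Q K "restrict_module V ?N" "restrict_module W (cat_part m n Q K W)"
    "restrict \<phi> ?N"
    by (intro V.Q.uq_mapI restrict_even_map g W.cat_part_submodule) auto
  have "restrict_module V ?N \<in> cat_C m n Q K"
  proof (rule r.inj_cat_C[OF _ W.cat_part_cat_C])
    show "inj_on (restrict \<phi> ?N) (carrier (restrict_module V ?N))"
      using inj by (auto simp: inj_on_def)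
  qed
  then have "?N \<in> cat_submodules m n Q K V" using g by (simp add: cat_submodules_def)
  then show ?thesis using V.cat_part_upper v by blast
qed

end

section \<open>Coinduced modules\<close>

lemma regular_module_simps [simp]:
  "carrier (regular_module Q) = carrier Q"
  "add (regular_module Q) = add Q"
  "zero (regular_module Q) = zero Q"
  "hpart (regular_module Q) = hpart Q"
  "act (regular_module Q) = mult Q"
  by (simp_all add: regular_module_def superring.defs smodule.defs)

lemma coind_simps:
  "carrier (coind P Q V) = {\<lambda>x\<in>carrier Q. \<phi> x \<oplus>\<^bsub>V\<^esub> \<psi> x | \<phi> \<psi>.
     \<phi> \<in> hpart (coind P Q V) 0 \<and> \<psi> \<in> hpart (coind P Q V) 1}"
  "zero (coind P Q V) = (\<lambda>x\<in>carrier Q. \<zero>\<^bsub>V\<^esub>)"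
  "add (coind P Q V) = (\<lambda>\<phi> \<psi>. \<lambda>x\<in>carrier Q. \<phi> x \<oplus>\<^bsub>V\<^esub> \<psi> x)"
  "hpart (coind P Q V) = super_hom_deg P (regular_module Q) V"
  by (simp_all add: coind_def Let_def super_hom_def superring.defs smodule.defs)

text \<open>The definition takes \<open>hcomp\<close> in the record of homomorphisms, before the
  action is attached. As \<open>hcomp\<close> reads only \<open>hpart\<close> and
  \<open>add\<close>, it may be taken in \<open>coind\<close> itself, whose grading is established
  below.\<close>

lemma coind_act: "act (coind P Q V) y \<zeta> = (\<lambda>x\<in>carrier Q.
    \<Oplus>\<^bsub>V\<^esub>i\<in>{0, 1}. \<Oplus>\<^bsub>V\<^esub>j\<in>{0, 1}. \<Oplus>\<^bsub>V\<^esub>k\<in>{0, 1}.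
      ssign V (i * (j + k)) (hcomp (coind P Q V) k \<zeta> (hcomp Q j x \<otimes>\<^bsub>Q\<^esub> hcomp Q i y)))"
proof -
  have "hcomp (super_hom P (regular_module Q) V) = hcomp (coind P Q V)"
    by (intro ext) (simp add: hcomp_def coind_simps(3,4) super_hom_def)
  then show ?thesis by (simp add: coind_def Let_def superring.defs smodule.defs)
qed

context graded_group
begin

text \<open>The shape of the action on \<open>coind\<close>: the indices run over the parities of
  the acting element, of the argument and of the homomorphism, in this order.\<close>

definition bsum :: "(bit \<Rightarrow> bit \<Rightarrow> bit \<Rightarrow> 'b) \<Rightarrow> 'b" where
  "bsum t = (\<Oplus>i\<in>{0, 1}. \<Oplus>j\<in>{0, 1}. \<Oplus>k\<in>{0, 1}. t i j k)"

lemma bsum_closed: "(\<And>i j k. t i j k \<in> carrier M) \<Longrightarrow> bsum t \<in> carrier M"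
  unfolding bsum_def by (intro finsum_closed Pi_I)

lemma bsum_add:
  assumes "\<And>i j k. t i j k \<in> carrier M" "\<And>i j k. u i j k \<in> carrier M"
  shows "bsum (\<lambda>i j k. t i j k \<oplus> u i j k) = bsum t \<oplus> bsum u"
  unfolding bsum_def using assms
  by (simp only: finsum_addf finsum_closed Pi_I)

lemma bsum_single:
  assumes "t i j k \<in> carrier M" "\<And>i' j' k'. (i', j', k') \<noteq> (i, j, k) \<Longrightarrow> t i' j' k' = \<zero>"
  shows "bsum t = t i j k"
proof -
  have *: "finsum M f {0, 1} = f p" if "f p \<in> carrier M" "\<And>r. r \<noteq> p \<Longrightarrow> f r = \<zero>" for f and p :: bit
    using that by (intro finsum_bit_single) (cases p; simp)+
  have z: "finsum M (\<lambda>_ :: bit. \<zero>) A = \<zero>" for A by (rule finsum_zero)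
  have 1: "(\<Oplus>k'\<in>{0, 1}. t i j k') = t i j k" using assms by (intro *) auto
  have 2: "(\<Oplus>k'\<in>{0, 1}. t i j' k') = \<zero>" if "j' \<noteq> j" for j'
    using assms(2)[of i j'] that z by simp
  have 3: "(\<Oplus>k'\<in>{0, 1}. t i' j' k') = \<zero>" if "i' \<noteq> i" for i' j'
    using assms(2)[of i' j'] that z by simp
  have 4: "(\<Oplus>j'\<in>{0, 1}. \<Oplus>k'\<in>{0, 1}. t i j' k') = t i j k"
    using *[of "\<lambda>j'. \<Oplus>k'\<in>{0, 1}. t i j' k'" j] 1 2 assms(1) by simp
  have 5: "(\<Oplus>j'\<in>{0, 1}. \<Oplus>k'\<in>{0, 1}. t i' j' k') = \<zero>" if "i' \<noteq> i" for i'
    using 3[OF that] z by simp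
  show ?thesis unfolding bsum_def
    using *[of "\<lambda>i'. \<Oplus>j'\<in>{0, 1}. \<Oplus>k'\<in>{0, 1}. t i' j' k'" i] 4 5 assms(1) by simp
qed

end

locale coinduction = Q: superalgebra Q + P: superalgebra P + V: supermodule P V
  for P Q :: "'a superring" and V :: "('a, 'v) smodule" +
  assumes P_subset: "carrier P \<subseteq> carrier Q"
    and P_mult: "mult P = mult Q" and P_hpart: "hpart P p \<subseteq> hpart Q p"
begin

abbreviation C where "C \<equiv> coind P Q V"

lemma hpart_iff: "\<phi> \<in> hpart C d \<longleftrightarrow> \<phi> \<in> carrier Q \<rightarrow>\<^sub>E carrier V
     \<and> (\<forall>x\<in>carrier Q. \<forall>y\<in>carrier Q. \<phi> (x \<oplus>\<^bsub>Q\<^esub> y) = \<phi> x \<oplus>\<^bsub>V\<^esub> \<phi> y)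
     \<and> (\<forall>p. \<forall>x\<in>hpart Q p. \<phi> x \<in> hpart V (p + d))
     \<and> (\<forall>p. \<forall>x\<in>hpart P p. \<forall>y\<in>carrier Q.
          \<phi> (x \<otimes>\<^bsub>Q\<^esub> y) = ssign V (p * d) (x \<rhd>\<^bsub>V\<^esub> \<phi> y))"
  by (auto simp: coind_simps(4) super_hom_deg_def image_subset_iff)

lemma hpartD:
  assumes "\<phi> \<in> hpart C d"
  shows "x \<in> carrier Q \<Longrightarrow> \<phi> x \<in> carrier V" "\<phi> \<in> extensional (carrier Q)"
    "\<lbrakk>x \<in> carrier Q; y \<in> carrier Q\<rbrakk> \<Longrightarrow> \<phi> (x \<oplus>\<^bsub>Q\<^esub> y) = \<phi> x \<oplus>\<^bsub>V\<^esub> \<phi> y"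
    "x \<in> hpart Q p \<Longrightarrow> \<phi> x \<in> hpart V (p + d)"
    "\<lbrakk>x \<in> hpart P p; y \<in> carrier Q\<rbrakk> \<Longrightarrow> \<phi> (x \<otimes>\<^bsub>Q\<^esub> y) = ssign V (p * d) (x \<rhd>\<^bsub>V\<^esub> \<phi> y)"
  using assms unfolding hpart_iff by (auto simp: PiE_def)

lemma hpartI:
  assumes "\<And>x. x \<in> carrier Q \<Longrightarrow> \<phi> x \<in> carrier V" "\<phi> \<in> extensional (carrier Q)"
    "\<And>x y. \<lbrakk>x \<in> carrier Q; y \<in> carrier Q\<rbrakk> \<Longrightarrow> \<phi> (x \<oplus>\<^bsub>Q\<^esub> y) = \<phi> x \<oplus>\<^bsub>V\<^esub> \<phi> y"
    "\<And>x p. x \<in> hpart Q p \<Longrightarrow> \<phi> x \<in> hpart V (p + d)"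
    "\<And>x y p. \<lbrakk>x \<in> hpart P p; y \<in> carrier Q\<rbrakk> \<Longrightarrow> \<phi> (x \<otimes>\<^bsub>Q\<^esub> y) = ssign V (p * d) (x \<rhd>\<^bsub>V\<^esub> \<phi> y)"
  shows "\<phi> \<in> hpart C d"
  using assms unfolding hpart_iff by (auto simp: PiE_def)

lemma hpart_P_carrier: "x \<in> hpart P p \<Longrightarrow> x \<in> carrier Q"
  using P_subset P.hpart_carrier by blast

lemma hpart_coind_add:
  assumes "\<phi> \<in> hpart C d" "\<psi> \<in> hpart C d"
  shows "\<phi> \<oplus>\<^bsub>C\<^esub> \<psi> \<in> hpart C d"
  unfolding coind_simps(3)
  by (rule hpartI) (use assms[THEN hpartD(1)] assms[THEN hpartD(3)] assms[THEN hpartD(4)]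
      assms[THEN hpartD(5)] in \<open>auto simp: Q.hpart_carrier V.hpart_add hpart_P_carrier V.ssign_add
        V.act_add_right P.hpart_carrier V.act_closed V.add_interchange\<close>)

lemma hpart_coind_zero: "\<zero>\<^bsub>C\<^esub> \<in> hpart C d"
  unfolding coind_simps(2)
  by (rule hpartI) (auto simp: Q.hpart_carrier hpart_P_carrier P.hpart_carrier)

lemma hpart_coind_minus:
  assumes "\<phi> \<in> hpart C d"
  shows "(\<lambda>x\<in>carrier Q. \<ominus>\<^bsub>V\<^esub> \<phi> x) \<in> hpart C d"
  by (rule hpartI) (use hpartD[OF assms] in \<open>auto simp: Q.hpart_carrier V.hpart_minus hpart_P_carrier
        V.act_minus_right P.hpart_carrier V.act_closed V.minus_add V.a_comm ssign_def\<close>)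

text \<open>Elements of the carrier are written with the even summand first, so the zero map is
  added on the right of an even map and on the left of an odd one.\<close>

lemma hpart_subset: "\<phi> \<in> hpart C d \<Longrightarrow> \<phi> \<in> carrier C"
proof -
  assume \<phi>: "\<phi> \<in> hpart C d"
  have "\<phi> = (\<lambda>x\<in>carrier Q. \<phi> x \<oplus>\<^bsub>V\<^esub> \<zero>\<^bsub>C\<^esub> x)" "\<phi> = (\<lambda>x\<in>carrier Q. \<zero>\<^bsub>C\<^esub> x \<oplus>\<^bsub>V\<^esub> \<phi> x)"
    using hpartD(1,2)[OF \<phi>] by (auto simp: coind_simps(2) extensional_def)
  then show ?thesis using \<phi> hpart_coind_zero unfolding coind_simps(1)
    by (cases "d = 0") auto
qed

lemma carrierD:
  assumes "\<zeta> \<in> carrier C"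
  shows "x \<in> carrier Q \<Longrightarrow> \<zeta> x \<in> carrier V" "\<zeta> \<in> extensional (carrier Q)"
    "\<lbrakk>x \<in> carrier Q; y \<in> carrier Q\<rbrakk> \<Longrightarrow> \<zeta> (x \<oplus>\<^bsub>Q\<^esub> y) = \<zeta> x \<oplus>\<^bsub>V\<^esub> \<zeta> y"
  using assms unfolding coind_simps(1) by (auto simp: hpartD V.add_interchange)

lemma carrierI: "\<lbrakk>\<phi> \<in> hpart C 0; \<psi> \<in> hpart C 1\<rbrakk> \<Longrightarrow> \<phi> \<oplus>\<^bsub>C\<^esub> \<psi> \<in> carrier C"
  unfolding coind_simps(1,3) by blast

lemma carrierE:
  assumes "\<zeta> \<in> carrier C"
  obtains \<phi> \<psi> where "\<phi> \<in> hpart C 0" "\<psi> \<in> hpart C 1" "\<zeta> = \<phi> \<oplus>\<^bsub>C\<^esub> \<psi>"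
  using assms unfolding coind_simps(1,3) by blast

lemma coind_eqI:
  assumes "\<zeta> \<in> carrier C" "\<xi> \<in> carrier C" "\<And>x. x \<in> carrier Q \<Longrightarrow> \<zeta> x = \<xi> x"
  shows "\<zeta> = \<xi>"
  using assms carrierD(2) by (intro extensionalityI[of _ "carrier Q"]) auto

lemma coind_homogeneous_eqI:
  assumes "\<zeta> \<in> carrier C" "\<xi> \<in> carrier C" "\<And>x p. x \<in> hpart Q p \<Longrightarrow> \<zeta> x = \<xi> x"
  shows "\<zeta> = \<xi>"
proof (rule coind_eqI[OF assms(1,2)])
  show "\<zeta> x = \<xi> x" if "x \<in> carrier Q" for x
    using that
    by (induction x rule: Q.graded_induct) (simp_all add: assms carrierD(3)[OF assms(1)] carrierD(3)[OF assms(2)])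
qed

lemma coind_add_apply: "x \<in> carrier Q \<Longrightarrow> (\<phi> \<oplus>\<^bsub>C\<^esub> \<psi>) x = \<phi> x \<oplus>\<^bsub>V\<^esub> \<psi> x"
  by (simp add: coind_simps(3))

lemma coind_add_closed:
  assumes "\<zeta> \<in> carrier C" "\<xi> \<in> carrier C"
  shows "\<zeta> \<oplus>\<^bsub>C\<^esub> \<xi> \<in> carrier C"
proof -
  obtain \<phi> \<psi> where 1: "\<phi> \<in> hpart C 0" "\<psi> \<in> hpart C 1" "\<zeta> = \<phi> \<oplus>\<^bsub>C\<^esub> \<psi>"
    using carrierE[OF assms(1)] .
  obtain \<phi>' \<psi>' where 2: "\<phi>' \<in> hpart C 0" "\<psi>' \<in> hpart C 1" "\<xi> = \<phi>' \<oplus>\<^bsub>C\<^esub> \<psi>'"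
    using carrierE[OF assms(2)] .
  have "\<zeta> \<oplus>\<^bsub>C\<^esub> \<xi> = (\<phi> \<oplus>\<^bsub>C\<^esub> \<phi>') \<oplus>\<^bsub>C\<^esub> (\<psi> \<oplus>\<^bsub>C\<^esub> \<psi>')"
    unfolding 1(3) 2(3) unfolding coind_simps(3)
    using 1(1,2)[THEN hpartD(1)] 2(1,2)[THEN hpartD(1)] by (auto simp: V.add_interchange)
  then show ?thesis using 1 2 by (simp add: carrierI hpart_coind_add)
qed

lemma coind_abelian_group: "abelian_group C"
proof (rule abelian_groupI)
  fix \<zeta> assume \<zeta>: "\<zeta> \<in> carrier C"
  obtain \<phi> \<psi> where 1: "\<phi> \<in> hpart C 0" "\<psi> \<in> hpart C 1" "\<zeta> = \<phi> \<oplus>\<^bsub>C\<^esub> \<psi>"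
    using carrierE[OF \<zeta>] .
  \<comment> \<open>Membership in the carrier requires an even and an odd summand, so the negative
    is formed on each of them.\<close>
  let ?m = "(\<lambda>x\<in>carrier Q. \<ominus>\<^bsub>V\<^esub> \<phi> x) \<oplus>\<^bsub>C\<^esub> (\<lambda>x\<in>carrier Q. \<ominus>\<^bsub>V\<^esub> \<psi> x)"
  have "?m \<in> carrier C" using 1 by (intro carrierI hpart_coind_minus)
  moreover have "?m \<oplus>\<^bsub>C\<^esub> \<zeta> = \<zero>\<^bsub>C\<^esub>"
    unfolding 1(3) unfolding coind_simps(2,3) using 1(1,2)[THEN hpartD(1)]
    by (auto simp: V.add_interchange V.l_neg)
  ultimately show "\<exists>\<xi>\<in>carrier C. \<xi> \<oplus>\<^bsub>C\<^esub> \<zeta> = \<zero>\<^bsub>C\<^esub>" by blast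
  show "\<zero>\<^bsub>C\<^esub> \<oplus>\<^bsub>C\<^esub> \<zeta> = \<zeta>"
    using carrierD[OF \<zeta>] by (auto simp: coind_simps(2,3) extensional_def)
next
  show "\<zero>\<^bsub>C\<^esub> \<in> carrier C" using hpart_subset hpart_coind_zero .
next
  fix \<zeta> \<xi> \<eta> assume "\<zeta> \<in> carrier C" "\<xi> \<in> carrier C" "\<eta> \<in> carrier C"
  then show "\<zeta> \<oplus>\<^bsub>C\<^esub> \<xi> \<oplus>\<^bsub>C\<^esub> \<eta> = \<zeta> \<oplus>\<^bsub>C\<^esub> (\<xi> \<oplus>\<^bsub>C\<^esub> \<eta>)"
    unfolding coind_simps(3) by (intro restrict_ext) (simp add: carrierD(1) V.a_assoc)
next
  fix \<zeta> \<xi> assume "\<zeta> \<in> carrier C" "\<xi> \<in> carrier C"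
  then show "\<zeta> \<oplus>\<^bsub>C\<^esub> \<xi> = \<xi> \<oplus>\<^bsub>C\<^esub> \<zeta>"
    unfolding coind_simps(3) by (intro restrict_ext) (simp add: carrierD(1) V.a_comm)
qed (rule coind_add_closed)

lemma coind_minus:
  assumes "\<zeta> \<in> carrier C" "(\<lambda>x\<in>carrier Q. \<ominus>\<^bsub>V\<^esub> \<zeta> x) \<in> carrier C"
  shows "\<ominus>\<^bsub>C\<^esub> \<zeta> = (\<lambda>x\<in>carrier Q. \<ominus>\<^bsub>V\<^esub> \<zeta> x)"
proof -
  interpret abelian_group C by (rule coind_abelian_group)
  show ?thesis
    by (rule minus_equality) (use assms carrierD(1)[OF assms(1)] in \<open>auto simp: coind_simps(2,3) V.l_neg\<close>)
qed

lemma hpart_coind_a_inv: "\<phi> \<in> hpart C d \<Longrightarrow> \<ominus>\<^bsub>C\<^esub> \<phi> \<in> hpart C d"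
  using coind_minus[OF hpart_subset hpart_subset] hpart_coind_minus[of \<phi> d] by metis

sublocale C: graded_group C
proof (rule graded_groupI[OF coind_abelian_group])
  show "additive_subgroup (hpart C p) C" for p
    unfolding additive_subgroup_iff[OF coind_abelian_group]
    using hpart_subset hpart_coind_zero hpart_coind_add hpart_coind_a_inv by auto
  show "\<exists>\<phi>\<in>hpart C 0. \<exists>\<psi>\<in>hpart C 1. \<zeta> = \<phi> \<oplus>\<^bsub>C\<^esub> \<psi>" if "\<zeta> \<in> carrier C" for \<zeta>
    using carrierE[OF that] by blast
  show "\<zeta> = \<zero>\<^bsub>C\<^esub>" if "\<zeta> \<in> hpart C 0" "\<zeta> \<in> hpart C 1" for \<zeta>
  proof (rule coind_homogeneous_eqI)
    show "\<zeta> x = \<zero>\<^bsub>C\<^esub> x" if x: "x \<in> hpart Q p" for x p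
    proof -
      have "\<zeta> x \<in> hpart V (p + 0)" "\<zeta> x \<in> hpart V (p + 1)"
        using x \<open>\<zeta> \<in> hpart C 0\<close> \<open>\<zeta> \<in> hpart C 1\<close> hpartD(4) by blast+
      moreover have "p + 0 \<noteq> p + 1" by (cases "p = 0") simp_all
      ultimately have "\<zeta> x = \<zero>\<^bsub>V\<^esub>" by (rule V.hpart_disjoint)
      then show ?thesis using Q.hpart_carrier[OF x] by (simp add: coind_simps(2))
    qed
  qed (use that hpart_subset hpart_coind_zero in auto)
qed

abbreviation cact (infixr "\<star>" 75) where "y \<star> \<zeta> \<equiv> act C y \<zeta>"

definition term_act where
  "term_act y \<zeta> x i j k = ssign V (i * (j + k)) (hcomp C k \<zeta> (hcomp Q j x \<otimes>\<^bsub>Q\<^esub> hcomp Q i y))"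

lemma cact_bsum: "x \<in> carrier Q \<Longrightarrow> (y \<star> \<zeta>) x = V.bsum (term_act y \<zeta> x)"
  by (simp add: coind_act V.bsum_def term_act_def)

lemma cact_extensional: "y \<star> \<zeta> \<in> extensional (carrier Q)"
  by (simp add: coind_act)

lemma term_act_closed:
  "\<lbrakk>y \<in> carrier Q; \<zeta> \<in> carrier C; x \<in> carrier Q\<rbrakk> \<Longrightarrow> term_act y \<zeta> x i j k \<in> carrier V"
  by (simp add: term_act_def carrierD(1)[OF C.hcomp_closed])

lemma cact_apply_closed:
  "\<lbrakk>y \<in> carrier Q; \<zeta> \<in> carrier C; x \<in> carrier Q\<rbrakk> \<Longrightarrow> (y \<star> \<zeta>) x \<in> carrier V"
  by (simp add: cact_bsum V.bsum_closed term_act_closed)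

lemma cact_apply_add_left:
  assumes "y \<in> carrier Q" "z \<in> carrier Q" "\<zeta> \<in> carrier C" "x \<in> carrier Q"
  shows "((y \<oplus>\<^bsub>Q\<^esub> z) \<star> \<zeta>) x = (y \<star> \<zeta>) x \<oplus>\<^bsub>V\<^esub> (z \<star> \<zeta>) x"
proof -
  have "term_act (y \<oplus>\<^bsub>Q\<^esub> z) \<zeta> x = (\<lambda>i j k. term_act y \<zeta> x i j k \<oplus>\<^bsub>V\<^esub> term_act z \<zeta> x i j k)"
    using assms by (intro ext) (simp add: term_act_def Q.hcomp_add Q.r_distr carrierD[OF C.hcomp_closed] V.ssign_add)
  then show ?thesis using assms by (simp add: cact_bsum V.bsum_add term_act_closed)
qed

lemma cact_apply_add_right:
  assumes "y \<in> carrier Q" "\<zeta> \<in> carrier C" "\<xi> \<in> carrier C" "x \<in> carrier Q"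
  shows "(y \<star> (\<zeta> \<oplus>\<^bsub>C\<^esub> \<xi>)) x = (y \<star> \<zeta>) x \<oplus>\<^bsub>V\<^esub> (y \<star> \<xi>) x"
proof -
  have "term_act y (\<zeta> \<oplus>\<^bsub>C\<^esub> \<xi>) x = (\<lambda>i j k. term_act y \<zeta> x i j k \<oplus>\<^bsub>V\<^esub> term_act y \<xi> x i j k)"
    using assms by (intro ext) (simp add: term_act_def C.hcomp_add coind_add_apply carrierD[OF C.hcomp_closed] V.ssign_add)
  then show ?thesis using assms by (simp add: cact_bsum V.bsum_add term_act_closed)
qed

lemma cact_apply_add:
  assumes "y \<in> carrier Q" "\<zeta> \<in> carrier C" "x \<in> carrier Q" "z \<in> carrier Q"
  shows "(y \<star> \<zeta>) (x \<oplus>\<^bsub>Q\<^esub> z) = (y \<star> \<zeta>) x \<oplus>\<^bsub>V\<^esub> (y \<star> \<zeta>) z"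
proof -
  have "term_act y \<zeta> (x \<oplus>\<^bsub>Q\<^esub> z) = (\<lambda>i j k. term_act y \<zeta> x i j k \<oplus>\<^bsub>V\<^esub> term_act y \<zeta> z i j k)"
    using assms by (intro ext) (simp add: term_act_def Q.hcomp_add Q.l_distr carrierD[OF C.hcomp_closed] V.ssign_add)
  then show ?thesis using assms by (simp add: cact_bsum V.bsum_add term_act_closed)
qed

text \<open>On homogeneous data one of the eight terms survives, which recovers the sign rule that
  defines the action. The module axioms below follow from this formula and additivity.\<close>

lemma cact_homogeneous:
  assumes "y \<in> hpart Q i" "\<zeta> \<in> hpart C k" "x \<in> hpart Q j"
  shows "(y \<star> \<zeta>) x = ssign V (i * (j + k)) (\<zeta> (x \<otimes>\<^bsub>Q\<^esub> y))"
proof -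
  note c = Q.hpart_carrier[OF assms(1)] hpart_subset[OF assms(2)] Q.hpart_carrier[OF assms(3)]
  have \<zeta>0: "\<zeta> \<zero>\<^bsub>Q\<^esub> = \<zero>\<^bsub>V\<^esub>"
    using carrierD(3)[OF c(2), of "\<zero>\<^bsub>Q\<^esub>" "\<zero>\<^bsub>Q\<^esub>"] carrierD(1)[OF c(2), of "\<zero>\<^bsub>Q\<^esub>"]
    by (simp add: V.add.r_cancel_one)
  have t: "term_act y \<zeta> x i' j' k' = (if (i', j', k') = (i, j, k)
      then ssign V (i * (j + k)) (\<zeta> (x \<otimes>\<^bsub>Q\<^esub> y)) else \<zero>\<^bsub>V\<^esub>)" for i' j' k'
    unfolding term_act_def using c \<zeta>0
    by (simp add: Q.hcomp_homogeneous[OF assms(1)] C.hcomp_homogeneous[OF assms(2)]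
        Q.hcomp_homogeneous[OF assms(3)] coind_simps(2))
  have "V.bsum (term_act y \<zeta> x) = term_act y \<zeta> x i j k"
    using c by (intro V.bsum_single term_act_closed) (auto simp only: t if_False)
  then show ?thesis using c(3) t by (simp add: cact_bsum)
qed

lemma cact_hpart:
  assumes y: "y \<in> hpart Q i" and \<zeta>: "\<zeta> \<in> hpart C k"
  shows "y \<star> \<zeta> \<in> hpart C (i + k)"
proof (rule hpartI)
  note c = Q.hpart_carrier[OF y] hpart_subset[OF \<zeta>]
  show "(y \<star> \<zeta>) x \<in> hpart V (p + (i + k))" if "x \<in> hpart Q p" for x p
  proof -
    have "\<zeta> (x \<otimes>\<^bsub>Q\<^esub> y) \<in> hpart V ((p + i) + k)"
      using that y \<zeta> by (intro hpartD(4) Q.mult_hpart)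
    then show ?thesis
      unfolding cact_homogeneous[OF y \<zeta> that] by (simp add: V.ssign_hpart add.assoc)
  qed
  show "(y \<star> \<zeta>) (z \<otimes>\<^bsub>Q\<^esub> x) = ssign V (p * (i + k)) (z \<rhd>\<^bsub>V\<^esub> (y \<star> \<zeta>) x)"
    if z: "z \<in> hpart P p" and x: "x \<in> carrier Q" for z x p
    using x
  proof (induction x rule: Q.graded_induct)
    case (homogeneous j x)
    have zQ: "z \<in> hpart Q p" "z \<in> carrier Q" "z \<in> carrier P"
      using z P_hpart hpart_P_carrier P.hpart_carrier by blast+
    note xc = Q.hpart_carrier[OF homogeneous]
    have v: "\<zeta> (x \<otimes>\<^bsub>Q\<^esub> y) \<in> carrier V" using carrierD(1)[OF c(2)] xc c by simp
    then have zv: "z \<rhd>\<^bsub>V\<^esub> \<zeta> (x \<otimes>\<^bsub>Q\<^esub> y) \<in> carrier V" using zQ V.act_closed by blast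
    have "(y \<star> \<zeta>) (z \<otimes>\<^bsub>Q\<^esub> x) = ssign V (i * ((p + j) + k)) (\<zeta> (z \<otimes>\<^bsub>Q\<^esub> (x \<otimes>\<^bsub>Q\<^esub> y)))"
      using cact_homogeneous[OF y \<zeta> Q.mult_hpart[OF zQ(1) homogeneous]] zQ xc c by (simp add: Q.m_assoc)
    also have "\<dots> = ssign V (i * ((p + j) + k) + p * k) (z \<rhd>\<^bsub>V\<^esub> \<zeta> (x \<otimes>\<^bsub>Q\<^esub> y))"
      using hpartD(5)[OF \<zeta> z, of "x \<otimes>\<^bsub>Q\<^esub> y"] xc c zv by simp
    \<comment> \<open>The left exponent comes from \<open>y\<close> acting at an argument of parity
      \<open>p + j\<close> and \<open>z\<close> then passing \<open>\<zeta>\<close>; the right one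
      from \<open>z\<close> passing the map \<open>y \<star> \<zeta>\<close> of parity
      \<open>i + k\<close> and \<open>y\<close> then acting at \<open>x\<close>.\<close>
    also have "i * ((p + j) + k) + p * k = p * (i + k) + i * (j + k)"
      by (simp add: algebra_simps)
    also have "ssign V \<dots> (z \<rhd>\<^bsub>V\<^esub> \<zeta> (x \<otimes>\<^bsub>Q\<^esub> y))
        = ssign V (p * (i + k)) (z \<rhd>\<^bsub>V\<^esub> ssign V (i * (j + k)) (\<zeta> (x \<otimes>\<^bsub>Q\<^esub> y)))"
      using zv v zQ by (simp add: V.act_ssign)
    finally show ?case by (simp add: cact_homogeneous[OF y \<zeta> homogeneous])
  next
    case (add a b)
    have zc: "z \<in> carrier Q" "z \<in> carrier P" using z hpart_P_carrier P.hpart_carrier by blast+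
    show ?case using add zc c
      by (simp add: Q.r_distr cact_apply_add cact_apply_closed V.act_add_right V.ssign_add V.act_closed)
  qed
qed (use assms Q.hpart_carrier hpart_subset in
    \<open>auto simp: cact_apply_closed cact_extensional cact_apply_add\<close>)

lemma coind_add_eqI:
  assumes "\<zeta> \<in> extensional (carrier Q)" "\<And>x. x \<in> carrier Q \<Longrightarrow> \<zeta> x = \<xi> x \<oplus>\<^bsub>V\<^esub> \<eta> x"
  shows "\<zeta> = \<xi> \<oplus>\<^bsub>C\<^esub> \<eta>"
  using assms by (auto simp: coind_simps(3) extensional_def)

lemma cact_add_left: "\<lbrakk>y \<in> carrier Q; z \<in> carrier Q; \<zeta> \<in> carrier C\<rbrakk>
    \<Longrightarrow> (y \<oplus>\<^bsub>Q\<^esub> z) \<star> \<zeta> = y \<star> \<zeta> \<oplus>\<^bsub>C\<^esub> z \<star> \<zeta>"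
  by (intro coind_add_eqI cact_extensional cact_apply_add_left)

lemma cact_add_right: "\<lbrakk>y \<in> carrier Q; \<zeta> \<in> carrier C; \<xi> \<in> carrier C\<rbrakk>
    \<Longrightarrow> y \<star> (\<zeta> \<oplus>\<^bsub>C\<^esub> \<xi>) = y \<star> \<zeta> \<oplus>\<^bsub>C\<^esub> y \<star> \<xi>"
  by (intro coind_add_eqI cact_extensional cact_apply_add_right)

lemma cact_closed: "\<lbrakk>y \<in> carrier Q; \<zeta> \<in> carrier C\<rbrakk> \<Longrightarrow> y \<star> \<zeta> \<in> carrier C"
proof (induction y rule: Q.graded_induct)
  case (homogeneous i y)
  note y = Q.hpart_carrier[OF homogeneous(1)]
  from homogeneous(2) show ?case
  proof (induction \<zeta> rule: C.graded_induct)
    case h: (homogeneous k \<zeta>)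
    then show ?case using cact_hpart homogeneous(1) hpart_subset by blast
  qed (simp add: y cact_add_right)
qed (simp add: cact_add_left)

text \<open>Multiplying the argument on the right gives a left action: evaluating
  \<open>y \<star> z \<star> \<zeta>\<close> at \<open>x\<close> first moves to \<open>x y\<close>
  and then to \<open>x y z\<close>.\<close>

lemma cact_mult:
  "\<lbrakk>y \<in> carrier Q; z \<in> carrier Q; \<zeta> \<in> carrier C\<rbrakk> \<Longrightarrow> (y \<otimes>\<^bsub>Q\<^esub> z) \<star> \<zeta> = y \<star> z \<star> \<zeta>"
proof (induction y rule: Q.graded_induct)
  case y: (homogeneous i y)
  note yc = Q.hpart_carrier[OF y(1)]
  from y(2,3) show ?case
  proof (induction z rule: Q.graded_induct)
    case z: (homogeneous j z)
    note zc = Q.hpart_carrier[OF z(1)]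
    from z(2) show ?case
    proof (induction \<zeta> rule: C.graded_induct)
      case \<zeta>: (homogeneous k \<zeta>)
      note \<zeta>c = hpart_subset[OF \<zeta>]
      show ?case
      proof (rule coind_homogeneous_eqI)
        fix x p assume x: "x \<in> hpart Q p"
        note xc = Q.hpart_carrier[OF x]
        have v: "\<zeta> (x \<otimes>\<^bsub>Q\<^esub> (y \<otimes>\<^bsub>Q\<^esub> z)) \<in> carrier V" using carrierD(1)[OF \<zeta>c] xc yc zc by simp
        have "(y \<star> z \<star> \<zeta>) x = ssign V (i * (p + (j + k))) ((z \<star> \<zeta>) (x \<otimes>\<^bsub>Q\<^esub> y))"
          by (rule cact_homogeneous[OF y(1) cact_hpart[OF z(1) \<zeta>] x])
        also have "(z \<star> \<zeta>) (x \<otimes>\<^bsub>Q\<^esub> y) = ssign V (j * ((p + i) + k)) (\<zeta> (x \<otimes>\<^bsub>Q\<^esub> (y \<otimes>\<^bsub>Q\<^esub> z)))"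
          using cact_homogeneous[OF z(1) \<zeta> Q.mult_hpart[OF x y(1)]] xc yc zc by (simp add: Q.m_assoc)
        also have "ssign V (i * (p + (j + k))) \<dots>
            = ssign V (i * (p + (j + k)) + j * ((p + i) + k)) (\<zeta> (x \<otimes>\<^bsub>Q\<^esub> (y \<otimes>\<^bsub>Q\<^esub> z)))"
          using v by simp
        \<comment> \<open>The two copies of \<open>i * j\<close> cancel modulo 2.\<close>
        also have "i * (p + (j + k)) + j * ((p + i) + k) = (i + j) * (p + k)"
          by (simp add: algebra_simps)
        also have "ssign V \<dots> (\<zeta> (x \<otimes>\<^bsub>Q\<^esub> (y \<otimes>\<^bsub>Q\<^esub> z))) = ((y \<otimes>\<^bsub>Q\<^esub> z) \<star> \<zeta>) x"
          using cact_homogeneous[OF Q.mult_hpart[OF y(1) z(1)] \<zeta> x] by simp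
        finally show "((y \<otimes>\<^bsub>Q\<^esub> z) \<star> \<zeta>) x = (y \<star> z \<star> \<zeta>) x" by simp
      qed (use yc zc \<zeta>c in \<open>auto intro!: cact_closed\<close>)
    qed (use yc zc in \<open>simp add: cact_add_right cact_closed\<close>)
  qed (use yc in \<open>simp add: cact_add_left cact_add_right cact_closed Q.r_distr\<close>)
qed (simp add: cact_add_left cact_closed Q.l_distr)

lemma cact_one: "\<zeta> \<in> carrier C \<Longrightarrow> \<one>\<^bsub>Q\<^esub> \<star> \<zeta> = \<zeta>"
proof (induction \<zeta> rule: C.graded_induct)
  case (homogeneous k \<zeta>)
  note c = hpart_subset[OF homogeneous]
  show ?case
  proof (rule coind_homogeneous_eqI)
    show "(\<one>\<^bsub>Q\<^esub> \<star> \<zeta>) x = \<zeta> x" if "x \<in> hpart Q p" for x p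
      using cact_homogeneous[OF Q.one_hpart homogeneous that] Q.hpart_carrier[OF that] by simp
  qed (use c in \<open>auto intro!: cact_closed\<close>)
qed (simp add: cact_add_right)

lemma coind_supermodule: "supermodule Q C"
  by (rule supermodule_altI[OF C.graded_group_axioms])
    (auto intro: cact_closed cact_add_left cact_add_right cact_mult cact_one cact_hpart)

end

section \<open>Functoriality and left exactness of coinduction\<close>

locale coinduction_map = V: coinduction P Q V + W: coinduction P Q W + even_map P V W f
  for P Q :: "'a superring" and V :: "('a, 'v) smodule" and W :: "('a, 'w) smodule" and f
begin

abbreviation push where "push \<equiv> compose (carrier Q) f"

text \<open>Post-composition with an even map shifts no parity, and \<open>f\<close> commutes with
  \<open>ssign\<close> because it is additive.\<close>

lemma push_hpart: "\<zeta> \<in> hpart V.C d \<Longrightarrow> push \<zeta> \<in> hpart W.C d"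
proof -
  assume \<zeta>: "\<zeta> \<in> hpart V.C d"
  note z = V.hpartD[OF \<zeta>]
  have s: "f (ssign V s v) = ssign W s (f v)" if "v \<in> carrier V" for s v
    using that by (simp add: ssign_def minus)
  show ?thesis
    by (rule W.hpartI) (use z in \<open>auto simp: compose_def add hpart V.Q.hpart_carrier V.hpart_P_carrier
      s V.V.act_closed V.P.hpart_carrier act\<close>)
qed

lemma push_add: "\<lbrakk>\<zeta> \<in> carrier V.C; \<xi> \<in> carrier V.C\<rbrakk>
    \<Longrightarrow> push (\<zeta> \<oplus>\<^bsub>V.C\<^esub> \<xi>) = push \<zeta> \<oplus>\<^bsub>W.C\<^esub> push \<xi>"
  by (auto simp: coind_simps(3) compose_def add V.carrierD(1))

lemma push_closed: "\<zeta> \<in> carrier V.C \<Longrightarrow> push \<zeta> \<in> carrier W.C"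
  by (induction \<zeta> rule: V.C.graded_induct)
    (auto simp: push_add W.coind_add_closed intro: push_hpart W.hpart_subset)

lemma push_act:
  assumes y: "y \<in> hpart Q i" and "\<zeta> \<in> carrier V.C"
  shows "push (y \<rhd>\<^bsub>V.C\<^esub> \<zeta>) = y \<rhd>\<^bsub>W.C\<^esub> push \<zeta>"
  using assms(2)
proof (induction \<zeta> rule: V.C.graded_induct)
  case (homogeneous k \<zeta>)
  note c = V.Q.hpart_carrier[OF y] V.hpart_subset[OF homogeneous]
  show ?case
  proof (rule W.coind_homogeneous_eqI)
    show "push (y \<rhd>\<^bsub>V.C\<^esub> \<zeta>) x = (y \<rhd>\<^bsub>W.C\<^esub> push \<zeta>) x" if x: "x \<in> hpart Q p" for x p
      using V.cact_homogeneous[OF y homogeneous x] W.cact_homogeneous[OF y push_hpart[OF homogeneous] x]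
        V.Q.hpart_carrier[OF x] c V.carrierD(1)[OF c(2)]
      by (simp add: compose_def ssign_def minus)
  qed (use c in \<open>auto intro!: push_closed V.cact_closed W.cact_closed\<close>)
next
  case (add a b)
  then show ?case using V.Q.hpart_carrier[OF y]
    by (simp add: V.cact_add_right W.cact_add_right push_add V.cact_closed push_closed)
qed

lemma push_even_map: "even_map Q V.C W.C (restrict push (carrier V.C))"
proof -
  interpret VC: supermodule Q V.C by (rule V.coind_supermodule)
  interpret WC: supermodule Q W.C by (rule W.coind_supermodule)
  show ?thesis
  proof unfold_locales
    show "restrict push (carrier V.C) \<in> even_hom Q V.C W.C"
      unfolding super_hom_deg_def
      using push_closed push_hpart V.hpart_subset V.Q.hpart_carrier
      by (auto simp: push_add V.coind_add_closed push_act V.cact_closed ssign_def)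
  qed
qed

lemma push_inj:
  assumes "inj_on f (carrier V)"
  shows "inj_on push (carrier V.C)"
proof (rule inj_onI)
  fix \<zeta> \<xi> assume c: "\<zeta> \<in> carrier V.C" "\<xi> \<in> carrier V.C" and eq: "push \<zeta> = push \<xi>"
  show "\<zeta> = \<xi>"
  proof (rule V.coind_eqI[OF c])
    fix x assume x: "x \<in> carrier Q"
    then have "f (\<zeta> x) = f (\<xi> x)" using fun_cong[OF eq, of x] by (simp add: compose_def)
    then show "\<zeta> x = \<xi> x" using assms V.carrierD(1) c x by (metis inj_onD)
  qed
qed

text \<open>The pointwise inverse of \<open>f\<close> along \<open>\<zeta>\<close> satisfies each
  required equation because the equation holds after applying the injective
  \<open>f\<close>.\<close>

lemma push_lift_homogeneous:
  assumes inj: "inj_on f (carrier V)" and \<zeta>: "\<zeta> \<in> hpart W.C d"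
    and im: "\<And>x. x \<in> carrier Q \<Longrightarrow> \<zeta> x \<in> f ` carrier V"
  shows "\<exists>\<eta>\<in>hpart V.C d. push \<eta> = \<zeta>"
proof -
  define \<eta> where "\<eta> = (\<lambda>x\<in>carrier Q. inv_into (carrier V) f (\<zeta> x))"
  note z = W.hpartD[OF \<zeta>]
  have \<eta>: "\<eta> x \<in> carrier V" "f (\<eta> x) = \<zeta> x" if "x \<in> carrier Q" for x
    using im[OF that] that by (auto simp: \<eta>_def inv_into_into f_inv_into_f)
  have eqI: "v = w" if "v \<in> carrier V" "w \<in> carrier V" "f v = f w" for v w
    using inj that by (rule_tac inj_onD)
  have s: "f (ssign V s v) = ssign W s (f v)" if "v \<in> carrier V" for s v
    using that by (simp add: ssign_def minus)
  have "\<eta> \<in> hpart V.C d"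
  proof (rule V.hpartI)
    show "\<eta> \<in> extensional (carrier Q)" by (simp add: \<eta>_def)
    show "\<eta> (x \<oplus>\<^bsub>Q\<^esub> y) = \<eta> x \<oplus>\<^bsub>V\<^esub> \<eta> y" if "x \<in> carrier Q" "y \<in> carrier Q" for x y
      using that \<eta> z by (intro eqI) (auto simp: add)
    \<comment> \<open>Parity is not an equation, so injectivity does not apply to it directly.
      Rephrased as being equal to one's own component it is, since \<open>f\<close> commutes with
      \<open>hcomp\<close>.\<close>
    show "\<eta> x \<in> hpart V (p + d)" if x: "x \<in> hpart Q p" for x p
    proof -
      note xc = V.Q.hpart_carrier[OF x]
      have "f (hcomp V (p + d) (\<eta> x)) = hcomp W (p + d) (\<zeta> x)"
        using \<eta>[OF xc] hcomp by metis
      also have "\<dots> = f (\<eta> x)" using W.V.hcomp_homogeneous[OF z(4)[OF x]] \<eta>(2)[OF xc] by simp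
      finally have "hcomp V (p + d) (\<eta> x) = \<eta> x" using \<eta>(1)[OF xc] by (intro eqI) auto
      then show ?thesis using V.V.hcomp_hpart[OF \<eta>(1)[OF xc], of "p + d"] by simp
    qed
    show "\<eta> (x \<otimes>\<^bsub>Q\<^esub> y) = ssign V (p * d) (x \<rhd>\<^bsub>V\<^esub> \<eta> y)" if "x \<in> hpart P p" "y \<in> carrier Q" for x y p
      using that \<eta> z(5)[OF that] V.hpart_P_carrier[OF that(1)] V.P.hpart_carrier[OF that(1)]
      by (intro eqI) (auto simp: s act V.V.act_closed)
  qed (rule \<eta>)
  moreover have "push \<eta> = \<zeta>"
    using \<eta> z(2) by (intro extensionalityI[of _ "carrier Q"]) (auto simp: compose_def)
  ultimately show ?thesis by blast
qed

end

text \<open>\<open>\<zeta>\<close> need not be homogeneous. Composition with \<open>g\<close>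
  commutes with \<open>hcomp\<close>, so \<open>g\<close> kills both components of
  \<open>\<zeta>\<close>; each takes values in the image of \<open>f\<close> and is lifted on its
  own, and the lifts are added.\<close>

lemma coind_left_exact:
  assumes "coinduction_map P Q A B f" "coinduction_map P Q B C g" "left_exact_seq A f B g C"
    and \<zeta>: "\<zeta> \<in> carrier (coind P Q B)" "compose (carrier Q) g \<zeta> = \<zero>\<^bsub>coind P Q C\<^esub>"
  shows "\<exists>\<eta>\<in>carrier (coind P Q A). compose (carrier Q) f \<eta> = \<zeta>"
proof -
  interpret f: coinduction_map P Q A B f by fact
  interpret g: coinduction_map P Q B C g by fact
  interpret gp: even_map Q "coind P Q B" "coind P Q C" "restrict g.push (carrier f.W.C)"
    by (rule g.push_even_map)
  have ex: "inj_on f (carrier A)" "f ` carrier A = {b \<in> carrier B. g b = \<zero>\<^bsub>C\<^esub>}"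
    using assms(3) by (auto simp: left_exact_seq_def)
  have lift: "\<exists>\<eta>\<in>hpart f.V.C p. f.push \<eta> = hcomp f.W.C p \<zeta>" for p
  proof (rule f.push_lift_homogeneous[OF ex(1)])
    show "hcomp f.W.C p \<zeta> \<in> hpart f.W.C p" using \<zeta>(1) by (rule f.W.C.hcomp_hpart)
    have "g.push (hcomp f.W.C p \<zeta>) = hcomp g.W.C p (g.push \<zeta>)"
      using gp.hcomp[OF \<zeta>(1), of p] \<zeta>(1) by simp
    also have "\<dots> = \<zero>\<^bsub>g.W.C\<^esub>"
      unfolding \<zeta>(2) using g.W.C.hcomp_homogeneous[OF g.W.C.hpart_zero, of p p] by simp
    finally have z: "g.push (hcomp f.W.C p \<zeta>) = \<zero>\<^bsub>g.W.C\<^esub>" .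
    show "hcomp f.W.C p \<zeta> x \<in> f ` carrier A" if "x \<in> carrier Q" for x
      unfolding ex(2) using fun_cong[OF z, of x] that f.W.carrierD(1)[OF f.W.C.hcomp_closed[OF \<zeta>(1)] that]
      by (simp add: compose_def coind_simps(2))
  qed
  obtain \<eta> where \<eta>: "\<eta> \<in> hpart f.V.C 0" "f.push \<eta> = hcomp f.W.C 0 \<zeta>" using lift by blast
  obtain \<xi> where \<xi>: "\<xi> \<in> hpart f.V.C 1" "f.push \<xi> = hcomp f.W.C 1 \<zeta>" using lift by blast
  have "f.push (\<eta> \<oplus>\<^bsub>f.V.C\<^esub> \<xi>) = \<zeta>"
    using f.push_add[of \<eta> \<xi>] \<eta> \<xi> f.V.hpart_subset f.W.C.hcomp_decomp[OF \<zeta>(1)] by auto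
  then show ?thesis using f.V.carrierI[OF \<eta>(1) \<xi>(1)] by blast
qed

section \<open>The quantum superalgebra is graded\<close>

definition homogeneous :: "nat \<Rightarrow> nat \<Rightarrow> bit \<Rightarrow> qfree \<Rightarrow> bool" where
  "homogeneous m n p x \<longleftrightarrow> x \<in> carrier (free_alg m n) \<and> (\<forall>w\<in>Poly_Mapping.keys x. word_parity m w = p)"

definition free_part :: "nat \<Rightarrow> bit \<Rightarrow> qfree \<Rightarrow> qfree" where
  "free_part m p x = (\<Sum>w\<in>{w \<in> Poly_Mapping.keys x. word_parity m w = p}.
     Poly_Mapping.single w (Poly_Mapping.lookup x w))"

lemma free_alg_simps [simp]:
  "mult (free_alg m n) = (*)" "one (free_alg m n) = 1" "zero (free_alg m n) = 0"
  "add (free_alg m n) = (+)"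
  by (simp_all add: free_alg_def)

lemma free_alg_mem: "x \<in> carrier (free_alg m n)
    \<longleftrightarrow> (\<forall>w\<in>Poly_Mapping.keys x. set (letters w) \<subseteq> gens m n)"
  by (simp add: free_alg_def)

lemma homogeneous_iff: "homogeneous m n p x
    \<longleftrightarrow> (\<forall>w\<in>Poly_Mapping.keys x. set (letters w) \<subseteq> gens m n \<and> word_parity m w = p)"
  by (auto simp: homogeneous_def free_alg_mem)

lemma word_parity_add: "word_parity m (v + w) = word_parity m v + word_parity m w"
  by (simp add: word_parity_def plus_qword_def)

lemma keys_uminus: "Poly_Mapping.keys (- x) = Poly_Mapping.keys x"
  by (auto simp: in_keys_iff)

lemma free_alg_closed:
  "0 \<in> carrier (free_alg m n)" "1 \<in> carrier (free_alg m n)"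
  "\<lbrakk>x \<in> carrier (free_alg m n); y \<in> carrier (free_alg m n)\<rbrakk> \<Longrightarrow> x + y \<in> carrier (free_alg m n)"
  "\<lbrakk>x \<in> carrier (free_alg m n); y \<in> carrier (free_alg m n)\<rbrakk> \<Longrightarrow> x * y \<in> carrier (free_alg m n)"
  "x \<in> carrier (free_alg m n) \<Longrightarrow> - x \<in> carrier (free_alg m n)"
  using keys_add[of x y] keys_mult[of x y]
  by (fastforce simp: free_alg_mem zero_qword_def plus_qword_def keys_uminus)+

lemma free_alg_ring: "ring (free_alg m n)"
proof (rule ringI)
  show "abelian_group (free_alg m n)"
  proof (rule abelian_groupI)
    show "\<exists>y\<in>carrier (free_alg m n). y \<oplus>\<^bsub>free_alg m n\<^esub> x = \<zero>\<^bsub>free_alg m n\<^esub>"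
      if "x \<in> carrier (free_alg m n)" for x
      using free_alg_closed(5)[OF that] by (intro bexI[of _ "- x"]) simp_all
  qed (auto simp: free_alg_closed add.assoc add.commute)
  show "Group.monoid (free_alg m n)"
    by (rule monoidI) (auto simp: free_alg_closed mult.assoc)
qed (auto simp: distrib_left distrib_right)

lemma free_alg_a_inv: "x \<in> carrier (free_alg m n) \<Longrightarrow> \<ominus>\<^bsub>free_alg m n\<^esub> x = - x"
proof -
  interpret ring "free_alg m n" by (rule free_alg_ring)
  show "x \<in> carrier (free_alg m n) \<Longrightarrow> \<ominus>\<^bsub>free_alg m n\<^esub> x = - x"
    using minus_equality[of "- x" x] by (simp add: free_alg_closed)
qed

lemma homogeneous_0: "homogeneous m n p 0"
  by (simp add: homogeneous_iff)

lemma homogeneous_1: "homogeneous m n 0 1"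
  by (simp add: homogeneous_iff zero_qword_def word_parity_def)

lemma homogeneous_const: "homogeneous m n 0 (const c)"
  by (simp add: homogeneous_iff zero_qword_def word_parity_def const_def)

lemma homogeneous_uminus: "homogeneous m n p x \<Longrightarrow> homogeneous m n p (- x)"
  by (simp add: homogeneous_iff keys_uminus)

lemma homogeneous_add: "\<lbrakk>homogeneous m n p x; homogeneous m n p y\<rbrakk> \<Longrightarrow> homogeneous m n p (x + y)"
  using keys_add[of x y] by (auto simp: homogeneous_iff)

lemma homogeneous_diff: "\<lbrakk>homogeneous m n p x; homogeneous m n p y\<rbrakk> \<Longrightarrow> homogeneous m n p (x - y)"
  using homogeneous_add[OF _ homogeneous_uminus] by fastforce

lemma homogeneous_mult:
  assumes "homogeneous m n p x" "homogeneous m n r y"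
  shows "homogeneous m n (p + r) (x * y)"
proof -
  have "x * y \<in> carrier (free_alg m n)"
    using assms by (intro free_alg_closed) (auto simp: homogeneous_def)
  moreover have "word_parity m w = p + r" if "w \<in> Poly_Mapping.keys (x * y)" for w
    using keys_mult[of x y] that assms by (auto simp: homogeneous_iff word_parity_add)
  ultimately show ?thesis by (simp add: homogeneous_def)
qed

lemma homogeneous_mult': "\<lbrakk>homogeneous m n p x; homogeneous m n r y; s = p + r\<rbrakk> \<Longrightarrow> homogeneous m n s (x * y)"
  using homogeneous_mult by blast

lemma homogeneous_gen: "\<lbrakk>g \<in> gens m n; p = gen_parity m g\<rbrakk> \<Longrightarrow> homogeneous m n p (gen g)"
  by (simp add: homogeneous_iff gen_def word_parity_def)

lemma lookup_free_part:
  "Poly_Mapping.lookup (free_part m p x) w = (if word_parity m w = p then Poly_Mapping.lookup x w else 0)"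
  by (auto simp: free_part_def lookup_sum lookup_single when_def in_keys_iff sum.delta')

lemma homogeneous_free_part:
  "x \<in> carrier (free_alg m n) \<Longrightarrow> homogeneous m n p (free_part m p x)"
  by (auto simp: homogeneous_iff in_keys_iff lookup_free_part free_alg_mem split: if_splits)

lemma free_part_add: "free_part m p (x + y) = free_part m p x + free_part m p y"
  by (rule poly_mapping_eqI) (simp add: lookup_free_part lookup_add)

lemma free_part_uminus: "free_part m p (- x) = - free_part m p x"
  by (rule poly_mapping_eqI) (simp add: lookup_free_part)

lemma free_part_decomp: "free_part m p x + free_part m (p + 1) x = x"
proof (rule poly_mapping_eqI)
  have "q = p \<or> q = p + 1" "p \<noteq> p + 1" for q by (cases "p = 0"; cases "q = 0"; simp)+
  then show "Poly_Mapping.lookup (free_part m p x + free_part m (p + 1) x) w = Poly_Mapping.lookup x w" for w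
    by (auto simp: lookup_free_part lookup_add)
qed

lemma free_part_homogeneous: "homogeneous m n p x \<Longrightarrow> free_part m r x = (if r = p then x else 0)"
  by (rule poly_mapping_eqI) (auto simp: lookup_free_part homogeneous_iff in_keys_iff)

text \<open>The other two products of components have parity \<open>p + 1\<close> and drop out. This
  formula is what makes the set of elements with parity components in an ideal closed under
  multiplication.\<close>

lemma free_part_mult:
  assumes x: "x \<in> carrier (free_alg m n)" and y: "y \<in> carrier (free_alg m n)"
  shows "free_part m p (x * y) = free_part m 0 x * free_part m p y + free_part m 1 x * free_part m (p + 1) y"
proof -
  define a b c d where abcd: "a = free_part m 0 x" "b = free_part m 1 x"
    "c = free_part m p y" "d = free_part m (p + 1) y"
  have "x * y = (a + b) * (c + d)"
    using free_part_decomp[of m 0 x] free_part_decomp[of m p y] abcd by simp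
  then have xy: "x * y = a * c + (a * d + (b * c + b * d))" by (simp add: algebra_simps)
  note h = homogeneous_free_part[OF x] homogeneous_free_part[OF y]
  have ne: "p \<noteq> p + 1" "p + 1 \<noteq> p" by (cases "p = 0"; simp)+
  have 1: "homogeneous m n p (a * c)" "homogeneous m n (p + 1) (a * d)"
    "homogeneous m n (p + 1) (b * c)" "homogeneous m n p (b * d)"
    unfolding abcd by (rule homogeneous_mult'[OF h(1) h(2)], simp add: ac_simps)+
  show ?thesis
    unfolding xy free_part_add using 1[THEN free_part_homogeneous, of p] ne by (simp add: abcd)
qed

section \<open>Homogeneity of the defining relators\<close>

locale quantum_gl =
  fixes m n :: nat
  assumes m_pos: "m > 0" and n_pos: "n > 0"
begin

lemma gens_mem:
  "a \<in> idx' m n \<Longrightarrow> GenE a (Suc a) \<in> gens m n" "a \<in> idx' m n \<Longrightarrow> GenE (Suc a) a \<in> gens m n"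
  "a \<in> idx m n \<Longrightarrow> GenK a \<in> gens m n" "a \<in> idx m n \<Longrightarrow> GenKinv a \<in> gens m n"
  by (auto simp: gens_def)

abbreviation hom where "hom \<equiv> homogeneous m n"

lemma hom_fK: "a \<in> idx m n \<Longrightarrow> hom 0 (fK a)" "a \<in> idx m n \<Longrightarrow> hom 0 (fKinv a)"
  by (auto intro!: homogeneous_gen gens_mem simp: gen_parity_def)

lemma hom_fE:
  "a \<in> idx' m n \<Longrightarrow> hom (of_bool (a = m)) (fE a (Suc a))"
  "a \<in> idx' m n \<Longrightarrow> hom (of_bool (a = m)) (fE (Suc a) a)"
  by (auto intro!: homogeneous_gen gens_mem simp: gen_parity_def)

lemma hom_cmult: "hom p x \<Longrightarrow> hom p (const c * x)"
  using homogeneous_mult[OF homogeneous_const, of m n p x c] by simp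

text \<open>The two terms of the q-commutator have the same factors and hence the same parity. Its
  value is left open because the relation ideal is graded as soon as each relator has some
  parity.\<close>

lemma hom_root_up: "\<lbrakk>a > 0; a + k \<in> idx' m n\<rbrakk> \<Longrightarrow> \<exists>p. hom p (root_up m a k)"
proof (induction k arbitrary: a)
  case 0
  then show ?case using hom_fE(1)[of a] by auto
next
  case (Suc k)
  then obtain p where p: "hom p (root_up m (Suc a) k)" by fastforce
  have a: "a \<in> idx' m n" using Suc.prems by (auto simp: idx'_def)
  show ?case
    using homogeneous_diff[OF homogeneous_mult'[OF hom_fE(1)[OF a] p refl]
        homogeneous_mult'[OF hom_cmult[OF p] hom_fE(1)[OF a] add.commute]] by auto
qed

lemma hom_root_down: "\<lbrakk>a > 0; a + k \<in> idx' m n\<rbrakk> \<Longrightarrow> \<exists>p. hom p (root_down m a k)"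
proof (induction k arbitrary: a)
  case 0
  then show ?case using hom_fE(2)[of a] by auto
next
  case (Suc k)
  then obtain p where p: "hom p (root_down m (Suc a) k)" by fastforce
  have a: "a \<in> idx' m n" using Suc.prems by (auto simp: idx'_def)
  show ?case
    using homogeneous_diff[OF homogeneous_mult'[OF p hom_fE(2)[OF a] refl]
        homogeneous_mult'[OF hom_cmult[OF hom_fE(2)[OF a]] p add.commute]] by auto
qed

text \<open>Each term contains \<open>x\<close> twice, so the parity of \<open>x\<close> cancels and
  that of \<open>y\<close> remains.\<close>

lemma hom_serre:
  assumes x: "hom p x" and y: "hom r y"
  shows "hom r (serre x y)"
proof -
  have "hom r (x * x * y)" "hom r (const (qq + inverse qq) * x * y * x)" "hom r (y * x * x)"
    using homogeneous_mult[OF homogeneous_mult[OF x x] y]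
      homogeneous_mult[OF homogeneous_mult[OF hom_cmult[OF x] y] x]
      homogeneous_mult[OF homogeneous_mult[OF y x] x] by (simp_all add: ac_simps)
  then show ?thesis unfolding serre_def by (intro homogeneous_add homogeneous_diff)
qed

lemma hom_relators: "x \<in> relators m n \<Longrightarrow> \<exists>p. hom p x"
  unfolding relators_def
proof (elim UnE)
  note E = hom_fE
  \<comment> \<open>This is where both ranks have to be positive: the odd simple root must
    exist.\<close>
  have m_idx: "m \<in> idx' m n" using m_pos n_pos by (auto simp: idx'_def)
  have Suc_idx: "a \<in> idx m n" "Suc a \<in> idx m n" if "a \<in> idx' m n" for a
    using that by (auto simp: idx'_def idx_def)
  {
    assume "x \<in> {fK a * fKinv a - 1 | a. a \<in> idx m n}"
    then show ?thesis
      by (auto intro!: exI[of _ 0] homogeneous_diff homogeneous_mult'[of _ _ 0 _ 0] hom_fK homogeneous_1)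
  next
    assume "x \<in> {x * y - y * x | x y. x \<in> fK ` idx m n \<union> fKinv ` idx m n
        \<and> y \<in> fK ` idx m n \<union> fKinv ` idx m n}"
    then show ?thesis
      by (auto intro!: exI[of _ 0] homogeneous_diff homogeneous_mult'[of _ _ 0 _ 0] hom_fK)
  next
    assume "x \<in> {fK a * fE b c * fKinv a
        - const (qq powi bform m n (eps a) (\<lambda>i. eps b i - eps c i)) * fE b c | a b c.
        a \<in> idx m n \<and> b \<in> idx m n \<and> c \<in> idx m n \<and> (c = Suc b \<or> b = Suc c)}"
    then obtain a b c where x: "x = fK a * fE b c * fKinv a
        - const (qq powi bform m n (eps a) (\<lambda>i. eps b i - eps c i)) * fE b c"
      and abc: "a \<in> idx m n" "b \<in> idx m n" "c \<in> idx m n" "c = Suc b \<or> b = Suc c" by blast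
    have "\<exists>p. hom p (fE b c)"
    proof (cases "c = Suc b")
      case True
      then have "b \<in> idx' m n" using abc by (auto simp: idx_def idx'_def)
      then show ?thesis using hom_fE(1) True by blast
    next
      case False
      then have b: "b = Suc c" using abc by blast
      then have "c \<in> idx' m n" using abc by (auto simp: idx_def idx'_def)
      then show ?thesis using hom_fE(2) b by blast
    qed
    then obtain p where "hom p (fE b c)" by blast
    then have "hom p x" unfolding x using abc
      by (intro homogeneous_diff hom_cmult homogeneous_mult'[of _ _ p _ 0] homogeneous_mult'[of _ _ 0 _ p] hom_fK) auto
    then show ?thesis by blast
  next
    assume "x \<in> {fE a (Suc a) * fE (Suc b) b
        - (if a = m \<and> b = m then - 1 else 1) * (fE (Suc b) b * fE a (Suc a))
        - (if a = b then const (inverse (qa m a - inverse (qa m a)))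
             * (fK a * fKinv (Suc a) - fKinv a * fK (Suc a)) else 0) | a b.
        a \<in> idx' m n \<and> b \<in> idx' m n}"
    then obtain a b where x: "x = fE a (Suc a) * fE (Suc b) b
        - (if a = m \<and> b = m then - 1 else 1) * (fE (Suc b) b * fE a (Suc a))
        - (if a = b then const (inverse (qa m a - inverse (qa m a)))
             * (fK a * fKinv (Suc a) - fKinv a * fK (Suc a)) else 0)"
      and ab: "a \<in> idx' m n" "b \<in> idx' m n" by blast
    \<comment> \<open>For \<open>a = b\<close> this parity is 0, at the odd node because 1 + 1 = 0.
      It thus agrees with the even term in the \<open>K_a\<close>, which occurs only then.\<close>
    let ?p = "of_bool (a = m) + of_bool (b = m) :: bit"
    have 1: "hom ?p (fE a (Suc a) * fE (Suc b) b)" using ab by (intro homogeneous_mult hom_fE)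
    have 2: "hom ?p (fE (Suc b) b * fE a (Suc a))"
      using ab by (intro homogeneous_mult'[OF hom_fE(2) hom_fE(1)]) (auto simp: add.commute)
    have 3: "hom ?p ((if a = m \<and> b = m then - 1 else 1) * (fE (Suc b) b * fE a (Suc a)))"
      using 2 by (auto intro: homogeneous_uminus)
    have 4: "hom 0 (const (inverse (qa m a - inverse (qa m a)))
             * (fK a * fKinv (Suc a) - fKinv a * fK (Suc a)))"
      using ab Suc_idx
      by (intro hom_cmult homogeneous_diff homogeneous_mult'[of _ _ 0 _ 0] hom_fK) auto
    have 5: "hom ?p (if a = b then const (inverse (qa m a - inverse (qa m a)))
             * (fK a * fKinv (Suc a) - fKinv a * fK (Suc a)) else 0)"
      using 4 by (cases "a = b") (simp_all add: homogeneous_0)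
    show ?thesis unfolding x using homogeneous_diff[OF homogeneous_diff[OF 1 3] 5] by blast
  next
    assume "x \<in> {fE m (Suc m) * fE m (Suc m), fE (Suc m) m * fE (Suc m) m}"
    then show ?thesis using homogeneous_mult hom_fE[OF m_idx] by blast
  next
    assume "x \<in> {fE a (Suc a) * fE b (Suc b) - fE b (Suc b) * fE a (Suc a) | a b.
        a \<in> idx' m n \<and> b \<in> idx' m n \<and> \<bar>int a - int b\<bar> \<ge> 2}"
    then show ?thesis
      using homogeneous_diff[OF homogeneous_mult[OF E(1) E(1)] homogeneous_mult'[OF E(1) E(1) add.commute]] by blast
  next
    assume "x \<in> {fE (Suc a) a * fE (Suc b) b - fE (Suc b) b * fE (Suc a) a | a b.
        a \<in> idx' m n \<and> b \<in> idx' m n \<and> \<bar>int a - int b\<bar> \<ge> 2}"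
    then show ?thesis
      using homogeneous_diff[OF homogeneous_mult[OF E(2) E(2)] homogeneous_mult'[OF E(2) E(2) add.commute]] by blast
  next
    assume "x \<in> {serre (fE a (Suc a)) (fE b (Suc b)) | a b.
        a \<in> idx' m n \<and> b \<in> idx' m n \<and> a \<noteq> m \<and> (b = Suc a \<or> a = Suc b)}"
    then show ?thesis using hom_serre[OF E(1) E(1)] by blast
  next
    assume "x \<in> {serre (fE (Suc a) a) (fE (Suc b) b) | a b.
        a \<in> idx' m n \<and> b \<in> idx' m n \<and> a \<noteq> m \<and> (b = Suc a \<or> a = Suc b)}"
    then show ?thesis using hom_serre[OF E(2) E(2)] by blast
  next
    assume x: "x \<in> (if m \<ge> 2 \<and> n \<ge> 2 then
        {root_up m (m - 1) 2 * fE m (Suc m) + fE m (Suc m) * root_up m (m - 1) 2,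
         root_down m (m - 1) 2 * fE (Suc m) m + fE (Suc m) m * root_down m (m - 1) 2}
      else {})"
    then have mn: "m \<ge> 2" "n \<ge> 2" by (auto split: if_splits)
    \<comment> \<open>The guard is what keeps the simple roots \<open>m - 1\<close> and
      \<open>m + 1\<close>, which flank the odd one, in range.\<close>
    then have r: "m - 1 > 0" "m - 1 + 2 \<in> idx' m n" by (auto simp: idx'_def)
    obtain p where p: "hom p (root_up m (m - 1) 2)" using hom_root_up[OF r] by blast
    obtain r where r: "hom r (root_down m (m - 1) 2)" using hom_root_down[OF r] by blast
    have "hom (p + of_bool (m = m)) (root_up m (m - 1) 2 * fE m (Suc m) + fE m (Suc m) * root_up m (m - 1) 2)"
      by (intro homogeneous_add homogeneous_mult p homogeneous_mult'[OF _ p add.commute] E(1) m_idx)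
    moreover have "hom (r + of_bool (m = m)) (root_down m (m - 1) 2 * fE (Suc m) m + fE (Suc m) m * root_down m (m - 1) 2)"
      by (intro homogeneous_add homogeneous_mult r homogeneous_mult'[OF _ r add.commute] E(2) m_idx)
    ultimately show ?thesis using x mn by (auto simp del: root_up.simps root_down.simps)
  }
qed

section \<open>The parity grading of the quotient\<close>

sublocale F: ring "free_alg m n" by (rule free_alg_ring)

abbreviation F where "F \<equiv> carrier (free_alg m n)"
abbreviation I where "I \<equiv> rel_ideal m n"
abbreviation cls where "cls \<equiv> uq_class m n"

lemma relators_F: "relators m n \<subseteq> F"
  using hom_relators by (auto simp: homogeneous_def)

lemma I_ideal: "ideal I (free_alg m n)"
  unfolding rel_ideal_def by (rule F.genideal_ideal[OF relators_F])

sublocale I: ideal I "free_alg m n" by (rule I_ideal)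

lemma I_closed: "0 \<in> I" "\<lbrakk>x \<in> I; y \<in> I\<rbrakk> \<Longrightarrow> x + y \<in> I" "x \<in> I \<Longrightarrow> - x \<in> I"
  "\<lbrakk>x \<in> I; y \<in> F\<rbrakk> \<Longrightarrow> x * y \<in> I" "\<lbrakk>x \<in> I; y \<in> F\<rbrakk> \<Longrightarrow> y * x \<in> I" "x \<in> I \<Longrightarrow> x \<in> F"
proof -
  show "0 \<in> I" using I.zero_closed by simp
  show "x + y \<in> I" if "x \<in> I" "y \<in> I" using I.a_closed[OF that] by simp
  show "- x \<in> I" if "x \<in> I"
    using I.a_inv_closed[OF that] free_alg_a_inv[OF I.Icarr[OF that]] by simp
  show "x * y \<in> I" if "x \<in> I" "y \<in> F" using I.I_r_closed[OF that] by simp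
  show "y * x \<in> I" if "x \<in> I" "y \<in> F" using I.I_l_closed[OF that] by simp
  show "x \<in> I \<Longrightarrow> x \<in> F" by (rule I.Icarr)
qed

lemma F_free_part: "x \<in> F \<Longrightarrow> free_part m p x \<in> F"
  using homogeneous_free_part by (auto simp: homogeneous_def)

text \<open>The elements of \<open>I\<close> whose parity components stay in \<open>I\<close> form
  an ideal. It contains the relators, each being its own single nonzero component or zero, so by
  minimality of the generated ideal it is all of \<open>I\<close>.\<close>

lemma I_graded: "x \<in> I \<Longrightarrow> free_part m p x \<in> I"
proof -
  let ?J = "{x \<in> I. \<forall>p. free_part m p x \<in> I}"
  have "ideal ?J (free_alg m n)"
  proof (rule idealI[OF free_alg_ring])
    have "additive_subgroup ?J (free_alg m n)"
      unfolding additive_subgroup_iff[OF F.abelian_group_axioms]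
      using I_closed by (auto simp: free_part_add free_part_uminus free_alg_a_inv
        free_part_homogeneous[OF homogeneous_0, of m p 0 for p])
    then show "subgroup ?J (add_monoid (free_alg m n))" by (rule additive_subgroup.a_subgroup)
  qed (use I_closed F_free_part in \<open>auto simp: free_part_mult[where n = n]\<close>)
  moreover have "relators m n \<subseteq> ?J"
  proof
    fix x assume x: "x \<in> relators m n"
    then have "x \<in> I" unfolding rel_ideal_def using F.genideal_self[OF relators_F] by blast
    then show "x \<in> ?J"
      using hom_relators[OF x] I_closed(1) by (auto simp: free_part_homogeneous[where n = n])
  qed
  ultimately have "I \<subseteq> ?J" unfolding rel_ideal_def by (rule F.genideal_minimal)
  then show "x \<in> I \<Longrightarrow> free_part m p x \<in> I" by blast
qed

abbreviation U where "U \<equiv> Uq m n"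

lemma Uq_simps:
  "carrier U = carrier (free_alg m n Quot I)" "mult U = mult (free_alg m n Quot I)"
  "one U = one (free_alg m n Quot I)" "zero U = zero (free_alg m n Quot I)"
  "add U = add (free_alg m n Quot I)"
  "hpart U p = {cls x | x. hom p x}"
  by (auto simp: Uq_def ring.defs superring.defs homogeneous_def)

lemma carrier_Uq: "carrier U = cls ` F"
  by (auto simp: Uq_simps uq_class_def FactRing_def A_RCOSETS_defs a_r_coset_def)

lemma cls_hom:
  "x \<in> F \<Longrightarrow> y \<in> F \<Longrightarrow> cls (x + y) = cls x \<oplus>\<^bsub>U\<^esub> cls y"
  "x \<in> F \<Longrightarrow> y \<in> F \<Longrightarrow> cls (x * y) = cls x \<otimes>\<^bsub>U\<^esub> cls y"
  "cls 1 = \<one>\<^bsub>U\<^esub>"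
  using ring_hom_add[OF I.rcos_ring_hom, of x y] ring_hom_mult[OF I.rcos_ring_hom, of x y]
    ring_hom_one[OF I.rcos_ring_hom] by (simp_all add: Uq_simps uq_class_def)

lemma cls_eq_zero_iff: "x \<in> F \<Longrightarrow> cls x = \<zero>\<^bsub>U\<^esub> \<longleftrightarrow> x \<in> I"
  using I.rcos_const_imp_mem F.a_rcos_zero[OF I_ideal] by (auto simp: Uq_simps uq_class_def FactRing_simps)

end

text \<open>Being a ring depends on these fields alone, which carries it over to records that have a
  grading in addition.\<close>

lemma ring_transfer:
  assumes "ring R" "carrier S = carrier R" "mult S = mult R" "one S = one R" "zero S = zero R" "add S = add R"
  shows "ring S"
proof -
  interpret R: ring R by fact
  show ?thesis
  proof (rule ringI)
    show "abelian_group S"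
    proof (rule abelian_groupI)
      show "\<exists>y\<in>carrier S. y \<oplus>\<^bsub>S\<^esub> x = \<zero>\<^bsub>S\<^esub>" if "x \<in> carrier S" for x
        using that R.l_neg[of x] assms by (intro bexI[of _ "\<ominus>\<^bsub>R\<^esub> x"]) auto
    qed (auto simp: assms R.a_ac)
    show "Group.monoid S" by (rule monoidI) (auto simp: assms R.m_assoc)
  qed (auto simp: assms R.l_distr R.r_distr)
qed

context quantum_gl
begin

lemma Uq_ring: "ring U"
  by (rule ring_transfer[OF I.quotient_is_ring]) (simp_all add: Uq_simps)

sublocale U: ring U by (rule Uq_ring)

lemma cls_closed: "x \<in> F \<Longrightarrow> cls x \<in> carrier U"
  by (simp add: carrier_Uq)

lemma cls_zero: "cls 0 = \<zero>\<^bsub>U\<^esub>"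
  by (simp add: cls_eq_zero_iff free_alg_closed I_closed)

lemma cls_uminus: "x \<in> F \<Longrightarrow> cls (- x) = \<ominus>\<^bsub>U\<^esub> cls x"
  using cls_hom(1)[of "- x" x] U.minus_equality[of "cls (- x)" "cls x"]
  by (simp add: free_alg_closed cls_closed cls_zero)

lemma homF: "hom p x \<Longrightarrow> x \<in> F"
  by (simp add: homogeneous_def)

sublocale U: superalgebra U
proof -
  have "graded_group U"
  proof (rule graded_groupI[OF U.abelian_group_axioms])
    show "additive_subgroup (hpart U p) U" for p
      unfolding additive_subgroup_iff[OF U.abelian_group_axioms]
    proof (intro conjI ballI subsetI)
      show "\<zero>\<^bsub>U\<^esub> \<in> hpart U p" unfolding Uq_simps(6) using cls_zero homogeneous_0 by (intro CollectI exI[of _ 0]) auto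
      show "x \<in> carrier U" if "x \<in> hpart U p" for x using that by (auto simp: Uq_simps(6) intro: cls_closed homF)
      show "x \<oplus>\<^bsub>U\<^esub> y \<in> hpart U p" if "x \<in> hpart U p" "y \<in> hpart U p" for x y
        using that unfolding Uq_simps(6)
        by clarify (metis cls_hom(1) homF homogeneous_add)
      show "\<ominus>\<^bsub>U\<^esub> x \<in> hpart U p" if "x \<in> hpart U p" for x
        using that unfolding Uq_simps(6)
        by clarify (metis cls_uminus homF homogeneous_uminus)
    qed
  next
    fix v assume "v \<in> carrier U"
    then obtain x where x: "x \<in> F" "v = cls x" by (auto simp: carrier_Uq)
    have "v = cls (free_part m 0 x) \<oplus>\<^bsub>U\<^esub> cls (free_part m 1 x)"
      using cls_hom(1)[OF F_free_part[OF x(1), of 0] F_free_part[OF x(1), of 1]] free_part_decomp[of m 0 x] x(2) by simp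
    then show "\<exists>a\<in>hpart U 0. \<exists>b\<in>hpart U 1. v = a \<oplus>\<^bsub>U\<^esub> b"
      unfolding Uq_simps(6) using homogeneous_free_part[OF x(1)] by blast
  next
    fix v assume "v \<in> hpart U 0" "v \<in> hpart U 1"
    then obtain x y where x: "hom 0 x" "v = cls x" and y: "hom 1 y" "v = cls y"
      by (auto simp: Uq_simps(6))
    have c: "x \<in> F" "- y \<in> F" "y \<in> F" using x y homF free_alg_closed(5) by blast+
    \<comment> \<open>An even \<open>x\<close> and an odd \<open>y\<close> with the same class
      differ by an element of \<open>I\<close>. The even component of that difference is
      \<open>x\<close> itself, so \<open>I_graded\<close> puts \<open>x\<close> into
      \<open>I\<close>.\<close>
    have "cls (x + - y) = cls x \<oplus>\<^bsub>U\<^esub> \<ominus>\<^bsub>U\<^esub> cls y" using cls_hom(1)[OF c(1,2)] c by (simp only: cls_uminus)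
    also have "\<dots> = \<zero>\<^bsub>U\<^esub>" using x(2) y(2) cls_closed[OF c(3)] U.r_neg by metis
    finally have "x + - y \<in> I" using cls_eq_zero_iff free_alg_closed(3)[OF c(1,2)] by blast
    then have "free_part m 0 (x + - y) \<in> I" by (rule I_graded)
    moreover have "free_part m 0 (x + - y) = x"
      unfolding free_part_add free_part_uminus
      using free_part_homogeneous[OF x(1), of 0] free_part_homogeneous[OF y(1), of 0] by simp
    ultimately have "x \<in> I" by simp
    then show "v = \<zero>\<^bsub>U\<^esub>" using x c cls_eq_zero_iff by blast
  qed
  then interpret graded_group U .
  show "superalgebra U"
  proof unfold_locales
    show "x \<otimes>\<^bsub>U\<^esub> y \<in> hpart U (p + r)" if "x \<in> hpart U p" "y \<in> hpart U r" for x y p r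
      using that unfolding Uq_simps(6)
      by clarify (metis cls_hom(2) homF homogeneous_mult)
    show "\<one>\<^bsub>U\<^esub> \<in> hpart U 0" unfolding Uq_simps(6) using cls_hom(3) homogeneous_1
      by (intro CollectI exI[of _ 1]) auto
  qed
qed

lemma scalar_hpart: "uq_scalar m n c \<in> hpart U 0"
  unfolding Uq_simps(6) uq_scalar_def using homogeneous_const by blast

lemma gen_hpart: "g \<in> gens m n \<Longrightarrow> uq_gen m n g \<in> hpart U (gen_parity m g)"
  unfolding Uq_simps(6) uq_gen_def using homogeneous_gen by blast

lemma const_F: "const c \<in> F"
  using homogeneous_const homF by blast

lemma uq_scalar_add: "uq_scalar m n (c + d) = uq_scalar m n c \<oplus>\<^bsub>U\<^esub> uq_scalar m n d"
  unfolding uq_scalar_def cls_hom(1)[OF const_F const_F, symmetric] by (simp add: const_def single_add)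

lemma uq_scalar_mult: "uq_scalar m n (c * d) = uq_scalar m n c \<otimes>\<^bsub>U\<^esub> uq_scalar m n d"
  unfolding uq_scalar_def cls_hom(2)[OF const_F const_F, symmetric] by (simp add: const_def mult_single)

lemma uq_scalar_one: "uq_scalar m n 1 = \<one>\<^bsub>U\<^esub>"
  by (simp add: uq_scalar_def const_def cls_hom(3))

lemma const_central: "const c * x = x * const c"
proof -
  have x: "x = (\<Sum>w\<in>Poly_Mapping.keys x. Poly_Mapping.single w (Poly_Mapping.lookup x w))" (is "_ = ?s")
    by (rule poly_mapping_eqI) (auto simp: lookup_sum lookup_single when_def in_keys_iff sum.delta')
  have "const c * ?s = ?s * const c"
    unfolding sum_distrib_left sum_distrib_right
    by (rule sum.cong) (simp_all add: const_def mult_single mult.commute)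
  then show ?thesis using x by metis
qed

lemma uq_scalar_central:
  assumes "x \<in> carrier U"
  shows "uq_scalar m n c \<otimes>\<^bsub>U\<^esub> x = x \<otimes>\<^bsub>U\<^esub> uq_scalar m n c"
proof -
  obtain y where y: "y \<in> F" "x = cls y" using assms by (auto simp: carrier_Uq)
  show ?thesis unfolding y(2) uq_scalar_def
    using cls_hom(2)[OF const_F y(1)] cls_hom(2)[OF y(1) const_F] const_central by metis
qed

section \<open>Quantum sub-superalgebras inherit the grading\<close>

definition generators :: "nat set \<Rightarrow> nat set \<Rightarrow> uq set" where
  "generators \<Theta>p \<Theta>m = range (uq_scalar m n) \<union> uq_gen m n ` (GenK ` idx m n \<union> GenKinv ` idx m n
     \<union> {GenE a (Suc a) | a. a \<in> \<Theta>p} \<union> {GenE (Suc a) a | a. a \<in> \<Theta>m})"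

lemma Uq_sub_simps:
  "carrier (Uq_sub m n \<Theta>p \<Theta>m) = generate_ring U (generators \<Theta>p \<Theta>m)"
  "mult (Uq_sub m n \<Theta>p \<Theta>m) = mult U" "one (Uq_sub m n \<Theta>p \<Theta>m) = one U"
  "zero (Uq_sub m n \<Theta>p \<Theta>m) = zero U" "add (Uq_sub m n \<Theta>p \<Theta>m) = add U"
  "hpart (Uq_sub m n \<Theta>p \<Theta>m) p = hpart U p \<inter> generate_ring U (generators \<Theta>p \<Theta>m)"
  by (simp_all add: Uq_sub_def Let_def generators_def)

lemma generators_homogeneous:
  assumes "\<Theta>p \<subseteq> idx' m n" "\<Theta>m \<subseteq> idx' m n" "x \<in> generators \<Theta>p \<Theta>m"
  shows "\<exists>p. x \<in> hpart U p"
proof -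
  have "GenK ` idx m n \<union> GenKinv ` idx m n \<union> {GenE a (Suc a) | a. a \<in> \<Theta>p}
      \<union> {GenE (Suc a) a | a. a \<in> \<Theta>m} \<subseteq> gens m n"
    using assms(1,2) by (auto simp: gens_def)
  then show ?thesis using assms(3) scalar_hpart gen_hpart unfolding generators_def by blast
qed

context
  fixes \<Theta>p \<Theta>m :: "nat set"
  assumes \<Theta>: "\<Theta>p \<subseteq> idx' m n" "\<Theta>m \<subseteq> idx' m n"
begin

abbreviation A where "A \<equiv> generate_ring U (generators \<Theta>p \<Theta>m)"

lemma generators_carrier: "generators \<Theta>p \<Theta>m \<subseteq> carrier U"
  using generators_homogeneous[OF \<Theta>] U.hpart_carrier by blast

lemma A_carrier: "x \<in> A \<Longrightarrow> x \<in> carrier U"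
  using U.generate_ring_incl[OF generators_carrier] by blast

text \<open>A subring generated by homogeneous elements is graded. In the induction, the component
  of a product is a sum of products of components of the factors, which lie in \<open>A\<close> by
  hypothesis.\<close>

lemma A_hcomp: "x \<in> A \<Longrightarrow> hcomp U p x \<in> A"
proof (induction x arbitrary: p rule: generate_ring.induct)
  case one
  then show ?case
    by (simp add: U.hcomp_homogeneous[OF U.one_hpart] U.zero_in_generate generate_ring.one)
next
  case (incl h)
  then obtain r where "h \<in> hpart U r" using generators_homogeneous[OF \<Theta>] by blast
  then show ?case
    using incl by (simp add: U.hcomp_homogeneous U.zero_in_generate generate_ring.incl)
next
  case (a_inv h)
  have c: "h \<in> carrier U" using a_inv A_carrier by blast
  have "hcomp U p (\<ominus>\<^bsub>U\<^esub> h) = \<ominus>\<^bsub>U\<^esub> hcomp U p h"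
  proof (rule U.minus_equality[symmetric])
    show "hcomp U p (\<ominus>\<^bsub>U\<^esub> h) \<oplus>\<^bsub>U\<^esub> hcomp U p h = \<zero>\<^bsub>U\<^esub>"
      using U.hcomp_add[of "\<ominus>\<^bsub>U\<^esub> h" h p] c U.hcomp_homogeneous[OF U.hpart_zero[of p], of p] by (simp add: U.l_neg)
  qed (use c in auto)
  then show ?case using a_inv generate_ring.a_inv by metis
next
  case (eng_add a b)
  then show ?case using A_carrier by (simp add: U.hcomp_add generate_ring.eng_add)
next
  case (eng_mult a b)
  have c: "a \<in> carrier U" "b \<in> carrier U" using eng_mult A_carrier by blast+
  define a0 a1 b0 b1 where d: "a0 = hcomp U 0 a" "a1 = hcomp U 1 a" "b0 = hcomp U p b" "b1 = hcomp U (p + 1) b"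
  have h: "a0 \<in> hpart U 0" "a1 \<in> hpart U 1" "b0 \<in> hpart U p" "b1 \<in> hpart U (p + 1)"
    using c unfolding d by (auto intro: U.hcomp_hpart)
  note hc = h[THEN U.hpart_carrier]
  have ab: "a = a0 \<oplus>\<^bsub>U\<^esub> a1" "b = b0 \<oplus>\<^bsub>U\<^esub> b1"
    unfolding d using c by (simp_all only: U.hcomp_decomp U.hcomp_decomp')
  have "hcomp U p (a \<otimes>\<^bsub>U\<^esub> b) = a0 \<otimes>\<^bsub>U\<^esub> b0 \<oplus>\<^bsub>U\<^esub> a1 \<otimes>\<^bsub>U\<^esub> b1"
  proof (rule U.hcomp_eqI)
    show "a0 \<otimes>\<^bsub>U\<^esub> b0 \<oplus>\<^bsub>U\<^esub> a1 \<otimes>\<^bsub>U\<^esub> b1 \<in> hpart U p"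
      using U.mult_hpart[OF h(1,3)] U.mult_hpart[OF h(2,4)] by (intro U.hpart_add) (auto simp: ac_simps)
    show "a1 \<otimes>\<^bsub>U\<^esub> b0 \<oplus>\<^bsub>U\<^esub> a0 \<otimes>\<^bsub>U\<^esub> b1 \<in> hpart U (p + 1)"
      using U.mult_hpart[OF h(2,3)] U.mult_hpart[OF h(1,4)] by (intro U.hpart_add) (auto simp: ac_simps)
    show "a \<otimes>\<^bsub>U\<^esub> b = a0 \<otimes>\<^bsub>U\<^esub> b0 \<oplus>\<^bsub>U\<^esub> a1 \<otimes>\<^bsub>U\<^esub> b1 \<oplus>\<^bsub>U\<^esub> (a1 \<otimes>\<^bsub>U\<^esub> b0 \<oplus>\<^bsub>U\<^esub> a0 \<otimes>\<^bsub>U\<^esub> b1)"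
      unfolding ab using hc by (simp add: U.l_distr U.r_distr U.a_ac)
  qed
  then show ?case using eng_mult.IH d by (metis generate_ring.eng_add generate_ring.eng_mult)
qed

lemma Uq_sub_superalgebra: "superalgebra (Uq_sub m n \<Theta>p \<Theta>m)" (is "superalgebra ?S")
proof -
  have "ring (U\<lparr>carrier := A\<rparr>)" by (rule U.generate_ring_is_ring[OF generators_carrier])
  then have S: "ring ?S" by (rule ring_transfer) (simp_all add: Uq_sub_simps)
  interpret S: ring ?S by fact
  have inv: "\<ominus>\<^bsub>?S\<^esub> x = \<ominus>\<^bsub>U\<^esub> x" if "x \<in> A" for x
    using S.l_neg[of x] U.minus_equality[of "\<ominus>\<^bsub>?S\<^esub> x" x] S.a_inv_closed[of x] that
    by (simp add: Uq_sub_simps A_carrier)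
  have "graded_group ?S"
  proof (rule graded_groupI[OF S.abelian_group_axioms])
    show "additive_subgroup (hpart ?S p) ?S" for p
      unfolding additive_subgroup_iff[OF S.abelian_group_axioms] Uq_sub_simps
      by (auto simp: inv U.hpart_minus U.hpart_add U.zero_in_generate intro: generate_ring.intros)
    show "\<exists>a\<in>hpart ?S 0. \<exists>b\<in>hpart ?S 1. v = a \<oplus>\<^bsub>?S\<^esub> b" if "v \<in> carrier ?S" for v
      using that A_hcomp[of v] A_carrier[of v] U.hcomp_hpart[of v] U.hcomp_decomp[of v] unfolding Uq_sub_simps
      by (intro bexI[of _ "hcomp U 0 v"] bexI[of _ "hcomp U 1 v"]) auto
    show "v = \<zero>\<^bsub>?S\<^esub>" if "v \<in> hpart ?S 0" "v \<in> hpart ?S 1" for v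
      using that U.hpart_disjoint[of v 0 1] by (auto simp: Uq_sub_simps)
  qed
  then interpret graded_group ?S .
  show ?thesis
    by unfold_locales (auto simp: Uq_sub_simps U.mult_hpart U.one_hpart intro: generate_ring.intros)
qed

lemma Uq_sub_scalar: "uq_scalar m n c \<in> carrier (Uq_sub m n \<Theta>p \<Theta>m)"
  unfolding Uq_sub_simps generators_def by (intro generate_ring.incl) auto

lemma Uq_sub_GenK: "a \<in> idx m n \<Longrightarrow> uq_gen m n (GenK a) \<in> carrier (Uq_sub m n \<Theta>p \<Theta>m)"
  unfolding Uq_sub_simps generators_def by (intro generate_ring.incl) auto

lemma Uq_sub_carrier: "x \<in> carrier (Uq_sub m n \<Theta>p \<Theta>m) \<Longrightarrow> x \<in> carrier U"
  using A_carrier by (simp add: Uq_sub_simps)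

end

definition is_sub :: "uq superring \<Rightarrow> bool" where
  "is_sub S \<longleftrightarrow> (\<exists>\<Theta>p\<subseteq>idx' m n. \<exists>\<Theta>m\<subseteq>idx' m n. S = Uq_sub m n \<Theta>p \<Theta>m)"

lemma is_sub_pair:
  assumes "uq_pair m n Q K"
  shows "is_sub Q" "is_sub K" "carrier K \<subseteq> carrier Q"
  using assms unfolding uq_pair_def parabolic_sub_def reductive_sub_def is_sub_def by blast+

lemma pair_uq_algebra:
  assumes "uq_pair m n Q K"
  shows "uq_algebra m n Q K"
proof -
  obtain \<Theta>p \<Theta>m where Q: "\<Theta>p \<subseteq> idx' m n" "\<Theta>m \<subseteq> idx' m n" "Q = Uq_sub m n \<Theta>p \<Theta>m"
    using is_sub_pair[OF assms] unfolding is_sub_def by blast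
  obtain \<Phi>p \<Phi>m where K: "\<Phi>p \<subseteq> idx' m n" "\<Phi>m \<subseteq> idx' m n" "K = Uq_sub m n \<Phi>p \<Phi>m"
    using is_sub_pair[OF assms] unfolding is_sub_def by blast
  interpret Q: superalgebra Q unfolding Q(3) by (rule Uq_sub_superalgebra[OF Q(1,2)])
  note scK = Uq_sub_scalar[OF K(1,2), folded K(3)]
  show ?thesis
  proof (unfold_locales, goal_cases)
    case (1 c)
    then show ?case unfolding Q(3) by (rule Uq_sub_scalar[OF Q(1,2)])
  next
    case (2 c d)
    then show ?case unfolding Q(3) Uq_sub_simps by (rule uq_scalar_add)
  next
    case (3 c d)
    then show ?case unfolding Q(3) Uq_sub_simps by (rule uq_scalar_mult)
  next
    case 4
    then show ?case unfolding Q(3) Uq_sub_simps by (rule uq_scalar_one)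
  next
    case (5 x c)
    then show ?case using Uq_sub_carrier[OF Q(1,2)] uq_scalar_central[of x c]
      unfolding Q(3) by (simp add: Uq_sub_simps)
  next
    case (6 a)
    then show ?case unfolding Q(3) by (rule Uq_sub_GenK[OF Q(1,2)])
  next
    case 7
    then show ?case by (rule is_sub_pair(3)[OF assms])
  next
    case 8
    then show ?case unfolding Q(3) K(3) by (simp add: Uq_sub_simps U.zero_in_generate)
  next
    case 9
    then show ?case unfolding Q(3) K(3) by (simp add: Uq_sub_simps generate_ring.one)
  next
    case (10 x y)
    then show ?case unfolding Q(3) K(3) by (simp add: Uq_sub_simps generate_ring.eng_add)
  next
    case (11 x c)
    then show ?case using scK[of c] unfolding Q(3) K(3) by (simp add: Uq_sub_simps generate_ring.eng_mult)
  qed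
qed

lemma pair_coinduction:
  assumes "compatible_pairs m n Q K P L" "supermodule P V"
  shows "coinduction P Q V"
proof -
  have *: "uq_pair m n Q K" "uq_pair m n P L" "carrier P \<subseteq> carrier Q"
    using assms(1) by (auto simp: compatible_pairs_def)
  obtain \<Theta>p \<Theta>m where Q: "\<Theta>p \<subseteq> idx' m n" "\<Theta>m \<subseteq> idx' m n" "Q = Uq_sub m n \<Theta>p \<Theta>m"
    using is_sub_pair[OF *(1)] unfolding is_sub_def by blast
  obtain \<Phi>p \<Phi>m where P: "\<Phi>p \<subseteq> idx' m n" "\<Phi>m \<subseteq> idx' m n" "P = Uq_sub m n \<Phi>p \<Phi>m"
    using is_sub_pair[OF *(2)] unfolding is_sub_def by blast
  show ?thesis
  proof (intro coinduction.intro coinduction_axioms.intro assms(2) *(3))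
    show "superalgebra Q" unfolding Q(3) by (rule Uq_sub_superalgebra[OF Q(1,2)])
    show "superalgebra P" unfolding P(3) by (rule Uq_sub_superalgebra[OF P(1,2)])
    show "mult P = mult Q" unfolding P(3) Q(3) by (simp add: Uq_sub_simps)
    \<comment> \<open>Both gradings are cut out of the grading of \<open>U\<close>, so the inclusion
      of carriers is enough.\<close>
    show "hpart P p \<subseteq> hpart Q p" for p
      using *(3) unfolding P(3) Q(3) by (auto simp: Uq_sub_simps)
  qed
qed

end

section \<open>Left exactness of induction\<close>

lemma Ind_eq: "Ind m n P Q K V = restrict_module (coind P Q V) (cat_part m n Q K (coind P Q V))"
  by (simp add: Ind_def cat_part_def cat_submodules_def)

lemma Ind_simps:
  "carrier (Ind m n P Q K V) = cat_part m n Q K (coind P Q V)"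
  "zero (Ind m n P Q K V) = zero (coind P Q V)"
  "add (Ind m n P Q K V) = add (coind P Q V)"
  by (simp_all add: Ind_eq)

theorem lemma4p2:
  fixes m n :: nat
    and Q K P L :: "uq superring"
  assumes "m > 0" and "n > 0"
    and "compatible_pairs m n Q K P L"
  shows "left_exact_functor P (cat_C m n P L :: (uq, 'v) smodule set)
           Q (cat_C m n Q K :: (uq, uq \<Rightarrow> 'v) smodule set)
           (Ind m n P Q K) (Ind_map m n P Q K)"
proof -
  interpret quantum_gl m n by unfold_locales (use assms in auto)
  interpret Q: uq_algebra m n Q K
    using assms(3) by (intro pair_uq_algebra) (simp add: compatible_pairs_def)
  have sm: "supermodule P V" if "V \<in> cat_C m n P L" for V :: "(uq, 'v) smodule"
    using that by (simp add: cat_C_def)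
  have co: "coinduction P Q V" if "V \<in> cat_C m n P L" for V :: "(uq, 'v) smodule"
    using pair_coinduction[OF assms(3) sm[OF that]] .
  have um: "uq_module m n Q K (coind P Q V)" if "V \<in> cat_C m n P L" for V :: "(uq, 'v) smodule"
    using Q.uq_moduleI coinduction.coind_supermodule[OF co[OF that]] .
  have cm: "coinduction_map P Q V W f"
    if "V \<in> cat_C m n P L" "W \<in> cat_C m n P L" "f \<in> even_hom P V W" for V W :: "(uq, 'v) smodule" and f
  proof (intro coinduction_map.intro co that even_map.intro even_map_axioms.intro sm)
    show "superalgebra P" using co[OF that(1)] by (simp add: coinduction_def)
  qed
  let ?F = "Ind m n P Q K :: (uq, 'v) smodule \<Rightarrow> (uq, uq \<Rightarrow> 'v) smodule"
  have sub: "\<zeta> \<in> carrier (coind P Q V)" if "V \<in> cat_C m n P L" "\<zeta> \<in> carrier (?F V)"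
    for V :: "(uq, 'v) smodule" and \<zeta>
    using uq_module.cat_part_submodule[OF um[OF that(1)]] that(2)
    by (auto simp: Ind_simps graded_submodule_def)
  \<comment> \<open>The double restriction exhibits \<open>Ind_map\<close> as the even map on the
    full coinduced modules, cut down to \<open>cat_part\<close>, which is the form that
    \<open>restrict_even_map\<close> produces.\<close>
  have map_eq: "Ind_map m n P Q K V W f = restrict (restrict (compose (carrier Q) f) (carrier (coind P Q V)))
      (cat_part m n Q K (coind P Q V))" if "V \<in> cat_C m n P L" for V W :: "(uq, 'v) smodule" and f
    using sub[OF that] by (auto simp: Ind_map_def Ind_simps)
  have ap: "Ind_map m n P Q K V W f \<zeta> = compose (carrier Q) f \<zeta>" if "\<zeta> \<in> carrier (?F V)"
    for V W :: "(uq, 'v) smodule" and f \<zeta>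
    using that by (simp add: Ind_map_def)
  have um_map: "uq_map m n Q K (coind P Q V) (coind P Q W)
      (restrict (compose (carrier Q) f) (carrier (coind P Q V)))"
    if "V \<in> cat_C m n P L" "W \<in> cat_C m n P L" "f \<in> even_hom P V W" for V W :: "(uq, 'v) smodule" and f
    by (intro Q.uq_mapI coinduction_map.push_even_map cm that)
  have img: "compose (carrier Q) f \<zeta> \<in> carrier (?F W)"
    if "V \<in> cat_C m n P L" "W \<in> cat_C m n P L" "f \<in> even_hom P V W" "\<zeta> \<in> carrier (?F V)"
    for V W :: "(uq, 'v) smodule" and f \<zeta>
    using uq_map.cat_part_image[OF um_map[OF that(1-3)], of \<zeta>] sub[OF that(1,4)] that(4)
    by (simp add: Ind_simps)
  have obj: "?F V \<in> cat_C m n Q K" if "V \<in> cat_C m n P L" for V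
    unfolding Ind_eq by (rule uq_module.cat_part_cat_C[OF um[OF that]])
  have mor: "Ind_map m n P Q K V W f \<in> even_hom Q (?F V) (?F W)"
    if "V \<in> cat_C m n P L" "W \<in> cat_C m n P L" "f \<in> even_hom P V W" for V W f
  proof -
    interpret u: uq_map m n Q K "coind P Q V" "coind P Q W"
      "restrict (compose (carrier Q) f) (carrier (coind P Q V))" by (rule um_map[OF that])
    show ?thesis unfolding map_eq[OF that(1)] Ind_eq
      by (intro even_map.even_hom u.restrict_even_map u.V.cat_part_submodule u.W.cat_part_submodule)
        (use u.cat_part_image in blast)
  qed
  show ?thesis
  proof (unfold_locales, goal_cases)
    case (1 V)
    then show ?case by (rule obj)
  next
    case (2 V W f)
    then show ?case by (rule mor)
  next
    case (3 V)
    \<comment> \<open>Elements of the coinduced module are extensional on \<open>Q\<close>; hence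
      composing with the identity returns \<open>\<zeta>\<close> itself and not just a map that
      agrees with it on \<open>Q\<close>.\<close>
    have "compose (carrier Q) (\<lambda>v\<in>carrier V. v) \<zeta> = \<zeta>" if "\<zeta> \<in> carrier (?F V)" for \<zeta>
      using coinduction.carrierD(1,2)[OF co[OF 3] sub[OF 3 that]]
      by (intro extensionalityI[of _ "carrier Q"]) (auto simp: compose_def)
    then show ?case unfolding Ind_map_def by (intro restrict_ext)
  next
    case (4 V W X f g)
    show ?case
    proof (rule extensionalityI[of _ "carrier (?F V)"])
      fix \<zeta> assume \<zeta>: "\<zeta> \<in> carrier (?F V)"
      have "compose (carrier Q) (compose (carrier V) g f) \<zeta> = compose (carrier Q) g (compose (carrier Q) f \<zeta>)"
        using coinduction.carrierD(1)[OF co[OF 4(1)] sub[OF 4(1) \<zeta>]] by (auto simp: compose_def)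
      then show "Ind_map m n P Q K V X (compose (carrier V) g f) \<zeta>
          = compose (carrier (?F V)) (Ind_map m n P Q K W X g) (Ind_map m n P Q K V W f) \<zeta>"
        using \<zeta> img[OF 4(1,2,4) \<zeta>] by (simp add: ap compose_eq)
    qed (auto simp: Ind_map_def)
  next
    case (5 V W f g)
    show ?case
    proof (rule extensionalityI[of _ "carrier (?F V)"])
      fix \<zeta> assume \<zeta>: "\<zeta> \<in> carrier (?F V)"
      have "compose (carrier Q) (\<lambda>v\<in>carrier V. f v \<oplus>\<^bsub>W\<^esub> g v) \<zeta>
          = compose (carrier Q) f \<zeta> \<oplus>\<^bsub>?F W\<^esub> compose (carrier Q) g \<zeta>"
        using coinduction.carrierD(1)[OF co[OF 5(1)] sub[OF 5(1) \<zeta>]]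
        by (auto simp: compose_def Ind_simps coind_simps(3))
      then show "Ind_map m n P Q K V W (\<lambda>v\<in>carrier V. f v \<oplus>\<^bsub>W\<^esub> g v) \<zeta>
          = (\<lambda>z\<in>carrier (?F V). Ind_map m n P Q K V W f z \<oplus>\<^bsub>?F W\<^esub> Ind_map m n P Q K V W g z) \<zeta>"
        using \<zeta> by (simp add: ap)
    qed (auto simp: Ind_map_def)
  next
    case (6 A B C f g)
    let ?\<Phi> = "Ind_map m n P Q K A B f" and ?\<Psi> = "Ind_map m n P Q K B C g"
    interpret f: uq_map m n Q K "coind P Q A" "coind P Q B"
      "restrict (compose (carrier Q) f) (carrier (coind P Q A))" by (rule um_map[OF 6(1,2,4)])
    have inj: "inj_on (compose (carrier Q) f) (carrier (coind P Q A))"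
      using coinduction_map.push_inj[OF cm[OF 6(1,2,4)]] 6(6) by (simp add: left_exact_seq_def)
    have gf: "g (f v) = \<zero>\<^bsub>C\<^esub>" if "v \<in> carrier A" for v
      using 6(6) that by (auto simp: left_exact_seq_def)
    show ?case
      unfolding left_exact_seq_def
    proof (intro conjI equalityI subsetI)
      show "inj_on ?\<Phi> (carrier (?F A))"
        using inj sub[OF 6(1)] by (auto simp: inj_on_def ap)
    next
      fix \<xi> assume "\<xi> \<in> ?\<Phi> ` carrier (?F A)"
      then obtain \<zeta> where \<zeta>: "\<zeta> \<in> carrier (?F A)" "\<xi> = compose (carrier Q) f \<zeta>"
        by (auto simp: ap)
      have "compose (carrier Q) g \<xi> = \<zero>\<^bsub>?F C\<^esub>"
        using coinduction.carrierD(1)[OF co[OF 6(1)] sub[OF 6(1) \<zeta>(1)]]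
        by (auto simp: \<zeta>(2) compose_def gf Ind_simps coind_simps(2))
      then show "\<xi> \<in> {b \<in> carrier (?F B). ?\<Psi> b = \<zero>\<^bsub>?F C\<^esub>}"
        using img[OF 6(1,2,4) \<zeta>(1)] \<zeta>(2) by (simp add: ap)
    next
      fix \<xi> assume "\<xi> \<in> {b \<in> carrier (?F B). ?\<Psi> b = \<zero>\<^bsub>?F C\<^esub>}"
      then have \<xi>: "\<xi> \<in> carrier (?F B)" "compose (carrier Q) g \<xi> = \<zero>\<^bsub>coind P Q C\<^esub>"
        by (auto simp: ap Ind_simps)
      obtain \<eta> where \<eta>: "\<eta> \<in> carrier (coind P Q A)" "compose (carrier Q) f \<eta> = \<xi>"
        using coind_left_exact[OF cm[OF 6(1,2,4)] cm[OF 6(2,3,5)] 6(6) sub[OF 6(2) \<xi>(1)] \<xi>(2)] by blast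
      \<comment> \<open>So far the lift is known to lie in the full coinduced module only. Its image
        lies in the largest submodule for \<open>B\<close>, and injectivity places it in the one for
        \<open>A\<close>.\<close>
      have "\<eta> \<in> carrier (?F A)"
        unfolding Ind_simps
      proof (rule f.cat_part_preimage)
        show "inj_on (restrict (compose (carrier Q) f) (carrier (coind P Q A))) (carrier (coind P Q A))"
          using inj by (simp add: inj_on_def)
      qed (use \<eta> \<xi>(1) in \<open>auto simp: Ind_simps\<close>)
      then show "\<xi> \<in> ?\<Phi> ` carrier (?F A)" using \<eta>(2) ap by force
    qed
  qed
qed

end
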